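(* Fix $c>0$, $u_{X_1}\ge0$, $0\le a_i\le b_i\le1$ and boxes $B_i=\{x\in\mathcal{D}_0:\underline{x}_{ji}\le x_j\le\bar x_{ji},j=1,\dots,d\}$ ($i=1,\dots,n$, $x_{j0}\le\underline{x}_{ji}\le\bar x_{ji}\le\infty$), and $S=\{x\in\mathcal{D}_0:g_1(x_2,\dots,x_d)\le x_1\le g_2(x_2,\dots,x_d)\}$ with measurable $g_1\le g_2$ from $[x_{20},\infty)\times\cdots\times[x_{d0},\infty)$ to $[x_{10},\infty]$. The 1-POU-DRO problem is: maximize $P(S)$ over finite measures $P$ on $\mathcal{D}_0$ such that $P(\mathcal{D}_0)=c$, $P/c$ is 1-POU about $x_0$, $P(\{x_1=x_{10}\})=0$, $f_{X_1}(x_{10})\le u_{X_1}$, and $a_ic\le P(B_i)\le b_ic$ for $i=1,\dots,n$. This problem is equivalent to (has the same optimal value as) the moment problem: maximize $c\,E_Q\big[\frac{\min(g_2(Z_2,\dots,Z_d),Z_1)-\min(g_1(Z_2,\dots,Z_d),Z_1)}{Z_1-x_{10}}\big]$ over probability distributions $Q$ of $Z=(Z_1,\dots,Z_d)\in\mathcal{D}_0$ subject to $E_Q[1/(Z_1-x_{10})]\le u_{X_1}/c$ and $a_i\le E_Q\big[\frac{\min(Z_1,\bar x_{1i})-\min(Z_1,\underline{x}_{1i})}{Z_1-x_{10}}I(\underline{x}_{ji}\le Z_j\le\bar x_{ji},j\ge2)\big]\le b_i$ for $i=1,\dots,n$. Moreover, if $Q^*$ is optimal for the moment problem and $Z^*\sim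 Q^*$, then $cP^*$ is optimal for the 1-POU-DRO problem, where $P^*$ is the distribution of $(x_{10}+U(Z_1^*-x_{10}),Z_2^*,\dots,Z_d^* )$ with $U$ uniform on $(0,1)$ independent of $Z^*$.
   Context: $x_0\in\mathbb{R}\times[-\infty,\infty)^{d-1}$, $\mathcal{D}_0=\{x\ge x_0\}$ (componentwise). A measurable $K\subset\mathcal{D}_0$ is 1-POU about $x_0$ if $x\in K$, $x_1\ge x'_1\ge x_{10}$, $x'_i=x_i$ ($i\ge2$) imply $x'\in K$; a probability distribution on $\mathcal{D}_0$ is 1-POU about $x_0$ if it lies in the closed (weak topology) convex hull of uniform distributions on 1-POU subsets of $\mathcal{D}_0$. $f_{X_1}$ denotes a density on $[x_{10},\infty)$ of the measure $A\mapsto P(\{x\in\mathcal{D}_0:x_1\in A\})$ chosen continuous at $x_{10}$ (such a density exists for 1-POU $P$ with $P(\{x_1=x_{10}\})=0$, and its value at $x_{10}$ is uniquely determined). Conventions: ratios with denominator $Z_1-x_{10}=0$ are $+\infty$ in the first constraint. *)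

theory Defs
  imports "HOL-Probability.Probability"
begin

text \<open>Points of R x [-inf,inf)^(d-1) are represented as functions nat => ereal,
  extensional on {1..d}; component 1 is finite on the domain D0.\<close>

definition amb :: "nat \<Rightarrow> (nat \<Rightarrow> ereal) measure" where
  "amb d = PiM {1..d} (\<lambda>_. (borel :: ereal measure))"

definition D0 :: "nat \<Rightarrow> (nat \<Rightarrow> ereal) \<Rightarrow> (nat \<Rightarrow> ereal) set" where
  "D0 d x0 = {x \<in> space (amb d). \<forall>j\<in>{1..d}. x0 j \<le> x j \<and> x j < \<infinity>}"

definition M0 :: "nat \<Rightarrow> (nat \<Rightarrow> ereal) \<Rightarrow> (nat \<Rightarrow> ereal) measure" where
  "M0 d x0 = restrict_space (amb d) (D0 d x0)"

definition emb :: "nat \<Rightarrow> (nat \<Rightarrow> real) \<Rightarrow> (nat \<Rightarrow> ereal)" where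
  "emb d y = (\<lambda>j\<in>{1..d}. ereal (y j))"

text \<open>Lebesgue measure on D0 (points with an infinite coordinate are null).\<close>
definition Leb0 :: "nat \<Rightarrow> (nat \<Rightarrow> ereal) \<Rightarrow> (nat \<Rightarrow> ereal) measure" where
  "Leb0 d x0 = distr (restrict_space (PiM {1..d} (\<lambda>_. lborel))
      {y \<in> space (PiM {1..d} (\<lambda>_. (lborel :: real measure))). emb d y \<in> D0 d x0})
      (M0 d x0) (emb d)"

definition POU_set :: "nat \<Rightarrow> (nat \<Rightarrow> ereal) \<Rightarrow> (nat \<Rightarrow> ereal) set \<Rightarrow> bool" where
  "POU_set d x0 K \<longleftrightarrow> K \<in> sets (M0 d x0) \<and>
     (\<forall>x\<in>K. \<forall>t. x0 1 \<le> t \<and> t \<le> x 1 \<longrightarrow> x(1 := t) \<in> K)"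

definition unif_POU :: "nat \<Rightarrow> (nat \<Rightarrow> ereal) \<Rightarrow> (nat \<Rightarrow> ereal) measure set" where
  "unif_POU d x0 = {uniform_measure (Leb0 d x0) K | K. POU_set d x0 K \<and>
      0 < emeasure (Leb0 d x0) K \<and> emeasure (Leb0 d x0) K < \<infinity>}"

definition mixture :: "'a measure \<Rightarrow> (real \<times> 'a measure) list \<Rightarrow> 'a measure" where
  "mixture M ps = measure_of (space M) (sets M)
     (\<lambda>A. \<Sum>(w, Q)\<leftarrow>ps. ennreal w * emeasure Q A)"

definition conv_hull_meas :: "'a measure \<Rightarrow> 'a measure set \<Rightarrow> 'a measure set" where
  "conv_hull_meas M C = {mixture M ps | ps. ps \<noteq> [] \<and>
      (\<forall>(w, Q)\<in>set ps. 0 \<le> w \<and> Q \<in> C) \<and> (\<Sum>(w, Q)\<leftarrow>ps. w) = 1}"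

definition weak_closure :: "'a::topological_space measure \<Rightarrow> 'a set \<Rightarrow> 'a measure set \<Rightarrow> 'a measure set" where
  "weak_closure M X C = {P. prob_space P \<and> sets P = sets M \<and>
     (\<forall>F (\<epsilon>::real). finite F \<and> \<epsilon> > 0 \<and>
        (\<forall>f\<in>F. continuous_on X f \<and> bounded (f ` X) \<and> f \<in> borel_measurable M) \<longrightarrow>
        (\<exists>Q\<in>C. \<forall>f\<in>F. \<bar>(\<integral>x. f x \<partial>P) - (\<integral>x. f x \<partial>Q)\<bar> < \<epsilon>))}"

definition is_1POU :: "nat \<Rightarrow> (nat \<Rightarrow> ereal) \<Rightarrow> (nat \<Rightarrow> ereal) measure \<Rightarrow> bool" where
  "is_1POU d x0 P \<longleftrightarrow> prob_space P \<and> sets P = sets (M0 d x0) \<and>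
     P \<in> weak_closure (M0 d x0) (D0 d x0) (conv_hull_meas (M0 d x0) (unif_POU d x0))"

definition X1_density_bound :: "nat \<Rightarrow> (nat \<Rightarrow> ereal) \<Rightarrow> (nat \<Rightarrow> ereal) measure \<Rightarrow> real \<Rightarrow> bool" where
  "X1_density_bound d x0 P u \<longleftrightarrow> (\<exists>f :: real \<Rightarrow> real. f \<in> borel_measurable borel \<and>
     (\<forall>t\<ge>real_of_ereal (x0 1). 0 \<le> f t) \<and>
     (\<forall>A\<in>sets borel. A \<subseteq> {real_of_ereal (x0 1)..} \<longrightarrow>
        emeasure P {x \<in> D0 d x0. real_of_ereal (x 1) \<in> A} = (\<integral>\<^sup>+ t\<in>A. ennreal (f t) \<partial>lborel)) \<and>
     continuous (at (real_of_ereal (x0 1)) within {real_of_ereal (x0 1)..}) f \<and>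
     f (real_of_ereal (x0 1)) \<le> u)"

definition box :: "nat \<Rightarrow> (nat \<Rightarrow> ereal) \<Rightarrow> (nat \<Rightarrow> nat \<Rightarrow> ereal) \<Rightarrow> (nat \<Rightarrow> nat \<Rightarrow> ereal) \<Rightarrow> nat \<Rightarrow> (nat \<Rightarrow> ereal) set" where
  "box d x0 lo hi i = {x \<in> D0 d x0. \<forall>j\<in>{1..d}. lo i j \<le> x j \<and> x j \<le> hi i j}"

definition Sset :: "nat \<Rightarrow> (nat \<Rightarrow> ereal) \<Rightarrow> ((nat \<Rightarrow> ereal) \<Rightarrow> ereal) \<Rightarrow> ((nat \<Rightarrow> ereal) \<Rightarrow> ereal) \<Rightarrow> (nat \<Rightarrow> ereal) set" where
  "Sset d x0 g1 g2 = {x \<in> D0 d x0. g1 (restrict x {2..d}) \<le> x 1 \<and> x 1 \<le> g2 (restrict x {2..d})}"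

definition DRO_feasible :: "nat \<Rightarrow> nat \<Rightarrow> (nat \<Rightarrow> ereal) \<Rightarrow> real \<Rightarrow> real \<Rightarrow> (nat \<Rightarrow> real) \<Rightarrow> (nat \<Rightarrow> real)
    \<Rightarrow> (nat \<Rightarrow> nat \<Rightarrow> ereal) \<Rightarrow> (nat \<Rightarrow> nat \<Rightarrow> ereal) \<Rightarrow> (nat \<Rightarrow> ereal) measure set" where
  "DRO_feasible d n x0 c u a b lo hi = {P. sets P = sets (M0 d x0) \<and> finite_measure P \<and>
     emeasure P (D0 d x0) = ennreal c \<and>
     is_1POU d x0 (scale_measure (ennreal (1 / c)) P) \<and>
     emeasure P {x \<in> D0 d x0. x 1 = x0 1} = 0 \<and>
     X1_density_bound d x0 P u \<and>
     (\<forall>i\<in>{1..n}. a i * c \<le> measure P (box d x0 lo hi i) \<and> measure P (box d x0 lo hi i) \<le> b i * c)}"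

definition obj_ratio :: "nat \<Rightarrow> (nat \<Rightarrow> ereal) \<Rightarrow> ((nat \<Rightarrow> ereal) \<Rightarrow> ereal) \<Rightarrow> ((nat \<Rightarrow> ereal) \<Rightarrow> ereal) \<Rightarrow> (nat \<Rightarrow> ereal) \<Rightarrow> real" where
  "obj_ratio d x0 g1 g2 z =
     (real_of_ereal (min (g2 (restrict z {2..d})) (z 1)) - real_of_ereal (min (g1 (restrict z {2..d})) (z 1)))
     / (real_of_ereal (z 1) - real_of_ereal (x0 1))"

definition inv_gap :: "(nat \<Rightarrow> ereal) \<Rightarrow> (nat \<Rightarrow> ereal) \<Rightarrow> ennreal" where
  "inv_gap x0 z = (if z 1 = x0 1 then \<infinity> else ennreal (1 / (real_of_ereal (z 1) - real_of_ereal (x0 1))))"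

definition box_ratio :: "nat \<Rightarrow> (nat \<Rightarrow> ereal) \<Rightarrow> (nat \<Rightarrow> nat \<Rightarrow> ereal) \<Rightarrow> (nat \<Rightarrow> nat \<Rightarrow> ereal) \<Rightarrow> nat \<Rightarrow> (nat \<Rightarrow> ereal) \<Rightarrow> real" where
  "box_ratio d x0 lo hi i z =
     (real_of_ereal (min (z 1) (hi i 1)) - real_of_ereal (min (z 1) (lo i 1)))
     / (real_of_ereal (z 1) - real_of_ereal (x0 1))
     * (if \<forall>j\<in>{2..d}. lo i j \<le> z j \<and> z j \<le> hi i j then 1 else 0)"

definition MOM_feasible :: "nat \<Rightarrow> nat \<Rightarrow> (nat \<Rightarrow> ereal) \<Rightarrow> real \<Rightarrow> real \<Rightarrow> (nat \<Rightarrow> real) \<Rightarrow> (nat \<Rightarrow> real)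
    \<Rightarrow> (nat \<Rightarrow> nat \<Rightarrow> ereal) \<Rightarrow> (nat \<Rightarrow> nat \<Rightarrow> ereal) \<Rightarrow> (nat \<Rightarrow> ereal) measure set" where
  "MOM_feasible d n x0 c u a b lo hi = {Q. prob_space Q \<and> sets Q = sets (M0 d x0) \<and>
     (\<integral>\<^sup>+ z. inv_gap x0 z \<partial>Q) \<le> ennreal (u / c) \<and>
     (\<forall>i\<in>{1..n}. a i \<le> (\<integral>z. box_ratio d x0 lo hi i z \<partial>Q) \<and> (\<integral>z. box_ratio d x0 lo hi i z \<partial>Q) \<le> b i)}"

definition MOM_obj :: "nat \<Rightarrow> (nat \<Rightarrow> ereal) \<Rightarrow> real \<Rightarrow> ((nat \<Rightarrow> ereal) \<Rightarrow> ereal) \<Rightarrow> ((nat \<Rightarrow> ereal) \<Rightarrow> ereal) \<Rightarrow> (nat \<Rightarrow> ereal) measure \<Rightarrow> real" where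
  "MOM_obj d x0 c g1 g2 Q = c * (\<integral>z. obj_ratio d x0 g1 g2 z \<partial>Q)"

definition lift_dist :: "nat \<Rightarrow> (nat \<Rightarrow> ereal) \<Rightarrow> (nat \<Rightarrow> ereal) measure \<Rightarrow> (nat \<Rightarrow> ereal) measure" where
  "lift_dist d x0 Q = distr (Q \<Otimes>\<^sub>M uniform_measure lborel {0<..<1}) (M0 d x0)
     (\<lambda>(z, v). z(1 := ereal (real_of_ereal (x0 1) + v * (real_of_ereal (z 1) - real_of_ereal (x0 1)))))"

end

(* The lift sends Q to the law P of (x10 + U (Z1 - x10), Z2, ..., Zd). Conditioning on Z turns
   P-probabilities of boxes and of S into the ratios of the moment problem, and the density of X1 at
   x10 is E_Q[1 / (Z1 - x10)]. So it suffices that the lift maps the feasible laws of the moment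
   problem onto the normalised feasible measures of the robust problem.

   Lifts are 1-POU: approximate Q by finitely supported laws, and the lift of a point mass by the
   uniform laws on boxes that shrink to a segment.

   Every 1-POU law P without mass at x1 = x10 is a lift: contracting the first coordinate towards x10
   by a factor k maps a 1-POU set into itself, so k P(contraction in A) <= P(A). This inequality is
   stable under mixtures and weak limits. Averaging it over k gives a density f with respect to
   Lebesgue measure times the law of the other coordinates, and f is nonincreasing in the first
   coordinate. By the layer cake formula, P is then the mixture of the uniform laws on the superlevel
   segments {f > r}, each weighted by its length. *)
theory Submission
  imports Defs
begin

section \<open>Khinchin's representation along fibres\<close>

text \<open>A 1-POU law is given only as a weak limit, so neither a density nor a mixing law can be
  read off from its definition. The contraction inequality serves as an intermediate notion: it
  speaks of the law alone, and once its two sides are written as integrals of a continuous function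
  and of its composition with the (continuous) contraction, it is a closed condition. Going back
  from continuous functions to Borel sets uses inner regularity, hence a Polish space; the domain,
  whose points may have coordinates -\<infinity>, is therefore embedded in the real sequences. On
  each fibre the inequality is the hypothesis of Khinchin's theorem on unimodal laws. Absence of
  mass at x1 = x10 is what lets the averaging over k produce a density: a point at height 0 is fixed
  by every contraction. In the other direction the approximating boxes have positive volume only
  over a segment of positive length, which the constraint on 1 / (Z1 - x10) guarantees almost
  surely.\<close>

lemma nn_integral_rescale_unit_interval:
  fixes g :: "real \<Rightarrow> ennreal"
  assumes "g \<in> borel_measurable borel" "0 \<le> z"
  shows "ennreal z * (\<integral>\<^sup>+v. g (v * z) * indicator {0<..<1} v \<partial>lborel)
    = (\<integral>\<^sup>+t. g t * indicator {0<..<z} t \<partial>lborel)"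
proof (cases "z = 0")
  case False
  with assms have z: "0 < z" by simp
  have [measurable]: "g \<in> borel_measurable borel" by fact
  have "(\<integral>\<^sup>+t. g t * indicator {0<..<z} t \<partial>lborel)
      = ennreal \<bar>z\<bar> * (\<integral>\<^sup>+v. g (0 + z * v) * indicator {0<..<z} (0 + z * v) \<partial>lborel)"
    by (rule nn_integral_real_affine) (use z in auto)
  also have "(\<lambda>v. g (0 + z * v) * indicator {0<..<z} (0 + z * v))
      = (\<lambda>v. g (v * z) * indicator {0<..<1} v)"
    using z by (auto simp: fun_eq_iff indicator_def mult.commute zero_less_mult_iff)
  finally show ?thesis using z by simp
qed auto

text \<open>If t is in \<open>E\<close> and almost all contractions of t are too, then
  \<open>E\<close> fills (0, t) up to a null set, so t is at most the length m of \<open>E\<close>.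
  Hence \<open>E\<close> lies almost everywhere in (0, m), and a subset of full length misses only a
  null set. The almost-everywhere form is forced by densities being known only up to null
  sets.\<close>

lemma AE_initial_segment:
  fixes E :: "real set"
  assumes E[measurable]: "E \<in> sets borel" and pos: "E \<subseteq> {0<..}" and fin: "emeasure lborel E < \<infinity>"
    and down: "AE t in lborel. t \<in> E \<longrightarrow> (AE k in lborel. 0 < k \<and> k < 1 \<longrightarrow> k * t \<in> E)"
  shows "AE t in lborel. t \<in> E \<longleftrightarrow> 0 < t \<and> t < measure lborel E"
proof -
  define m where "m = measure lborel E"
  have m: "emeasure lborel E = ennreal m" "0 \<le> m"
    using fin unfolding m_def by (auto simp: emeasure_eq_ennreal_measure less_top)
  have le: "t \<le> m" if t: "t \<in> E" and d: "AE k in lborel. 0 < k \<and> k < 1 \<longrightarrow> k * t \<in> E" for t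
  proof -
    have t0: "0 < t" using t pos by auto
    have "AE s in lborel. 0 < 0 + (1/t) * s \<and> 0 + (1/t) * s < 1 \<longrightarrow> (0 + (1/t) * s) * t \<in> E"
      by (rule AE_borel_affine[where P="\<lambda>k. 0 < k \<and> k < 1 \<longrightarrow> k * t \<in> E"]) (use t0 d in auto)
    then have "AE s in lborel. s \<in> {0<..<t} \<longrightarrow> s \<in> E"
      by eventually_elim (use t0 in \<open>auto simp: field_simps\<close>)
    then have "emeasure lborel {0<..<t} \<le> emeasure lborel E"
      by (intro emeasure_mono_AE) auto
    then show ?thesis using m t0 by simp
  qed
  \<comment> \<open>\<open>le\<close> only gives t <= m; dropping the single point m makes the
    inequality strict.\<close>
  have "AE t in lborel. t \<noteq> m" by (rule AE_lborel_singleton)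
  with down have sub: "AE t in lborel. t \<in> E \<longrightarrow> 0 < t \<and> t < m"
  proof eventually_elim
    case (elim t)
    then show ?case using le[of t] pos by auto
  qed
  have eq: "emeasure lborel (E \<inter> {0<..<m}) = ennreal m"
    unfolding m(1)[symmetric] by (intro emeasure_eq_AE) (use sub in auto)
  have "emeasure lborel ({0<..<m} - (E \<inter> {0<..<m})) = emeasure lborel {0<..<m} - emeasure lborel (E \<inter> {0<..<m})"
    by (intro emeasure_Diff) (auto simp: eq)
  also have "\<dots> = 0" unfolding eq using m by simp
  finally have "{0<..<m} - (E \<inter> {0<..<m}) \<in> null_sets lborel" by (intro null_setsI) auto
  then have "AE t in lborel. t \<notin> {0<..<m} - (E \<inter> {0<..<m})" by (rule AE_not_in)
  with sub show ?thesis unfolding m_def[symmetric] by eventually_elim auto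
qed

text \<open>Test on the set where the claim fails. Finiteness of the integral of \<open>f\<close>
  makes the subtraction of the two integrals legitimate in \<open>ennreal\<close>.\<close>

lemma AE_le_if_set_nn_integral_le:
  fixes f g :: "'a \<Rightarrow> ennreal"
  assumes [measurable]: "f \<in> borel_measurable M" "g \<in> borel_measurable M"
    and fin: "(\<integral>\<^sup>+x. f x \<partial>M) < \<infinity>"
    and le: "\<And>A. A \<in> sets M \<Longrightarrow> (\<integral>\<^sup>+x. f x * indicator A x \<partial>M) \<le> (\<integral>\<^sup>+x. g x * indicator A x \<partial>M)"
  shows "AE x in M. f x \<le> g x"
proof -
  define A where "A = {x \<in> space M. g x < f x}"
  have [measurable]: "A \<in> sets M" unfolding A_def by measurable
  have gf: "g x * indicator A x \<le> f x * indicator A x" for x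
    by (auto simp: A_def indicator_def)
  have "(\<integral>\<^sup>+x. f x * indicator A x \<partial>M) \<le> (\<integral>\<^sup>+x. f x \<partial>M)"
    by (intro nn_integral_mono) (auto simp: indicator_def)
  with fin have finA: "(\<integral>\<^sup>+x. f x * indicator A x \<partial>M) < \<infinity>" by (rule le_less_trans[rotated])
  have finG: "(\<integral>\<^sup>+x. g x * indicator A x \<partial>M) < \<infinity>"
    using nn_integral_mono[of M "\<lambda>x. g x * indicator A x" "\<lambda>x. f x * indicator A x"] gf finA
    by (meson le_less_trans)
  have "(\<integral>\<^sup>+x. f x * indicator A x - g x * indicator A x \<partial>M)
      = (\<integral>\<^sup>+x. f x * indicator A x \<partial>M) - (\<integral>\<^sup>+x. g x * indicator A x \<partial>M)"
    by (intro nn_integral_diff) (use finG gf in auto)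
  also have "\<dots> = 0" using le[of A] finA by (simp add: diff_eq_0_iff_ennreal)
  finally have "AE x in M. f x * indicator A x - g x * indicator A x = 0"
    by (subst (asm) nn_integral_0_iff_AE) auto
  moreover have "AE x in M. f x < \<infinity>"
    using fin nn_integral_PInf_AE[of f M] by (auto simp: less_top)
  ultimately show ?thesis
    using AE_space
  proof eventually_elim
    case (elim x)
    then show ?case
      by (cases "x \<in> A") (auto simp: A_def diff_eq_0_iff_ennreal)
  qed
qed

text \<open>Layer cake for a single value. The value may be infinite, because a Radon-Nikodym
  derivative takes values in \<open>ennreal\<close>.\<close>

lemma emeasure_lborel_ray_below:
  "emeasure lborel {r::real. 0 < r \<and> ennreal r < x} = x"
proof (cases x)
  case (real a)
  then have "{r::real. 0 < r \<and> ennreal r < x} = {0<..<a}" by (auto simp: ennreal_less_iff)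
  then show ?thesis using real by simp
next
  case top
  have "(of_nat n :: ennreal) \<le> emeasure lborel {0::real<..}" for n
  proof -
    have "emeasure lborel {0<..<real n} \<le> emeasure lborel {0::real<..}" by (intro emeasure_mono) auto
    then show ?thesis by (simp add: ennreal_of_nat_eq_real_of_nat)
  qed
  then have "emeasure lborel {0::real<..} = \<infinity>"
    by (metis ennreal_SUP_of_nat_eq_top SUP_least infinity_ennreal_def neq_top_trans)
  moreover have "{r::real. 0 < r \<and> ennreal r < x} = {0<..}" using top by auto
  ultimately show ?thesis using top by simp
qed

text \<open>Over a one-point space this is Khinchin's theorem: a law on the positive reals with k
  mu(A) <= mu(k A) for 0 < k < 1 is the law of U Z, with U uniform on (0, 1) and independent of Z.
  One joint density on the product, instead of conditional laws on the fibres, keeps everything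
  jointly measurable over an arbitrary measurable space.\<close>

lemma khinchin_fibrewise:
  fixes N :: "'a measure" and mu :: "('a \<times> real) measure"
  assumes prob: "prob_space mu" and sets_mu: "sets mu = sets (N \<Otimes>\<^sub>M borel)"
    and pos: "AE p in mu. 0 < snd p"
    and shrink: "\<And>k A. 0 < k \<Longrightarrow> k < 1 \<Longrightarrow> A \<in> sets (N \<Otimes>\<^sub>M borel) \<Longrightarrow>
      ennreal k * emeasure mu A \<le> emeasure mu {p \<in> space (N \<Otimes>\<^sub>M borel). (fst p, snd p / k) \<in> A}"
  obtains Q where "prob_space Q" "sets Q = sets (N \<Otimes>\<^sub>M borel)" "AE p in Q. 0 < snd p"
    "\<And>A. A \<in> sets (N \<Otimes>\<^sub>M borel) \<Longrightarrow> emeasure mu A =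
      (\<integral>\<^sup>+p. (\<integral>\<^sup>+v. indicator A (fst p, v * snd p) * indicator {0<..<1} v \<partial>lborel) \<partial>Q)"
proof -
  interpret mu: prob_space mu by fact
  define nu where "nu = distr mu N fst"
  note sets_mu[measurable_cong]
  have fst_mu: "fst \<in> measurable mu N" by measurable
  interpret nu: prob_space nu unfolding nu_def by (rule mu.prob_space_distr) (rule fst_mu)
  have sets_nu[measurable_cong, simp]: "sets nu = sets N" by (simp add: nu_def)
  have space_mu: "space mu = space (N \<Otimes>\<^sub>M borel)" by (rule sets_eq_imp_space_eq) fact
  have space_nu: "space nu = space N" by (simp add: nu_def)
  interpret pair_sigma_finite nu "lborel :: real measure" ..
  let ?R = "nu \<Otimes>\<^sub>M (lborel :: real measure)"
  have sigma_finite_R: "sigma_finite_measure ?R"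
    by (rule sigma_finite_pair_measure) (standard)+
  have sets_R: "sets ?R = sets (N \<Otimes>\<^sub>M borel)" by (rule sets_pair_measure_cong) auto
  have space_R: "space ?R = space (N \<Otimes>\<^sub>M borel)" by (rule sets_eq_imp_space_eq) (rule sets_R)

  \<comment> \<open>Average over k = 1 / l with 1 < l < 2. For \<open>mu\<close>-almost every (y, s)
    the slice of \<open>A\<close> over y is Lebesgue null, hence so is the set of l with (y, l s) in
    \<open>A\<close>, because s > 0. The interval of l has length 1 and keeps k above 1 / 2, so half
    of the mass of \<open>A\<close> is bounded by a vanishing integral.\<close>
  have null: "emeasure mu A = 0" if A: "A \<in> null_sets ?R" for A
  proof -
    have [measurable]: "A \<in> sets (N \<Otimes>\<^sub>M borel)" using A sets_R by auto
    have "AE p in ?R. p \<notin> A" by (rule AE_not_in) fact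
    then have "AE y in nu. AE t in lborel. (y, t) \<notin> A" by (rule AE_pair)
    then have "AE p in mu. AE t in lborel. (fst p, t) \<notin> A"
      unfolding nu_def by (rule AE_distrD[OF fst_mu])
    then have zero: "AE p in mu. (\<integral>\<^sup>+l. indicator A (fst p, l * snd p) * indicator {1<..<2} l \<partial>lborel) = 0"
      using pos AE_space
    proof eventually_elim
      case (elim p)
      then have [measurable]: "fst p \<in> space N" by (auto simp: space_mu space_pair_measure)
      have "AE l in lborel. (fst p, 0 + snd p * l) \<notin> A"
        by (rule AE_borel_affine[where P="\<lambda>t. (fst p, t) \<notin> A"]) (use elim in auto)
      then have "(\<integral>\<^sup>+l. indicator A (fst p, l * snd p) * indicator {1<..<2} l \<partial>lborel) = (\<integral>\<^sup>+l. 0 \<partial>(lborel::real measure))"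
        by (intro nn_integral_cong_AE) (auto simp: mult.commute)
      then show ?case by simp
    qed
    have half: "ennreal (1/2) * emeasure mu A \<le> (\<integral>\<^sup>+p. indicator A (fst p, l * snd p) \<partial>mu)" if l: "1 < l" "l < 2" for l
    proof -
      have "ennreal (1/2) * emeasure mu A \<le> ennreal (1/l) * emeasure mu A"
        by (intro mult_right_mono ennreal_leI) (use l in \<open>auto simp: field_simps\<close>)
      also have "\<dots> \<le> emeasure mu {p \<in> space (N \<Otimes>\<^sub>M borel). (fst p, snd p / (1 / l)) \<in> A}"
        by (rule shrink) (use l in auto)
      also have "\<dots> = (\<integral>\<^sup>+p. indicator {p \<in> space (N \<Otimes>\<^sub>M borel). (fst p, snd p / (1 / l)) \<in> A} p \<partial>mu)"
        by (rule nn_integral_indicator[symmetric]) (simp add: sets_mu, measurable)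
      also have "\<dots> = (\<integral>\<^sup>+p. indicator A (fst p, l * snd p) \<partial>mu)"
        by (rule nn_integral_cong) (auto simp: indicator_def space_mu mult.commute)
      finally show ?thesis .
    qed
    have "ennreal (1/2) * emeasure mu A = (\<integral>\<^sup>+l. ennreal (1/2) * emeasure mu A * indicator {1<..<2::real} l \<partial>lborel)"
      by (subst nn_integral_cmult_indicator) auto
    also have "\<dots> \<le> (\<integral>\<^sup>+l. (\<integral>\<^sup>+p. indicator A (fst p, l * snd p) * indicator {1<..<2} l \<partial>mu) \<partial>lborel)"
      by (intro nn_integral_mono) (use half in \<open>auto simp: indicator_def\<close>)
    also have "\<dots> = (\<integral>\<^sup>+p. (\<integral>\<^sup>+l. indicator A (fst p, l * snd p) * indicator {1<..<2} l \<partial>lborel) \<partial>mu)"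
    proof -
      interpret L: pair_sigma_finite "lborel :: real measure" mu ..
      show ?thesis by (rule L.Fubini'[symmetric]) measurable
    qed
    also have "\<dots> = (\<integral>\<^sup>+p. 0 \<partial>mu)" by (rule nn_integral_cong_AE) (rule zero)
    finally show ?thesis by simp
  qed
  have ac: "absolutely_continuous ?R mu" unfolding absolutely_continuous_def
  proof
    fix A assume A: "A \<in> null_sets ?R"
    show "A \<in> null_sets mu"
      using null_setsD2[OF A] by (intro null_setsI null[OF A]) (simp only: sets_mu sets_R)
  qed
  define f where "f = RN_deriv ?R mu"
  have f_R: "f \<in> borel_measurable ?R" by (simp add: f_def)
  then have f[measurable]: "f \<in> borel_measurable (N \<Otimes>\<^sub>M borel)"
    by (simp add: measurable_cong_sets[OF sets_R refl])
  have mu_dens: "density ?R f = mu" unfolding f_def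
    by (rule sigma_finite_measure.density_RN_deriv[OF sigma_finite_R ac]) (simp add: sets_mu sets_R)
  have mu_f: "emeasure mu A = (\<integral>\<^sup>+p. f p * indicator A p \<partial>?R)" if "A \<in> sets (N \<Otimes>\<^sub>M borel)" for A
    using that by (subst mu_dens[symmetric], subst emeasure_density) (auto simp: f_R sets_R)
  have f_fin: "(\<integral>\<^sup>+p. f p \<partial>?R) = 1"
  proof -
    have "1 = emeasure mu (space mu)" by (simp add: mu.emeasure_space_1)
    also have "\<dots> = (\<integral>\<^sup>+p. f p * indicator (space mu) p \<partial>?R)" by (rule mu_f) (simp add: space_mu)
    also have "\<dots> = (\<integral>\<^sup>+p. f p \<partial>?R)" by (intro nn_integral_cong) (simp add: space_mu space_R[symmetric])
    finally show ?thesis by simp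
  qed

  \<comment> \<open>For densities the contraction inequality loses its factor: substituting k s for
    s produces the same k on the right-hand side.\<close>
  have mono_k: "AE p in ?R. f p \<le> f (fst p, k * snd p)" if k: "0 < k" "k < 1" for k
  proof (rule AE_le_if_set_nn_integral_le)
    show "(\<integral>\<^sup>+p. f p \<partial>?R) < \<infinity>" using f_fin by simp
    fix A assume "A \<in> sets ?R"
    then have A[measurable]: "A \<in> sets (N \<Otimes>\<^sub>M borel)" by (simp only: sets_R)
    have "ennreal k * (\<integral>\<^sup>+p. f p * indicator A p \<partial>?R) = ennreal k * emeasure mu A" by (simp add: mu_f)
    also have "\<dots> \<le> emeasure mu {p \<in> space (N \<Otimes>\<^sub>M borel). (fst p, snd p / k) \<in> A}"
      by (rule shrink) (use k in auto)
    also have "\<dots> = (\<integral>\<^sup>+p. f p * indicator {p \<in> space (N \<Otimes>\<^sub>M borel). (fst p, snd p / k) \<in> A} p \<partial>?R)"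
      by (rule mu_f) measurable
    also have "\<dots> = (\<integral>\<^sup>+p. f p * indicator A (fst p, snd p / k) \<partial>?R)"
      by (rule nn_integral_cong) (auto simp: indicator_def space_R)
    also have "\<dots> = (\<integral>\<^sup>+y. (\<integral>\<^sup>+s. f (y, s) * indicator A (y, s / k) \<partial>lborel) \<partial>nu)"
      by (subst lborel.nn_integral_fst[symmetric]) auto
    also have "\<dots> = (\<integral>\<^sup>+y. ennreal k * (\<integral>\<^sup>+s. f (y, k * s) * indicator A (y, s) \<partial>lborel) \<partial>nu)"
    proof (rule nn_integral_cong)
      fix y assume "y \<in> space nu"
      then have [measurable]: "y \<in> space N" by (simp add: space_nu)
      have "(\<integral>\<^sup>+s. f (y, s) * indicator A (y, s / k) \<partial>lborel)
          = ennreal \<bar>k\<bar> * (\<integral>\<^sup>+s. f (y, 0 + k * s) * indicator A (y, (0 + k * s) / k) \<partial>lborel)"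
        by (rule nn_integral_real_affine) (use k in auto)
      then show "(\<integral>\<^sup>+s. f (y, s) * indicator A (y, s / k) \<partial>lborel)
          = ennreal k * (\<integral>\<^sup>+s. f (y, k * s) * indicator A (y, s) \<partial>lborel)" using k by simp
    qed
    also have "\<dots> = ennreal k * (\<integral>\<^sup>+y. (\<integral>\<^sup>+s. f (y, k * s) * indicator A (y, s) \<partial>lborel) \<partial>nu)"
      by (rule nn_integral_cmult) measurable
    also have "(\<integral>\<^sup>+y. (\<integral>\<^sup>+s. f (y, k * s) * indicator A (y, s) \<partial>lborel) \<partial>nu)
        = (\<integral>\<^sup>+p. f (fst p, k * snd p) * indicator A p \<partial>?R)"
      by (subst lborel.nn_integral_fst[symmetric]) auto
    finally show "(\<integral>\<^sup>+p. f p * indicator A p \<partial>?R) \<le> (\<integral>\<^sup>+p. f (fst p, k * snd p) * indicator A p \<partial>?R)"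
      using k by (simp add: ennreal_mult_le_mult_iff)
  qed (use f in measurable)

  \<comment> \<open>The exceptional null set in \<open>mono_k\<close> depends on k. Exchanging the
    quantifiers by Fubini leaves one null set of fibres, outside of which the inequality holds for
    almost all t and k.\<close>
  have "AE y in nu. AE t in lborel. AE k in lborel. 0 < k \<and> k < 1 \<longrightarrow> f (y, t) \<le> f (y, k * t)"
  proof -
    interpret L: pair_sigma_finite "lborel :: real measure" ?R
      by (intro pair_sigma_finite.intro sigma_finite_R) (standard)
    have "AE k in lborel. AE p in ?R. 0 < k \<and> k < 1 \<longrightarrow> f p \<le> f (fst p, k * snd p)"
      using mono_k by auto
    moreover have "Measurable.pred (lborel \<Otimes>\<^sub>M ?R)
        (\<lambda>x. 0 < fst x \<and> fst x < 1 \<longrightarrow> f (snd x) \<le> f (fst (snd x), fst x * snd (snd x)))"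
      by measurable
    ultimately have "AE p in ?R. AE k in lborel. 0 < k \<and> k < 1 \<longrightarrow> f p \<le> f (fst p, k * snd p)"
      by (subst (asm) L.AE_commute) (simp_all only: pred_def)
    then have "AE y in nu. AE t in lborel. AE k in lborel. 0 < k \<and> k < 1 \<longrightarrow> f (y, t) \<le> f (fst (y, t), k * snd (y, t))"
      by (rule AE_pair)
    then show ?thesis by simp
  qed
  moreover have "AE y in nu. (\<integral>\<^sup>+t. f (y, t) \<partial>lborel) \<noteq> \<infinity>"
    by (rule nn_integral_PInf_AE) (auto simp: lborel.nn_integral_fst[of "\<lambda>p. f p", OF f_R] f_fin)
  ultimately have good: "AE y in nu. y \<in> space N \<and> (\<integral>\<^sup>+t. f (y, t) \<partial>lborel) \<noteq> \<infinity> \<and>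
      (AE t in lborel. AE k in lborel. 0 < k \<and> k < 1 \<longrightarrow> f (y, t) \<le> f (y, k * t))"
    using AE_space by eventually_elim (auto simp: space_nu)

  \<comment> \<open>Length of the superlevel set at level r, forced into the reals. On the fibres
    singled out by \<open>good\<close> it is finite for every r > 0, by Markov's inequality.\<close>
  define Z where "Z y r = enn2real (\<integral>\<^sup>+s. (if 0 < s \<and> ennreal r < f (y, s) then 1 else 0) \<partial>lborel)" for y and r :: real
  have Z[measurable]: "case_prod Z \<in> borel_measurable (N \<Otimes>\<^sub>M borel)" unfolding Z_def by measurable
  have Z0: "0 \<le> Z y r" for y r by (simp add: Z_def)
  have seg: "AE s in lborel. 0 < s \<and> ennreal r < f (y, s) \<longleftrightarrow> 0 < s \<and> s < Z y r"
    if y: "y \<in> space N" "(\<integral>\<^sup>+t. f (y, t) \<partial>lborel) \<noteq> \<infinity>"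
      "AE t in lborel. AE k in lborel. 0 < k \<and> k < 1 \<longrightarrow> f (y, t) \<le> f (y, k * t)" and r: "0 < r" for y r
  proof -
    note y(1)[measurable]
    define E where "E = {s. 0 < s \<and> ennreal r < f (y, s)}"
    have E[measurable]: "E \<in> sets borel" unfolding E_def by measurable
    have "(\<integral>\<^sup>+s. (if 0 < s \<and> ennreal r < f (y, s) then 1 else 0) \<partial>lborel) = (\<integral>\<^sup>+s. indicator E s \<partial>lborel)"
      by (intro nn_integral_cong) (auto simp: E_def)
    then have ZE: "Z y r = measure lborel E" by (simp add: Z_def measure_def)
    have "ennreal r * emeasure lborel E = (\<integral>\<^sup>+s. ennreal r * indicator E s \<partial>lborel)"
      by (simp add: nn_integral_cmult_indicator)
    also have "\<dots> \<le> (\<integral>\<^sup>+t. f (y, t) \<partial>lborel)"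
      by (intro nn_integral_mono) (auto simp: E_def indicator_def)
    finally have "ennreal r * emeasure lborel E < \<infinity>" using y(2) by (auto simp: top.not_eq_extremum intro: le_less_trans)
    then have fin: "emeasure lborel E < \<infinity>" using r by (auto simp: ennreal_mult_less_top)
    have "AE t in lborel. t \<in> E \<longleftrightarrow> 0 < t \<and> t < measure lborel E"
    proof (rule AE_initial_segment[OF E _ fin])
      show "E \<subseteq> {0<..}" by (auto simp: E_def)
      show "AE t in lborel. t \<in> E \<longrightarrow> (AE k in lborel. 0 < k \<and> k < 1 \<longrightarrow> k * t \<in> E)"
        using y(3)
      proof eventually_elim
        case (elim t)
        show ?case
        proof
          assume t: "t \<in> E"
          show "AE k in lborel. 0 < k \<and> k < 1 \<longrightarrow> k * t \<in> E"
            using elim by eventually_elim (use t in \<open>auto simp: E_def\<close>)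
        qed
      qed
    qed
    then show ?thesis by (simp add: ZE E_def)
  qed

  \<comment> \<open>The weight \<open>Z y r\<close> of a level cancels the factor 1 / Z in the
    density of the uniform law on its segment. Mixing the segments thus integrates the indicator of
    r < f (y, s) over r, which returns f (y, s).\<close>
  define D where "D = density ?R (\<lambda>(y, r). indicator {0<..} r * ennreal (Z y r))"
  define Q where "Q = distr D (N \<Otimes>\<^sub>M borel) (\<lambda>(y, r). (y, Z y r))"
  have Qint: "(\<integral>\<^sup>+p. F p \<partial>Q) = (\<integral>\<^sup>+y. (\<integral>\<^sup>+r. indicator {0<..} r * (ennreal (Z y r) * F (y, Z y r)) \<partial>lborel) \<partial>nu)"
    if [measurable]: "F \<in> borel_measurable (N \<Otimes>\<^sub>M borel)" for F
  proof -
    have "(\<integral>\<^sup>+p. F p \<partial>Q) = (\<integral>\<^sup>+p. F (case p of (y, r) \<Rightarrow> (y, Z y r)) \<partial>D)"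
      unfolding Q_def D_def by (intro nn_integral_distr) measurable
    also have "\<dots> = (\<integral>\<^sup>+p. (case p of (y, r) \<Rightarrow> indicator {0<..} r * ennreal (Z y r)) * F (case p of (y, r) \<Rightarrow> (y, Z y r)) \<partial>?R)"
      unfolding D_def by (intro nn_integral_density) measurable
    also have "\<dots> = (\<integral>\<^sup>+y. (\<integral>\<^sup>+r. indicator {0<..} r * (ennreal (Z y r) * F (y, Z y r)) \<partial>lborel) \<partial>nu)"
      by (subst lborel.nn_integral_fst[symmetric]) (auto simp: mult.assoc)
    finally show ?thesis .
  qed
  have key: "emeasure mu A =
      (\<integral>\<^sup>+p. (\<integral>\<^sup>+v. indicator A (fst p, v * snd p) * indicator {0<..<1} v \<partial>lborel) \<partial>Q)"
    if A[measurable]: "A \<in> sets (N \<Otimes>\<^sub>M borel)" for A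
  proof -
    have "(\<integral>\<^sup>+p. (\<integral>\<^sup>+v. indicator A (fst p, v * snd p) * indicator {0<..<1} v \<partial>lborel) \<partial>Q)
      = (\<integral>\<^sup>+y. (\<integral>\<^sup>+r. indicator {0<..} r * (ennreal (Z y r) * 
          (\<integral>\<^sup>+v. indicator A (y, v * Z y r) * indicator {0<..<1} v \<partial>lborel)) \<partial>lborel) \<partial>nu)"
      by (subst Qint) auto
    \<comment> \<open>The segments contain only positive heights, so the mixture sees only that part
      of \<open>A\<close>; \<open>pos\<close> restores all of \<open>A\<close> at the end.\<close>
    also have "\<dots> = (\<integral>\<^sup>+y. (\<integral>\<^sup>+s. f (y, s) * indicator (A \<inter> {p\<in>space mu. 0 < snd p}) (y, s) \<partial>lborel) \<partial>nu)"
    proof (rule nn_integral_cong_AE, use good in eventually_elim)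
      case (elim y)
      then have [measurable]: "y \<in> space N" by simp
      have "(\<integral>\<^sup>+r. indicator {0<..} r * (ennreal (Z y r) * 
          (\<integral>\<^sup>+v. indicator A (y, v * Z y r) * indicator {0<..<1} v \<partial>lborel)) \<partial>lborel)
        = (\<integral>\<^sup>+r. indicator {0<..} r * (\<integral>\<^sup>+s. indicator A (y, s) * indicator {0<..<Z y r} s \<partial>lborel) \<partial>lborel)"
        by (subst nn_integral_rescale_unit_interval[where g="\<lambda>s. indicator A (y, s)"]) (auto simp: Z0)
      also have "\<dots> = (\<integral>\<^sup>+r. (\<integral>\<^sup>+s. indicator A (y, s) * (if 0 < r \<and> 0 < s \<and> ennreal r < f (y, s) then 1 else 0) \<partial>lborel) \<partial>lborel)"
      proof (rule nn_integral_cong)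
        fix r :: real
        show "indicator {0<..} r * (\<integral>\<^sup>+s. indicator A (y, s) * indicator {0<..<Z y r} s \<partial>lborel)
          = (\<integral>\<^sup>+s. indicator A (y, s) * (if 0 < r \<and> 0 < s \<and> ennreal r < f (y, s) then 1 else 0) \<partial>lborel)"
        proof (cases "0 < r")
          case True
          have "AE s in lborel. 0 < s \<and> ennreal r < f (y, s) \<longleftrightarrow> 0 < s \<and> s < Z y r"
            by (rule seg) (use elim True in auto)
          then have "(\<integral>\<^sup>+s. indicator A (y, s) * indicator {0<..<Z y r} s \<partial>lborel)
            = (\<integral>\<^sup>+s. indicator A (y, s) * (if 0 < r \<and> 0 < s \<and> ennreal r < f (y, s) then 1 else 0) \<partial>lborel)"
            by (intro nn_integral_cong_AE, eventually_elim) (auto simp: True indicator_def)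
          then show ?thesis using True by simp
        qed simp
      qed
      \<comment> \<open>After the exchange s is fixed, and the levels below f (y, s) have total
        length f (y, s).\<close>
      also have "\<dots> = (\<integral>\<^sup>+s. (\<integral>\<^sup>+r. indicator A (y, s) * (if 0 < r \<and> 0 < s \<and> ennreal r < f (y, s) then 1 else 0) \<partial>lborel) \<partial>lborel)"
        by (rule lborel_pair.Fubini') measurable
      also have "\<dots> = (\<integral>\<^sup>+s. f (y, s) * indicator (A \<inter> {p\<in>space mu. 0 < snd p}) (y, s) \<partial>lborel)"
      proof (rule nn_integral_cong)
        fix s :: real
        have "(\<integral>\<^sup>+r. indicator A (y, s) * (if 0 < r \<and> 0 < s \<and> ennreal r < f (y, s) then 1 else 0) \<partial>lborel)
          = (\<integral>\<^sup>+r. (indicator A (y, s) * indicator {0<..} s) * indicator {r. 0 < r \<and> ennreal r < f (y, s)} r \<partial>lborel)"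
          by (intro nn_integral_cong) (auto simp: indicator_def)
        also have "\<dots> = (indicator A (y, s) * indicator {0<..} s) * f (y, s)"
          by (subst nn_integral_cmult_indicator) (auto simp: emeasure_lborel_ray_below)
        also have "\<dots> = f (y, s) * indicator (A \<inter> {p\<in>space mu. 0 < snd p}) (y, s)"
          using elim by (auto simp: indicator_def space_mu space_pair_measure)
        finally show "(\<integral>\<^sup>+r. indicator A (y, s) * (if 0 < r \<and> 0 < s \<and> ennreal r < f (y, s) then 1 else 0) \<partial>lborel)
          = f (y, s) * indicator (A \<inter> {p\<in>space mu. 0 < snd p}) (y, s)" .
      qed
      finally show ?case .
    qed
    also have "\<dots> = (\<integral>\<^sup>+p. f p * indicator (A \<inter> {p\<in>space mu. 0 < snd p}) p \<partial>?R)"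
      unfolding space_mu by (subst lborel.nn_integral_fst[symmetric]) auto
    also have "\<dots> = emeasure mu (A \<inter> {p\<in>space mu. 0 < snd p})"
      unfolding space_mu by (intro mu_f[symmetric]) measurable
    also have "\<dots> = emeasure mu A"
      using pos AE_space by (intro emeasure_eq_AE) (auto simp: sets_mu space_mu)
    finally show ?thesis by simp
  qed
  have sets_Q: "sets Q = sets (N \<Otimes>\<^sub>M borel)" by (simp add: Q_def)
  have space_Q: "space Q = space (N \<Otimes>\<^sub>M borel)" by (simp add: Q_def)
  show thesis
  proof (rule that)
    show "prob_space Q"
    proof
      have "1 = emeasure mu (space (N \<Otimes>\<^sub>M borel))" using mu.emeasure_space_1 by (simp add: space_mu)
      also have "\<dots> = (\<integral>\<^sup>+p. (\<integral>\<^sup>+v. indicator (space (N \<Otimes>\<^sub>M borel)) (fst p, v * snd p) * indicator {0<..<1} v \<partial>lborel) \<partial>Q)"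
        by (rule key) auto
      also have "\<dots> = (\<integral>\<^sup>+p. 1 \<partial>Q)"
        by (rule nn_integral_cong) (auto simp: space_Q space_pair_measure)
      finally show "emeasure Q (space Q) = 1" by simp
    qed
    show "AE p in Q. 0 < snd p"
    proof -
      \<comment> \<open>\<open>D\<close> has the factor \<open>Z\<close> in its density, so it gives
        no mass to the pairs with \<open>Z y r = 0\<close>.\<close>
      have "(\<integral>\<^sup>+p. indicator {p\<in>space (N \<Otimes>\<^sub>M borel). \<not> 0 < snd p} p \<partial>Q) = 0"
        by (subst Qint) (auto simp: indicator_def Z0 not_less intro!: nn_integral_zero' AE_I2 split: if_splits dest: order_antisym[OF _ Z0])
      then have "emeasure Q {p\<in>space (N \<Otimes>\<^sub>M borel). \<not> 0 < snd p} = 0"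
        by (subst (asm) nn_integral_indicator) (auto simp: sets_Q)
      then show ?thesis by (intro AE_I'[OF null_setsI]) (auto simp: sets_Q space_Q)
    qed
  qed (use sets_Q key in auto)
qed

section \<open>The lift\<close>

text \<open>The distinguished coordinate is written \<open>1\<close>; rewriting it to
  \<open>Suc 0\<close> would keep the rules about \<open>x 1\<close> from matching.\<close>

declare One_nat_def [simp del]

text \<open>For v < 1 the point r + v h stays below r + h, so both bounds may be cut off at r + h.
  Being at least r, they are real after the cut, even if \<alpha> or \<beta> is infinite. The
  quotient is the length of the resulting interval of v, hence between 0 and 1.\<close>

lemma nn_integral_unit_interval_fraction:
  fixes \<alpha> \<beta> :: ereal
  assumes \<alpha>: "ereal r \<le> \<alpha>" "\<alpha> \<le> \<beta>" and h: "0 < h"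
  shows "(\<integral>\<^sup>+v. indicator {v. \<alpha> \<le> ereal (r + v * h) \<and> ereal (r + v * h) \<le> \<beta>} v * indicator {0<..<1} v \<partial>lborel)
    = ennreal ((real_of_ereal (min \<beta> (ereal (r + h))) - real_of_ereal (min \<alpha> (ereal (r + h)))) / h)"
    and "0 \<le> (real_of_ereal (min \<beta> (ereal (r + h))) - real_of_ereal (min \<alpha> (ereal (r + h)))) / h"
    and "(real_of_ereal (min \<beta> (ereal (r + h))) - real_of_ereal (min \<alpha> (ereal (r + h)))) / h \<le> 1"
proof -
  have fin: "\<exists>a. min \<gamma> (ereal (r + h)) = ereal a" if "ereal r \<le> \<gamma>" for \<gamma>
  proof -
    have "ereal r \<le> min \<gamma> (ereal (r + h))" "min \<gamma> (ereal (r + h)) \<le> ereal (r + h)" using that h by auto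
    then show ?thesis by (cases "min \<gamma> (ereal (r + h))") auto
  qed
  obtain a where a: "min \<alpha> (ereal (r + h)) = ereal a" using fin \<alpha> by blast
  obtain b where b: "min \<beta> (ereal (r + h)) = ereal b" using fin \<alpha> by (meson order_trans)
  have "ereal r \<le> min \<alpha> (ereal (r + h))" using \<alpha> h by simp
  then have ra: "r \<le> a" using a by simp
  have "min \<alpha> (ereal (r + h)) \<le> min \<beta> (ereal (r + h))" using \<alpha> by (intro min.mono) auto
  then have ab: "a \<le> b" using a b by simp
  have "min \<beta> (ereal (r + h)) \<le> ereal (r + h)" by simp
  then have bh: "b \<le> r + h" using b by simp
  have iffa: "\<alpha> \<le> ereal (r + v * h) \<longleftrightarrow> a \<le> r + v * h" if "v < 1" for v
  proof -
    have "r + v * h < r + h" using that h by simp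
    then have "\<alpha> \<le> ereal (r + v * h) \<longleftrightarrow> min \<alpha> (ereal (r + h)) \<le> ereal (r + v * h)"
      by (auto simp: min_le_iff_disj)
    then show ?thesis by (simp add: a)
  qed
  have iffb: "ereal (r + v * h) \<le> \<beta> \<longleftrightarrow> r + v * h \<le> b" if "v < 1" for v
  proof -
    have "r + v * h < r + h" using that h by simp
    then have "ereal (r + v * h) \<le> \<beta> \<longleftrightarrow> ereal (r + v * h) \<le> min \<beta> (ereal (r + h))" by auto
    then show ?thesis by (simp add: b)
  qed
  \<comment> \<open>The closed interval of v may contain 0 or 1, which the open unit interval
    omits.\<close>
  have "AE v in lborel. v \<noteq> (0::real)" "AE v in lborel. v \<noteq> (1::real)" by (auto intro: AE_lborel_singleton)
  then have "AE v in lborel. indicator {v. \<alpha> \<le> ereal (r + v * h) \<and> ereal (r + v * h) \<le> \<beta>} v * indicator {0<..<1} v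
      = (indicator {(a - r) / h .. (b - r) / h} v :: ennreal)"
  proof eventually_elim
    case (elim v)
    have le: "0 \<le> (a - r) / h" "(b - r) / h \<le> 1" using ra bh h by (auto simp: field_simps)
    show ?case
    proof (cases "0 < v \<and> v < 1")
      case True
      then have "(a - r) / h \<le> v \<and> v \<le> (b - r) / h \<longleftrightarrow> \<alpha> \<le> ereal (r + v * h) \<and> ereal (r + v * h) \<le> \<beta>"
        using iffa[of v] iffb[of v] True
        by (simp add: pos_divide_le_eq[OF h] pos_le_divide_eq[OF h] diff_le_eq le_diff_eq add.commute)
      then show ?thesis using True by (auto simp: indicator_def)
    next
      case False
      then have "\<not> ((a - r) / h \<le> v \<and> v \<le> (b - r) / h)" using elim le by auto
      then show ?thesis using False by (auto simp: indicator_def)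
    qed
  qed
  then have "(\<integral>\<^sup>+v. indicator {v. \<alpha> \<le> ereal (r + v * h) \<and> ereal (r + v * h) \<le> \<beta>} v * indicator {0<..<1} v \<partial>lborel)
      = (\<integral>\<^sup>+v. indicator {(a - r) / h .. (b - r) / h} v \<partial>lborel)"
    by (rule nn_integral_cong_AE)
  also have "\<dots> = ennreal ((b - a) / h)" using ab h by (simp add: divide_right_mono diff_divide_distrib)
  finally show "(\<integral>\<^sup>+v. indicator {v. \<alpha> \<le> ereal (r + v * h) \<and> ereal (r + v * h) \<le> \<beta>} v * indicator {0<..<1} v \<partial>lborel)
    = ennreal ((real_of_ereal (min \<beta> (ereal (r + h))) - real_of_ereal (min \<alpha> (ereal (r + h)))) / h)"
    by (simp add: a b)
  show "0 \<le> (real_of_ereal (min \<beta> (ereal (r + h))) - real_of_ereal (min \<alpha> (ereal (r + h)))) / h"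
    "(real_of_ereal (min \<beta> (ereal (r + h))) - real_of_ereal (min \<alpha> (ereal (r + h)))) / h \<le> 1"
    unfolding a b using ra ab bh h by (auto simp: field_simps)
qed

section \<open>Coordinates on the domain: foot and height\<close>

locale pou =
  fixes d :: nat and x0 :: "nat \<Rightarrow> ereal"
  assumes d: "1 \<le> d" and x0_1: "\<bar>x0 1\<bar> \<noteq> \<infinity>"
begin

abbreviation "r0 \<equiv> real_of_ereal (x0 1)"

text \<open>With the first coordinate measured from its lower end, contraction towards x10 becomes
  multiplication of the height, and \<open>raise\<close> moves a point along its fibre.\<close>

definition height :: "(nat \<Rightarrow> ereal) \<Rightarrow> real" where
  "height x = real_of_ereal (x 1) - r0"

definition raise :: "(nat \<Rightarrow> ereal) \<Rightarrow> real \<Rightarrow> (nat \<Rightarrow> ereal)" where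
  "raise y s = y(1 := ereal (r0 + s))"

lemma ereal_r0 [simp]: "ereal r0 = x0 1"
  using x0_1 by (simp add: ereal_real)

lemma coords_eq: "{1..d} = insert 1 {2..d}"
  using d by auto

lemma space_amb: "space (amb d) = {1..d} \<rightarrow>\<^sub>E UNIV"
  by (simp add: amb_def space_PiM)

lemma measurable_coord_amb: "j \<in> {1..d} \<Longrightarrow> (\<lambda>x. x j) \<in> borel_measurable (amb d)"
  unfolding amb_def by (rule measurable_component_singleton)

lemma sets_D0: "D0 d x0 \<in> sets (amb d)"
proof -
  have [measurable]: "\<And>j. j \<in> {1..d} \<Longrightarrow> (\<lambda>x. x j) \<in> borel_measurable (amb d)"
    by (rule measurable_coord_amb)
  show ?thesis unfolding D0_def by measurable
qed

lemma space_M0: "space (M0 d x0) = D0 d x0"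
  by (auto simp: M0_def space_restrict_space D0_def)

lemma sets_M0_iff: "A \<in> sets (M0 d x0) \<longleftrightarrow> A \<subseteq> D0 d x0 \<and> A \<in> sets (amb d)"
  unfolding M0_def by (rule sets_restrict_space_iff) (use sets_D0 in \<open>simp add: sets.Int\<close>)

lemma measurable_M0I:
  "f \<in> measurable M (amb d) \<Longrightarrow> (\<And>x. x \<in> space M \<Longrightarrow> f x \<in> D0 d x0) \<Longrightarrow> f \<in> measurable M (M0 d x0)"
  unfolding M0_def by (rule measurable_restrict_space2) auto

lemma measurable_M0_amb: "(\<lambda>x. x) \<in> measurable (M0 d x0) (amb d)"
  unfolding M0_def by (rule measurable_restrict_space1) simp

lemma measurable_coord: "j \<in> {1..d} \<Longrightarrow> (\<lambda>x. x j) \<in> borel_measurable (M0 d x0)"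
  using measurable_compose[OF measurable_M0_amb measurable_coord_amb] .

lemma measurable_coord_1 [measurable]: "(\<lambda>x. x 1) \<in> borel_measurable (M0 d x0)" 
  by (rule measurable_coord) (use d in auto)

lemma measurable_height [measurable]: "height \<in> borel_measurable (M0 d x0)"
  unfolding height_def by measurable

text \<open>The codomain is \<open>amb d\<close> because a negative \<open>g p\<close> leads out of
  \<open>D0 d x0\<close>.\<close>

lemma measurable_raise_amb:
  assumes "f \<in> measurable M (M0 d x0)" "g \<in> borel_measurable M"
  shows "(\<lambda>p. raise (f p) (g p)) \<in> measurable M (amb d)"
  unfolding raise_def amb_def
proof (rule measurable_fun_upd[where J="{1..d}"])
  show "f \<in> measurable M (Pi\<^sub>M {1..d} (\<lambda>_. borel))"
    unfolding amb_def[symmetric] by (rule measurable_compose[OF assms(1) measurable_M0_amb])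
qed (use assms(2) d in auto)

lemma D0_D: "x \<in> D0 d x0 \<Longrightarrow> j \<in> {1..d} \<Longrightarrow> x0 j \<le> x j \<and> x j < \<infinity>"
  by (auto simp: D0_def)

lemma D0_coord_1:
  assumes "x \<in> D0 d x0"
  shows "x 1 = ereal (r0 + height x)" and "0 \<le> height x"
proof -
  have "ereal r0 \<le> x 1" "x 1 < \<infinity>" using D0_D[OF assms, of 1] d by auto
  then obtain t where "x 1 = ereal t" "r0 \<le> t" by (cases "x 1") (auto simp del: ereal_r0)
  then show "x 1 = ereal (r0 + height x)" "0 \<le> height x" by (auto simp: height_def)
qed

lemma height_0_iff: "x \<in> D0 d x0 \<Longrightarrow> height x = 0 \<longleftrightarrow> x 1 = x0 1"
  using D0_coord_1(1)[of x] ereal_r0 by (metis add.right_neutral add_left_cancel ereal.inject)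

lemma raise_in_D0 [simp]:
  assumes "y \<in> D0 d x0" "0 \<le> s" shows "raise y s \<in> D0 d x0"
proof -
  have "ereal r0 \<le> ereal (r0 + s)" using assms(2) by (simp del: ereal_r0)
  then show ?thesis using assms(1) d by (auto simp: D0_def raise_def space_amb PiE_iff extensional_def)
qed

lemma height_raise [simp]: "height (raise y s) = s"
  by (simp add: height_def raise_def)

lemma raise_raise [simp]: "raise (raise y s) t = raise y t"
  by (simp add: raise_def)

lemma raise_height [simp]: "x \<in> D0 d x0 \<Longrightarrow> raise x (height x) = x"
  using D0_coord_1(1)[of x] by (auto simp: raise_def)

lemma measurable_raise:
  assumes "f \<in> measurable M (M0 d x0)" "g \<in> borel_measurable M" "\<And>x. x \<in> space M \<Longrightarrow> 0 \<le> g x"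
  shows "(\<lambda>p. raise (f p) (g p)) \<in> measurable M (M0 d x0)"
proof (rule measurable_M0I)
  fix x assume x: "x \<in> space M"
  have "f x \<in> D0 d x0" using measurable_space[OF assms(1) x] by (simp add: space_M0)
  then show "raise (f x) (g x) \<in> D0 d x0" using assms(3)[OF x] by simp
qed (rule measurable_raise_amb[OF assms(1,2)])

text \<open>Cutting off at 0 makes the map total on the domain, as measurability into
  \<open>M0 d x0\<close> demands. In the uses below the argument is almost surely nonnegative, so
  the cut changes nothing there.\<close>

lemma measurable_raise_max [measurable]:
  "f \<in> measurable M (M0 d x0) \<Longrightarrow> g \<in> borel_measurable M \<Longrightarrow>
    (\<lambda>p. raise (f p) (max 0 (g p))) \<in> measurable M (M0 d x0)"
  by (rule measurable_raise) auto

section \<open>The lift as an image measure\<close>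

abbreviation "UU \<equiv> uniform_measure lborel {0<..<1::real}"

lemma prob_UU: "prob_space UU"
  by (rule prob_space_uniform_measure) auto

lemma AE_UU: "AE v in UU. 0 < v \<and> v < 1"
  by (rule AE_uniform_measureI) auto

lemma nn_integral_UU: "f \<in> borel_measurable borel \<Longrightarrow>
    (\<integral>\<^sup>+v. f v \<partial>UU) = (\<integral>\<^sup>+v. f v * indicator {0<..<1} v \<partial>lborel)"
  by (subst nn_integral_uniform_measure) (auto simp: divide_ennreal_def)

definition lift_map :: "(nat \<Rightarrow> ereal) \<times> real \<Rightarrow> (nat \<Rightarrow> ereal)" where
  "lift_map = (\<lambda>(z, v). raise z (max 0 (v * height z)))"

lemma measurable_lift_map [measurable]: "lift_map \<in> measurable (M0 d x0 \<Otimes>\<^sub>M borel) (M0 d x0)"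
  unfolding lift_map_def by measurable

text \<open>The map in the definition of the lift leaves the domain when its second argument is outside
  the unit interval, so it has to be replaced by a measurable version first.\<close>

lemma lift_dist_eq:
  assumes Q: "prob_space Q" "sets Q = sets (M0 d x0)"
  shows "lift_dist d x0 Q = distr (Q \<Otimes>\<^sub>M UU) (M0 d x0) lift_map"
proof -
  interpret Q: prob_space Q by fact
  interpret U: prob_space UU by (rule prob_UU)
  interpret pair_prob_space Q UU ..
  note Q(2)[measurable_cong]
  have sets_UU[measurable_cong]: "sets UU = sets borel" by simp
  let ?T = "\<lambda>(z, v). z(1 := ereal (r0 + v * (real_of_ereal (z 1) - r0)))"
  have space_Q: "space Q = D0 d x0" using sets_eq_imp_space_eq[OF Q(2)] by (simp add: space_M0)
  have T_raise: "?T = (\<lambda>p. raise (fst p) (snd p * height (fst p)))"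
    by (rule ext) (simp only: raise_def height_def split_beta)
  have T_amb: "?T \<in> measurable (Q \<Otimes>\<^sub>M UU) (amb d)"
    unfolding T_raise by (rule measurable_raise_amb) measurable
  have "AE p in Q \<Otimes>\<^sub>M UU. 0 < snd p"
  proof (rule AE_pair_measure)
    show "{x \<in> space (Q \<Otimes>\<^sub>M UU). 0 < snd x} \<in> sets (Q \<Otimes>\<^sub>M UU)" by measurable
    show "AE x in Q. AE y in UU. 0 < snd (x, y)" using AE_UU by auto
  qed
  then have eq: "AE p in Q \<Otimes>\<^sub>M UU. ?T p = lift_map p"
    using AE_space
  proof eventually_elim
    case (elim p)
    then have "fst p \<in> D0 d x0" "0 < snd p" by (auto simp: space_pair_measure space_Q)
    then have "0 \<le> snd p * height (fst p)" using D0_coord_1(2)[of "fst p"] by simp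
    then show ?case by (simp only: T_raise lift_map_def split_beta max_absorb2)
  qed
  have em: "emeasure (Q \<Otimes>\<^sub>M UU) (?T -` A \<inter> space (Q \<Otimes>\<^sub>M UU))
      = emeasure (Q \<Otimes>\<^sub>M UU) (lift_map -` A \<inter> space (Q \<Otimes>\<^sub>M UU))" if "A \<in> sets (M0 d x0)" for A
  proof (rule emeasure_eq_AE)
    show "AE x in Q \<Otimes>\<^sub>M UU. (x \<in> ?T -` A \<inter> space (Q \<Otimes>\<^sub>M UU)) = (x \<in> lift_map -` A \<inter> space (Q \<Otimes>\<^sub>M UU))"
      using eq by eventually_elim (simp only: vimage_eq Int_iff)
    show "?T -` A \<inter> space (Q \<Otimes>\<^sub>M UU) \<in> sets (Q \<Otimes>\<^sub>M UU)"
      using that by (intro measurable_sets[OF T_amb]) (simp only: sets_M0_iff)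
    show "lift_map -` A \<inter> space (Q \<Otimes>\<^sub>M UU) \<in> sets (Q \<Otimes>\<^sub>M UU)"
      by (rule measurable_sets[OF _ that]) measurable
  qed
  \<comment> \<open>The original map need not be measurable into \<open>M0 d x0\<close>, so
    \<open>emeasure_distr\<close> does not apply to it. Both image measures are compared through the
    definition of \<open>distr\<close>, as set functions that agree on the sigma-algebra.\<close>
  show ?thesis
    unfolding lift_dist_def distr_def
  proof (rule measure_of_eq)
    fix A assume "A \<in> sigma_sets (space (M0 d x0)) (sets (M0 d x0))"
    then have "A \<in> sets (M0 d x0)" by (simp only: sets.sigma_sets_eq)
    then show "emeasure (Q \<Otimes>\<^sub>M UU) (?T -` A \<inter> space (Q \<Otimes>\<^sub>M UU))
      = emeasure (Q \<Otimes>\<^sub>M UU) (lift_map -` A \<inter> space (Q \<Otimes>\<^sub>M UU))" by (rule em)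
  qed (rule sets.space_closed)
qed

lemma nn_integral_lift_dist:
  assumes Q: "prob_space Q" "sets Q = sets (M0 d x0)"
    and F[measurable]: "F \<in> borel_measurable (M0 d x0)"
  shows "(\<integral>\<^sup>+x. F x \<partial>lift_dist d x0 Q)
    = (\<integral>\<^sup>+z. (\<integral>\<^sup>+v. F (raise z (max 0 (v * height z))) * indicator {0<..<1} v \<partial>lborel) \<partial>Q)"
proof -
  interpret Q: prob_space Q by fact
  interpret U: prob_space UU by (rule prob_UU)
  note Q(2)[measurable_cong]
  have sets_UU[measurable_cong]: "sets UU = sets borel" by simp
  have "(\<integral>\<^sup>+x. F x \<partial>lift_dist d x0 Q) = (\<integral>\<^sup>+p. F (lift_map p) \<partial>(Q \<Otimes>\<^sub>M UU))"
    unfolding lift_dist_eq[OF Q] by (rule nn_integral_distr) measurable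
  also have "\<dots> = (\<integral>\<^sup>+z. (\<integral>\<^sup>+v. F (lift_map (z, v)) \<partial>UU) \<partial>Q)"
    by (rule U.nn_integral_fst[symmetric]) measurable
  also have "\<dots> = (\<integral>\<^sup>+z. (\<integral>\<^sup>+v. F (raise z (max 0 (v * height z))) * indicator {0<..<1} v \<partial>lborel) \<partial>Q)"
  proof (rule nn_integral_cong)
    fix z assume "z \<in> space Q"
    then have [measurable]: "z \<in> space (M0 d x0)" using sets_eq_imp_space_eq[OF Q(2)] by simp
    show "(\<integral>\<^sup>+v. F (lift_map (z, v)) \<partial>UU) = (\<integral>\<^sup>+v. F (raise z (max 0 (v * height z))) * indicator {0<..<1} v \<partial>lborel)"
      by (subst nn_integral_UU) (measurable, simp add: lift_map_def)
  qed
  finally show ?thesis .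
qed

lemma
  assumes Q: "prob_space Q" "sets Q = sets (M0 d x0)"
  shows prob_space_lift_dist: "prob_space (lift_dist d x0 Q)"
    and sets_lift_dist [simp]: "sets (lift_dist d x0 Q) = sets (M0 d x0)"
proof -
  interpret Q: prob_space Q by fact
  interpret U: prob_space UU by (rule prob_UU)
  interpret pair_prob_space Q UU ..
  note Q(2)[measurable_cong]
  have sets_UU[measurable_cong]: "sets UU = sets borel" by simp
  show "prob_space (lift_dist d x0 Q)"
    unfolding lift_dist_eq[OF Q] by (rule P.prob_space_distr) measurable
  show "sets (lift_dist d x0 Q) = sets (M0 d x0)" by (simp add: lift_dist_def)
qed

lemma emeasure_lift_dist:
  assumes Q: "prob_space Q" "sets Q = sets (M0 d x0)" and A: "A \<in> sets (M0 d x0)"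
  shows "emeasure (lift_dist d x0 Q) A
    = (\<integral>\<^sup>+z. (\<integral>\<^sup>+v. indicator A (raise z (v * height z)) * indicator {0<..<1} v \<partial>lborel) \<partial>Q)"
proof -
  have "emeasure (lift_dist d x0 Q) A = (\<integral>\<^sup>+x. indicator A x \<partial>lift_dist d x0 Q)"
    using A Q by simp
  also have "\<dots> = (\<integral>\<^sup>+z. (\<integral>\<^sup>+v. indicator A (raise z (max 0 (v * height z))) * indicator {0<..<1} v \<partial>lborel) \<partial>Q)"
    using A by (intro nn_integral_lift_dist[OF Q]) auto
  also have "\<dots> = (\<integral>\<^sup>+z. (\<integral>\<^sup>+v. indicator A (raise z (v * height z)) * indicator {0<..<1} v \<partial>lborel) \<partial>Q)"
    using sets_eq_imp_space_eq[OF Q(2)]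
    by (intro nn_integral_cong) (auto simp: indicator_def max_def space_M0 not_le mult_less_0_iff dest: D0_coord_1(2))
  finally show ?thesis .
qed

section \<open>Probabilities of S and of the boxes under a lift\<close>

lemma sets_Collect_D0:
  "Measurable.pred (M0 d x0) P \<Longrightarrow> {x \<in> D0 d x0. P x} \<in> sets (M0 d x0)"
  unfolding pred_def space_M0 .

lemma ereal_eq_x0_1 [simp]: "ereal t = x0 1 \<longleftrightarrow> t = r0"
  by (metis ereal.inject ereal_r0)

lemma measurable_rest:
  assumes g: "g \<in> borel_measurable (PiM {2..d} (\<lambda>_. (borel :: ereal measure)))"
  shows "(\<lambda>x. g (restrict x {2..d})) \<in> borel_measurable (M0 d x0)"
proof -
  have "(\<lambda>x. restrict x {2..d}) \<in> measurable (amb d) (PiM {2..d} (\<lambda>_. (borel :: ereal measure)))"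
    unfolding amb_def by (rule measurable_restrict_subset) auto
  from measurable_compose[OF measurable_M0_amb measurable_compose[OF this g]] show ?thesis .
qed

lemma restrict_raise [simp]: "restrict (raise y s) {2..d} = restrict y {2..d}"
  by (auto simp: raise_def restrict_def)

lemma raise_apply_1 [simp]: "raise y s 1 = ereal (r0 + s)"
  by (simp add: raise_def)

lemma raise_apply_rest [simp]: "j \<in> {2..d} \<Longrightarrow> raise y s j = y j"
  by (simp add: raise_def)

text \<open>Given Z = z, the lift spreads the first coordinate uniformly over the segment below z,
  and \<open>F z\<close> is the conditional probability of \<open>A\<close>. This is the common
  pattern for S and for the boxes.\<close>

lemma measure_lift_dist_eqI:
  assumes Q: "prob_space Q" "sets Q = sets (M0 d x0)" and A: "A \<in> sets (M0 d x0)"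
    and pos: "AE z in Q. 0 < height z"
    and F: "F \<in> borel_measurable (M0 d x0)"
    and eq: "\<And>z. z \<in> D0 d x0 \<Longrightarrow> 0 < height z \<Longrightarrow>
      (\<integral>\<^sup>+v. indicator A (raise z (v * height z)) * indicator {0<..<1} v \<partial>lborel) = ennreal (F z) \<and> 0 \<le> F z"
  shows "measure (lift_dist d x0 Q) A = (\<integral>z. F z \<partial>Q)"
proof -
  interpret Q: prob_space Q by fact
  interpret L: prob_space "lift_dist d x0 Q" using prob_space_lift_dist[OF Q] .
  note Q(2)[measurable_cong]
  have AE: "AE z in Q. z \<in> D0 d x0 \<and> 0 < height z"
    using pos AE_space by eventually_elim (use sets_eq_imp_space_eq[OF Q(2)] in \<open>simp add: space_M0\<close>)
  have "emeasure (lift_dist d x0 Q) A = (\<integral>\<^sup>+z. ennreal (F z) \<partial>Q)"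
    unfolding emeasure_lift_dist[OF Q A]
    by (rule nn_integral_cong_AE) (use AE eq in \<open>auto elim: eventually_mono\<close>)
  moreover have "AE z in Q. 0 \<le> F z" using AE by eventually_elim (use eq in auto)
  ultimately have "measure (lift_dist d x0 Q) A = (\<integral>z. F z \<partial>Q)"
    using F Q(2) by (simp add: measure_def integral_eq_nn_integral)
  then show ?thesis .
qed

lemma Sset_sets:
  assumes "g1 \<in> borel_measurable (PiM {2..d} (\<lambda>_. (borel :: ereal measure)))"
    "g2 \<in> borel_measurable (PiM {2..d} (\<lambda>_. (borel :: ereal measure)))"
  shows "Sset d x0 g1 g2 \<in> sets (M0 d x0)"
proof -
  have "{x \<in> space (M0 d x0). g1 (restrict x {2..d}) \<le> x 1}
      \<inter> {x \<in> space (M0 d x0). x 1 \<le> g2 (restrict x {2..d})} \<in> sets (M0 d x0)"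
    by (intro sets.Int borel_measurable_le measurable_rest assms measurable_coord_1)
  also have "{x \<in> space (M0 d x0). g1 (restrict x {2..d}) \<le> x 1}
      \<inter> {x \<in> space (M0 d x0). x 1 \<le> g2 (restrict x {2..d})} = Sset d x0 g1 g2"
    by (auto simp: Sset_def space_M0)
  finally show ?thesis .
qed

text \<open>Along the segment below z the coordinates 2..d stay fixed, so g1 and g2 are constant
  there and membership in S becomes an interval condition on v.\<close>

lemma measure_lift_dist_Sset:
  assumes Q: "prob_space Q" "sets Q = sets (M0 d x0)" and pos: "AE z in Q. 0 < height z"
    and g: "g1 \<in> borel_measurable (PiM {2..d} (\<lambda>_. (borel :: ereal measure)))"
      "g2 \<in> borel_measurable (PiM {2..d} (\<lambda>_. (borel :: ereal measure)))"
    and g_range: "\<forall>y\<in>PiE {2..d} (\<lambda>_. UNIV). (\<forall>j\<in>{2..d}. x0 j \<le> y j \<and> y j < \<infinity>) \<longrightarrow>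
                    x0 1 \<le> g1 y \<and> g1 y \<le> g2 y"
  shows "measure (lift_dist d x0 Q) (Sset d x0 g1 g2) = (\<integral>z. obj_ratio d x0 g1 g2 z \<partial>Q)"
proof (rule measure_lift_dist_eqI[OF Q Sset_sets[OF g] pos])
  note [measurable] = measurable_rest[OF g(1)] measurable_rest[OF g(2)]
  show "obj_ratio d x0 g1 g2 \<in> borel_measurable (M0 d x0)" unfolding obj_ratio_def by measurable
  fix z assume z: "z \<in> D0 d x0" and h: "0 < height z"
  let ?y = "restrict z {2..d}"
  have "\<forall>j\<in>{2..d}. x0 j \<le> z j \<and> z j < \<infinity>" using D0_D[OF z] by auto
  then have r: "ereal r0 \<le> g1 ?y" "g1 ?y \<le> g2 ?y" using g_range by auto
  have h_eq: "real_of_ereal (z 1) - r0 = height z" by (simp add: height_def)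
  have eq: "obj_ratio d x0 g1 g2 z = (real_of_ereal (min (g2 ?y) (ereal (r0 + height z)))
      - real_of_ereal (min (g1 ?y) (ereal (r0 + height z)))) / height z"
    unfolding obj_ratio_def h_eq D0_coord_1(1)[OF z, symmetric] ..
  have "(\<integral>\<^sup>+v. indicator (Sset d x0 g1 g2) (raise z (v * height z)) * indicator {0<..<1} v \<partial>lborel)
      = (\<integral>\<^sup>+v. indicator {v. g1 ?y \<le> ereal (r0 + v * height z) \<and> ereal (r0 + v * height z) \<le> g2 ?y} v * indicator {0<..<1} v \<partial>lborel)"
    using z h by (intro nn_integral_cong) (auto simp: indicator_def Sset_def)
  then show "(\<integral>\<^sup>+v. indicator (Sset d x0 g1 g2) (raise z (v * height z)) * indicator {0<..<1} v \<partial>lborel)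
      = ennreal (obj_ratio d x0 g1 g2 z) \<and> 0 \<le> obj_ratio d x0 g1 g2 z"
    using nn_integral_unit_interval_fraction[OF r h] by (simp add: eq)
qed

lemma box_sets: "box d x0 lo hi i \<in> sets (M0 d x0)"
proof -
  have [measurable]: "\<And>j. j \<in> {1..d} \<Longrightarrow> (\<lambda>x. x j) \<in> borel_measurable (M0 d x0)"
    by (rule measurable_coord)
  show ?thesis unfolding box_def by (intro sets_Collect_D0) measurable
qed

text \<open>Only the first coordinate varies along a segment: the conditions on the others
  contribute a factor 0 or 1, and the first one is an interval condition on v.\<close>

lemma measure_lift_dist_box:
  assumes Q: "prob_space Q" "sets Q = sets (M0 d x0)" and pos: "AE z in Q. 0 < height z"
    and i: "x0 1 \<le> lo i 1" "lo i 1 \<le> hi i 1"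
  shows "measure (lift_dist d x0 Q) (box d x0 lo hi i) = (\<integral>z. box_ratio d x0 lo hi i z \<partial>Q)"
proof (rule measure_lift_dist_eqI[OF Q box_sets pos])
  have [measurable]: "\<And>j. j \<in> {2..d} \<Longrightarrow> (\<lambda>x. x j) \<in> borel_measurable (M0 d x0)"
    by (rule measurable_coord) auto
  show "box_ratio d x0 lo hi i \<in> borel_measurable (M0 d x0)" unfolding box_ratio_def by measurable
  fix z assume z: "z \<in> D0 d x0" and h: "0 < height z"
  have r: "ereal r0 \<le> lo i 1" "lo i 1 \<le> hi i 1" using i by auto
  have h_eq: "real_of_ereal (z 1) - r0 = height z" by (simp add: height_def)
  have eq: "box_ratio d x0 lo hi i z = (real_of_ereal (min (hi i 1) (ereal (r0 + height z)))
      - real_of_ereal (min (lo i 1) (ereal (r0 + height z)))) / height z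
      * (if \<forall>j\<in>{2..d}. lo i j \<le> z j \<and> z j \<le> hi i j then 1 else 0)"
    unfolding box_ratio_def h_eq D0_coord_1(1)[OF z, symmetric] by (simp add: min.commute)
  have "(\<integral>\<^sup>+v. indicator (box d x0 lo hi i) (raise z (v * height z)) * indicator {0<..<1} v \<partial>lborel)
      = (\<integral>\<^sup>+v. (if \<forall>j\<in>{2..d}. lo i j \<le> z j \<and> z j \<le> hi i j then 1 else 0) *
        (indicator {v. lo i 1 \<le> ereal (r0 + v * height z) \<and> ereal (r0 + v * height z) \<le> hi i 1} v * indicator {0<..<1} v) \<partial>lborel)"
    using z h unfolding box_def coords_eq by (intro nn_integral_cong) (auto simp: indicator_def)
  also have "\<dots> = (if \<forall>j\<in>{2..d}. lo i j \<le> z j \<and> z j \<le> hi i j then 1 else 0) *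
     (\<integral>\<^sup>+v. indicator {v. lo i 1 \<le> ereal (r0 + v * height z) \<and> ereal (r0 + v * height z) \<le> hi i 1} v * indicator {0<..<1} v \<partial>lborel)"
    by (auto intro!: nn_integral_cong)
  finally show "(\<integral>\<^sup>+v. indicator (box d x0 lo hi i) (raise z (v * height z)) * indicator {0<..<1} v \<partial>lborel)
      = ennreal (box_ratio d x0 lo hi i z) \<and> 0 \<le> box_ratio d x0 lo hi i z"
    using nn_integral_unit_interval_fraction[OF r h] by (simp add: eq)
qed

section \<open>The density of the first coordinate at its lower end\<close>

lemma measurable_inv_gap [measurable]: "inv_gap x0 \<in> borel_measurable (M0 d x0)"
  unfolding inv_gap_def by measurable

lemma inv_gap_eq: "z \<in> D0 d x0 \<Longrightarrow> 0 < height z \<Longrightarrow> inv_gap x0 z = ennreal (1 / height z)"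
  using height_0_iff[of z] by (auto simp: inv_gap_def height_def)

text \<open>\<open>inv_gap\<close> is infinite at height 0, so a finite integral rules that height
  out almost surely.\<close>

lemma AE_height_pos:
  assumes "sets Q = sets (M0 d x0)" and "(\<integral>\<^sup>+z. inv_gap x0 z \<partial>Q) < \<infinity>"
  shows "AE z in Q. 0 < height z"
proof -
  have "inv_gap x0 \<in> borel_measurable Q" using assms(1) by (simp cong: measurable_cong_sets)
  then have "AE z in Q. inv_gap x0 z \<noteq> \<infinity>" using assms(2) by (intro nn_integral_PInf_AE) auto
  then show ?thesis using AE_space
  proof eventually_elim
    case (elim z)
    then have z: "z \<in> D0 d x0" using sets_eq_imp_space_eq[OF assms(1)] by (simp add: space_M0)
    have "height z \<noteq> 0" using elim(1) z height_0_iff by (auto simp: inv_gap_def)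
    then show ?case using D0_coord_1(2)[OF z] by simp
  qed
qed

lemma emeasure_lift_dist_bottom:
  assumes Q: "prob_space Q" "sets Q = sets (M0 d x0)" and pos: "AE z in Q. 0 < height z"
  shows "emeasure (lift_dist d x0 Q) {x \<in> D0 d x0. x 1 = x0 1} = 0"
proof -
  have "emeasure (lift_dist d x0 Q) {x \<in> D0 d x0. x 1 = x0 1} = (\<integral>\<^sup>+z. 0 \<partial>Q)"
  proof (subst emeasure_lift_dist[OF Q sets_Collect_D0], measurable, rule nn_integral_cong_AE)
    show "AE z in Q. (\<integral>\<^sup>+v. indicator {x \<in> D0 d x0. x 1 = x0 1} (raise z (v * height z)) * indicator {0<..<1} v \<partial>lborel) = 0"
      using pos
    proof eventually_elim
      case (elim z)
      have "(\<integral>\<^sup>+v. indicator {x \<in> D0 d x0. x 1 = x0 1} (raise z (v * height z)) * indicator {0<..<1} v \<partial>lborel)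
        = (\<integral>\<^sup>+v. 0 \<partial>(lborel :: real measure))"
        by (intro nn_integral_cong) (use elim in \<open>auto simp: indicator_def\<close>)
      then show ?case by simp
    qed
  qed
  then show ?thesis by simp
qed

text \<open>Given Z = z, the first coordinate has density 1 / height z on its segment;
  \<open>c\<close> times the average over z is a density of the scaled lift. Its continuity at
  \<open>r0\<close> is dominated convergence with majorant 1 / height, integrable by the first
  moment constraint.\<close>

lemma X1_density_bound_lift_dist:
  assumes Q: "prob_space Q" "sets Q = sets (M0 d x0)" and c: "0 < c" and u: "0 \<le> u"
    and gap: "(\<integral>\<^sup>+z. inv_gap x0 z \<partial>Q) \<le> ennreal (u / c)"
  shows "X1_density_bound d x0 (scale_measure (ennreal c) (lift_dist d x0 Q)) u"
proof -
  interpret Q: prob_space Q by fact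
  note Q(2)[measurable_cong]
  have fin: "(\<integral>\<^sup>+z. inv_gap x0 z \<partial>Q) < \<infinity>" using gap by (rule le_less_trans) simp
  have pos: "AE z in Q. 0 < height z" by (rule AE_height_pos[OF Q(2) fin])
  have AE: "AE z in Q. z \<in> D0 d x0 \<and> 0 < height z"
    using pos AE_space by eventually_elim (use sets_eq_imp_space_eq[OF Q(2)] in \<open>simp add: space_M0\<close>)
  have gap_eq: "(\<integral>\<^sup>+z. ennreal (1 / height z) \<partial>Q) = (\<integral>\<^sup>+z. inv_gap x0 z \<partial>Q)"
    by (rule nn_integral_cong_AE) (use AE inv_gap_eq in \<open>auto elim: eventually_mono\<close>)
  have int: "integrable Q (\<lambda>z. 1 / height z)"
    by (rule integrableI_nonneg) (use AE fin gap_eq in \<open>auto elim: eventually_mono\<close>)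
  \<comment> \<open>There is no cut-off below \<open>r0\<close>: the density is tested only on
    subsets of \<open>{r0..}\<close>, and \<open>neg\<close> below uses this for v < 0.\<close>
  define w where "w t z = (if t - r0 \<le> height z then 1 / height z else 0)" for t z
  have w[measurable]: "case_prod w \<in> borel_measurable (borel \<Otimes>\<^sub>M M0 d x0)" unfolding w_def by measurable
  define f where "f t = c * (\<integral>z. w t z \<partial>Q)" for t
  have w_bound: "AE z in Q. norm (w t z) \<le> 1 / height z" for t
    using AE by eventually_elim (auto simp: w_def)
  have w_int: "integrable Q (w t)" for t
    by (rule Bochner_Integration.integrable_bound[OF int], measurable, use AE in eventually_elim) (auto simp: w_def)
  have w0: "AE z in Q. 0 \<le> w t z" for t
    using AE by eventually_elim (auto simp: w_def)
  have f_nn: "ennreal (f t) = (\<integral>\<^sup>+z. ennreal c * ennreal (w t z) \<partial>Q)" for t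
    unfolding f_def using c w0 w_int
    by (simp add: nn_integral_cmult nn_integral_eq_integral ennreal_mult integral_nonneg_AE)
  have f0: "0 \<le> f t" for t unfolding f_def using c w0[of t] by (simp add: integral_nonneg_AE)
  show ?thesis
    unfolding X1_density_bound_def
  proof (intro exI[of _ f] conjI allI ballI impI)
    show "f \<in> borel_measurable borel" unfolding f_def by measurable
    show "0 \<le> f t" for t by (rule f0)
    have "f r0 = c * (\<integral>z. 1 / height z \<partial>Q)"
      unfolding f_def using AE by (intro arg_cong[where f="(*) c"] integral_cong_AE) (auto simp: w_def)
    also have "\<dots> \<le> c * (u / c)"
    proof (intro mult_left_mono)
      have "ennreal (\<integral>z. 1 / height z \<partial>Q) = (\<integral>\<^sup>+z. ennreal (1 / height z) \<partial>Q)"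
        using AE int by (intro nn_integral_eq_integral[symmetric]) auto
      also have "\<dots> \<le> ennreal (u / c)" using gap gap_eq by simp
      finally show "(\<integral>z. 1 / height z \<partial>Q) \<le> u / c" using u c by (simp add: ennreal_le_iff)
    qed (use c in simp)
    finally show "f r0 \<le> u" using c by simp
    show "continuous (at r0 within {r0..}) f"
      unfolding continuous_within_sequentially comp_def
    proof (intro allI impI, elim conjE)
      fix X :: "nat \<Rightarrow> real" assume X: "\<forall>n. X n \<in> {r0..}" "X \<longlonglongrightarrow> r0"
      have "(\<lambda>n. \<integral>z. w (X n) z \<partial>Q) \<longlonglongrightarrow> (\<integral>z. w r0 z \<partial>Q)"
      proof (rule integral_dominated_convergence[OF _ _ int _ w_bound])
        show "AE z in Q. (\<lambda>n. w (X n) z) \<longlonglongrightarrow> w r0 z"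
          using AE
        proof eventually_elim
          case (elim z)
          \<comment> \<open>Each segment has positive length, so points close to \<open>r0\<close>
            lie below its top, where \<open>w\<close> is constant in t.\<close>
          then have "\<forall>\<^sub>F n in sequentially. X n < r0 + height z"
            using order_tendstoD(2)[OF X(2)] by auto
          then have "\<forall>\<^sub>F n in sequentially. w (X n) z = w r0 z"
            by eventually_elim (use elim in \<open>auto simp: w_def\<close>)
          then show ?case by (rule tendsto_eventually)
        qed
      qed measurable
      then show "(\<lambda>n. f (X n)) \<longlonglongrightarrow> f r0" unfolding f_def by (intro tendsto_mult_left)
    qed
    fix A :: "real set" assume A[measurable]: "A \<in> sets borel" and Ar: "A \<subseteq> {r0..}"
    have [measurable]: "{x \<in> D0 d x0. real_of_ereal (x 1) \<in> A} \<in> sets (M0 d x0)"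
      by (rule sets_Collect_D0) measurable
    have slice: "(\<integral>\<^sup>+v. indicator {x \<in> D0 d x0. real_of_ereal (x 1) \<in> A} (raise z (v * height z)) * indicator {0<..<1} v \<partial>lborel)
        = (\<integral>\<^sup>+t. ennreal (w t z) * indicator A t \<partial>lborel)" if z: "z \<in> D0 d x0" and h: "0 < height z" for z
    proof -
      have [measurable]: "z \<in> space (M0 d x0)" using z by (simp add: space_M0)
      have "(\<integral>\<^sup>+t. ennreal (w t z) * indicator A t \<partial>lborel)
          = ennreal \<bar>height z\<bar> * (\<integral>\<^sup>+v. ennreal (w (r0 + height z * v) z) * indicator A (r0 + height z * v) \<partial>lborel)"
        by (rule nn_integral_real_affine) (use h in auto)
      also have "\<dots> = (\<integral>\<^sup>+v. ennreal (height z) * (ennreal (w (r0 + height z * v) z) * indicator A (r0 + height z * v)) \<partial>lborel)"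
        using h by (subst nn_integral_cmult) auto
      also have "\<dots> = (\<integral>\<^sup>+v. indicator {x \<in> D0 d x0. real_of_ereal (x 1) \<in> A} (raise z (v * height z)) * indicator {0<..<1} v \<partial>lborel)"
      proof (rule nn_integral_cong_AE)
        have "AE v in lborel. v \<noteq> (0::real)" "AE v in lborel. v \<noteq> (1::real)" by (auto intro: AE_lborel_singleton)
        then show "AE v in lborel. ennreal (height z) * (ennreal (w (r0 + height z * v) z) * indicator A (r0 + height z * v))
            = indicator {x \<in> D0 d x0. real_of_ereal (x 1) \<in> A} (raise z (v * height z)) * indicator {0<..<1} v"
        proof eventually_elim
          case (elim v)
          have neg: "r0 + height z * v \<notin> A" if "v < 0"
            using Ar mult_pos_neg[OF h that] by auto
          have "height z * v \<le> height z \<longleftrightarrow> v \<le> 1" using h by simp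
          moreover have "ennreal (height z) * ennreal (1 / height z) = 1"
            using h by (simp add: ennreal_mult[symmetric])
          ultimately show ?case
            using elim neg h z by (cases "0 < v") (auto simp: w_def indicator_def mult.commute)
        qed
      qed
      finally show ?thesis by simp
    qed
    have "emeasure (scale_measure (ennreal c) (lift_dist d x0 Q)) {x \<in> D0 d x0. real_of_ereal (x 1) \<in> A}
        = ennreal c * (\<integral>\<^sup>+z. (\<integral>\<^sup>+t. ennreal (w t z) * indicator A t \<partial>lborel) \<partial>Q)"
      by (simp add: emeasure_lift_dist[OF Q])
         (intro arg_cong[where f="(*) (ennreal c)"] nn_integral_cong_AE, use AE slice in \<open>auto elim: eventually_mono\<close>)
    also have "\<dots> = ennreal c * (\<integral>\<^sup>+t. (\<integral>\<^sup>+z. ennreal (w t z) * indicator A t \<partial>Q) \<partial>lborel)"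
    proof -
      interpret LQ: pair_sigma_finite "lborel :: real measure" Q ..
      show ?thesis by (subst LQ.Fubini') auto
    qed
    also have "\<dots> = (\<integral>\<^sup>+t. ennreal c * (\<integral>\<^sup>+z. ennreal (w t z) * indicator A t \<partial>Q) \<partial>lborel)"
      by (rule nn_integral_cmult[symmetric]) measurable
    also have "\<dots> = (\<integral>\<^sup>+t\<in>A. ennreal (f t) \<partial>lborel)"
      unfolding f_nn by (intro nn_integral_cong) (auto simp: indicator_def nn_integral_cmult)
    finally show "emeasure (scale_measure (ennreal c) (lift_dist d x0 Q)) {x \<in> D0 d x0. real_of_ereal (x 1) \<in> A}
        = (\<integral>\<^sup>+t\<in>A. ennreal (f t) \<partial>lborel)" .
  qed
qed

text \<open>The density is an arbitrary version that is continuous at \<open>r0\<close>, so it is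
  probed by thin strips [r0, r0 + D]. Given z, such a strip has probability min (1, D / height z) =
  D min (1 / height z, 1 / D), while its total mass is at most D times a bound on the density near
  \<open>r0\<close>. After division by D, monotone convergence as D tends to 0 yields the integral
  of 1 / height.\<close>

lemma inv_gap_le_if_X1_density_bound:
  assumes Q: "prob_space Q" "sets Q = sets (M0 d x0)" and c: "0 < c" and u: "0 \<le> u"
    and pos: "AE z in Q. 0 < height z"
    and dens: "X1_density_bound d x0 (scale_measure (ennreal c) (lift_dist d x0 Q)) u"
  shows "(\<integral>\<^sup>+z. inv_gap x0 z \<partial>Q) \<le> ennreal (u / c)"
proof -
  interpret Q: prob_space Q by fact
  note Q(2)[measurable_cong]
  have AE: "AE z in Q. z \<in> D0 d x0 \<and> 0 < height z"
    using pos AE_space by eventually_elim (use sets_eq_imp_space_eq[OF Q(2)] in \<open>simp add: space_M0\<close>)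
  obtain f :: "real \<Rightarrow> real" where f[measurable]: "f \<in> borel_measurable borel"
    and f_dens: "\<And>A. A \<in> sets borel \<Longrightarrow> A \<subseteq> {r0..} \<Longrightarrow>
      emeasure (scale_measure (ennreal c) (lift_dist d x0 Q)) {x \<in> D0 d x0. real_of_ereal (x 1) \<in> A}
        = (\<integral>\<^sup>+ t\<in>A. ennreal (f t) \<partial>lborel)"
    and cont: "continuous (at r0 within {r0..}) f" and fu: "f r0 \<le> u"
    using dens unfolding X1_density_bound_def by blast
  have main: "(\<integral>\<^sup>+z. inv_gap x0 z \<partial>Q) \<le> ennreal ((u + e) / c)" if e: "0 < e" for e
  proof -
    obtain \<delta> where \<delta>: "0 < \<delta>" "\<And>t. r0 \<le> t \<Longrightarrow> t < r0 + \<delta> \<Longrightarrow> f t < u + e"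
    proof -
      have "\<forall>\<^sub>F t in at r0 within {r0..}. f t < u + e"
        using cont fu e unfolding continuous_within by (intro order_tendstoD(2)) auto
      then obtain \<delta> where "0 < \<delta>" "\<And>t. t \<in> {r0..} \<Longrightarrow> t \<noteq> r0 \<Longrightarrow> dist t r0 < \<delta> \<Longrightarrow> f t < u + e"
        unfolding eventually_at by auto
      \<comment> \<open>The punctured neighbourhood omits \<open>r0\<close> itself, where
        \<open>fu\<close> applies.\<close>
      then show thesis using fu e by (intro that[of \<delta>]) (force simp: dist_real_def)+
    qed
    \<comment> \<open>The 2 in the denominator keeps the strip strictly shorter than \<delta>
      already for n = 0.\<close>
    define D where "D n = \<delta> / (2 + real n)" for n
    have D: "0 < D n" "D n < \<delta>" for n using \<delta>(1) by (auto simp: D_def field_simps add_pos_nonneg)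
    have D_mono: "1 / D m \<le> 1 / D n" if "m \<le> n" for m n
      using that \<delta>(1) by (auto simp: D_def divide_right_mono)
    have bound: "(\<integral>\<^sup>+z. ennreal (min (1 / height z) (1 / D n)) \<partial>Q) \<le> ennreal ((u + e) / c)" for n
    proof -
      have [measurable]: "{x \<in> D0 d x0. real_of_ereal (x 1) \<in> {r0..r0 + D n}} \<in> sets (M0 d x0)"
        by (rule sets_Collect_D0) measurable
      have slice: "(\<integral>\<^sup>+v. indicator {x \<in> D0 d x0. real_of_ereal (x 1) \<in> {r0..r0 + D n}} (raise z (v * height z)) * indicator {0<..<1} v \<partial>lborel)
          = ennreal (D n) * ennreal (min (1 / height z) (1 / D n))" if z: "z \<in> D0 d x0" and h: "0 < height z" for z
      proof -
        have "(\<integral>\<^sup>+v. indicator {x \<in> D0 d x0. real_of_ereal (x 1) \<in> {r0..r0 + D n}} (raise z (v * height z)) * indicator {0<..<1} v \<partial>lborel)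
          = (\<integral>\<^sup>+v. indicator {v. ereal r0 \<le> ereal (r0 + v * height z) \<and> ereal (r0 + v * height z) \<le> ereal (r0 + D n)} v * indicator {0<..<1} v \<partial>lborel)"
          using z h by (intro nn_integral_cong) (auto simp: indicator_def simp del: ereal_r0)
        also have "\<dots> = ennreal ((real_of_ereal (min (ereal (r0 + D n)) (ereal (r0 + height z)))
            - real_of_ereal (min (ereal r0) (ereal (r0 + height z)))) / height z)"
          by (rule nn_integral_unit_interval_fraction(1)) (use h D(1)[of n] in \<open>auto simp del: ereal_r0\<close>)
        also have "\<dots> = ennreal (D n * min (1 / height z) (1 / D n))"
          using h D(1)[of n] by (simp add: min_def field_simps del: ereal_r0)
        also have "\<dots> = ennreal (D n) * ennreal (min (1 / height z) (1 / D n))"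
          using h D(1)[of n] by (intro ennreal_mult) auto
        finally show ?thesis .
      qed
      have "ennreal (c * D n) * (\<integral>\<^sup>+z. ennreal (min (1 / height z) (1 / D n)) \<partial>Q)
          = ennreal c * (\<integral>\<^sup>+z. ennreal (D n) * ennreal (min (1 / height z) (1 / D n)) \<partial>Q)"
        using c D(1)[of n] by (simp add: nn_integral_cmult ennreal_mult mult.assoc)
      also have "\<dots> = emeasure (scale_measure (ennreal c) (lift_dist d x0 Q)) {x \<in> D0 d x0. real_of_ereal (x 1) \<in> {r0..r0 + D n}}"
      proof -
        have "(\<integral>\<^sup>+z. ennreal (D n) * ennreal (min (1 / height z) (1 / D n)) \<partial>Q)
            = emeasure (lift_dist d x0 Q) {x \<in> D0 d x0. real_of_ereal (x 1) \<in> {r0..r0 + D n}}"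
          by (subst emeasure_lift_dist[OF Q], measurable, rule nn_integral_cong_AE)
             (use AE in eventually_elim, use slice in simp)
        then show ?thesis by simp
      qed
      also have "\<dots> = (\<integral>\<^sup>+ t\<in>{r0..r0 + D n}. ennreal (f t) \<partial>lborel)" by (rule f_dens) auto
      also have "\<dots> \<le> (\<integral>\<^sup>+ t\<in>{r0..r0 + D n}. ennreal (u + e) \<partial>lborel)"
        using \<delta>(2) D(2)[of n] by (intro nn_integral_mono) (auto simp: indicator_def less_imp_le intro!: ennreal_leI)
      also have "\<dots> = ennreal (c * D n) * ennreal ((u + e) / c)"
        using c u e D(1)[of n] by (simp add: nn_integral_cmult_indicator ennreal_mult[symmetric] mult.commute del: ennreal_plus)
      finally show ?thesis using c D(1)[of n] by (subst (asm) ennreal_mult_le_mult_iff) auto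
    qed
    have "(\<integral>\<^sup>+z. inv_gap x0 z \<partial>Q) = (\<integral>\<^sup>+z. (SUP n. ennreal (min (1 / height z) (1 / D n))) \<partial>Q)"
    proof (rule nn_integral_cong_AE, use AE in eventually_elim)
      case (elim z)
      obtain n :: nat where n: "\<delta> / height z < real n" using reals_Archimedean2 by blast
      then have "1 / height z \<le> 1 / D n" using elim \<delta>(1) by (simp add: D_def field_simps)
      then have "ennreal (min (1 / height z) (1 / D n)) = ennreal (1 / height z)" by (simp add: min_def)
      moreover have "ennreal (min (1 / height z) (1 / D m)) \<le> ennreal (1 / height z)" for m
        by (intro ennreal_leI) simp
      ultimately have "(SUP n. ennreal (min (1 / height z) (1 / D n))) = ennreal (1 / height z)"
        by (intro antisym SUP_least) (auto intro: SUP_upper2[of n])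
      then show ?case using inv_gap_eq elim by simp
    qed
    also have "\<dots> = (SUP n. \<integral>\<^sup>+z. ennreal (min (1 / height z) (1 / D n)) \<partial>Q)"
    proof (rule nn_integral_monotone_convergence_SUP)
      show "incseq (\<lambda>n z. ennreal (min (1 / height z) (1 / D n)))"
        using D_mono by (auto simp: incseq_def le_fun_def intro!: ennreal_leI min.mono)
    qed measurable
    also have "\<dots> \<le> ennreal ((u + e) / c)" using bound by (rule SUP_least)
    finally show ?thesis .
  qed
  show ?thesis
  proof (rule ennreal_le_epsilon)
    fix e :: real assume e: "0 < e"
    \<comment> \<open>The slack \<open>e * c\<close> turns into exactly \<open>e\<close> after
      division by \<open>c\<close>.\<close>
    then have "(\<integral>\<^sup>+z. inv_gap x0 z \<partial>Q) \<le> ennreal ((u + e * c) / c)" using c by (intro main) simp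
    also have "\<dots> = ennreal (u / c) + ennreal e"
      using c u e by (simp add: ennreal_plus[symmetric] add_divide_distrib del: ennreal_plus)
    finally show "(\<integral>\<^sup>+z. inv_gap x0 z \<partial>Q) \<le> ennreal (u / c) + ennreal e" .
  qed
qed

end

section \<open>1-POU laws are lifts\<close>

context pou
begin

text \<open>A point is encoded by its foot \<open>raise x 0\<close> and its height. The contraction
  keeps the foot and scales the height, so the hypothesis is the one of
  \<open>khinchin_fibrewise\<close> for the joint law of the two. The pairs (foot, length) that it
  produces are turned back into points by \<open>raise\<close>.\<close>

lemma lift_dist_eq_if_shrink:
  assumes P: "prob_space P" "sets P = sets (M0 d x0)"
    and bottom: "emeasure P {x \<in> D0 d x0. x 1 = x0 1} = 0"
    and shrink: "\<And>k A. 0 < k \<Longrightarrow> k < 1 \<Longrightarrow> A \<in> sets (M0 d x0) \<Longrightarrow>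
      ennreal k * emeasure P {x \<in> D0 d x0. raise x (k * height x) \<in> A} \<le> emeasure P A"
  obtains Q where "prob_space Q" "sets Q = sets (M0 d x0)" "AE z in Q. 0 < height z"
    "lift_dist d x0 Q = P"
proof -
  interpret P: prob_space P by fact
  note P(2)[measurable_cong]
  have space_P: "space P = D0 d x0" using sets_eq_imp_space_eq[OF P(2)] by (simp add: space_M0)
  let ?N = "M0 d x0 \<Otimes>\<^sub>M (borel :: real measure)"
  define split where "split x = (raise x 0, height x)" for x
  have split[measurable]: "split \<in> measurable (M0 d x0) ?N"
    unfolding split_def by (intro measurable_Pair measurable_raise) auto
  define mu where "mu = distr P ?N split"
  have mu: "emeasure mu A = emeasure P {x \<in> D0 d x0. split x \<in> A}" if "A \<in> sets ?N" for A
    unfolding mu_def using that by (subst emeasure_distr) (auto simp: space_P intro: arg_cong[where f="emeasure P"])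
  have [measurable]: "{x \<in> D0 d x0. x 1 = x0 1} \<in> sets (M0 d x0)"
    by (rule sets_Collect_D0) measurable
  have AE_P: "AE x in P. 0 < height x"
  proof (rule AE_I')
    show "{x \<in> D0 d x0. x 1 = x0 1} \<in> null_sets P" using bottom by (intro null_setsI) (auto simp: P(2))
    show "{x \<in> space P. \<not> 0 < height x} \<subseteq> {x \<in> D0 d x0. x 1 = x0 1}"
      using D0_coord_1(2) height_0_iff by (force simp: space_P)
  qed
  have prob_mu: "prob_space mu" unfolding mu_def by (rule P.prob_space_distr) measurable
  have pos_mu: "AE p in mu. 0 < snd p"
    unfolding mu_def using AE_P by (subst AE_distr_iff) (auto simp: split_def)
  have shrink_mu: "ennreal k * emeasure mu A \<le> emeasure mu {p \<in> space ?N. (fst p, snd p / k) \<in> A}"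
    if k: "0 < k" "k < 1" and A[measurable]: "A \<in> sets ?N" for k A
  proof -
    \<comment> \<open>Points whose stretching by 1 / k has its code in \<open>A\<close>. The
      contraction of x lies in \<open>A'\<close> exactly when the code of x itself lies in
      \<open>A\<close>.\<close>
    define A' where "A' = {x \<in> D0 d x0. (raise x 0, height x / k) \<in> A}"
    have "(\<lambda>x. (raise x 0, height x / k)) \<in> measurable (M0 d x0) ?N"
      by (intro measurable_Pair measurable_raise) auto
    then have A'[measurable]: "A' \<in> sets (M0 d x0)"
      unfolding A'_def
      by (rule back_subst[where P="\<lambda>S. S \<in> sets (M0 d x0)", OF measurable_sets[OF _ A]])
         (auto simp: space_M0)
    have "emeasure mu A = emeasure P {x \<in> D0 d x0. raise x (k * height x) \<in> A'}"
      unfolding mu[OF A] A'_def using k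
      by (intro arg_cong[where f="emeasure P"] Collect_cong) (auto simp: split_def D0_coord_1(2))
    also have "ennreal k * \<dots> \<le> emeasure P A'" by (rule shrink) (use k A' in auto)
    also have "\<dots> = emeasure mu {p \<in> space ?N. (fst p, snd p / k) \<in> A}"
      by (subst mu, measurable) (auto simp: A'_def split_def space_pair_measure space_M0 intro!: arg_cong[where f="emeasure P"])
    finally show ?thesis .
  qed
  have sets_mu: "sets mu = sets ?N" by (simp add: mu_def)
  have "\<exists>R. prob_space R \<and> sets R = sets ?N \<and> (AE p in R. 0 < snd p) \<and> (\<forall>A\<in>sets ?N. emeasure mu A =
      (\<integral>\<^sup>+p. (\<integral>\<^sup>+v. indicator A (fst p, v * snd p) * indicator {0<..<1} v \<partial>lborel) \<partial>R))"
  proof (rule khinchin_fibrewise[OF prob_mu sets_mu pos_mu], goal_cases)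
    case (1 k A)
    then show ?case by (rule shrink_mu)
  next
    case (2 Q)
    show ?case by (intro exI[of _ Q] conjI ballI 2)
  qed
  then obtain R where R: "prob_space R" "sets R = sets ?N" "AE p in R. 0 < snd p"
    and key: "\<And>A. A \<in> sets ?N \<Longrightarrow> emeasure mu A =
      (\<integral>\<^sup>+p. (\<integral>\<^sup>+v. indicator A (fst p, v * snd p) * indicator {0<..<1} v \<partial>lborel) \<partial>R)"
    by blast
  interpret R: prob_space R by fact
  note R(2)[measurable_cong]
  \<comment> \<open>\<open>raise\<close> overwrites the first coordinate of \<open>fst p\<close>, so
    lifting \<open>G p\<close> by the factor v gives \<open>G (fst p, v * snd p)\<close> as soon as
    \<open>snd p\<close> is positive.\<close>
  define G where "G p = raise (fst p) (max 0 (snd p))" for p :: "(nat \<Rightarrow> ereal) \<times> real"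
  have G[measurable]: "G \<in> measurable ?N (M0 d x0)" unfolding G_def by measurable
  define Q where "Q = distr R (M0 d x0) G"
  have Q: "prob_space Q" "sets Q = sets (M0 d x0)"
    unfolding Q_def by (auto intro!: R.prob_space_distr)
  show thesis
  proof (rule that[OF Q])
    show "AE z in Q. 0 < height z"
      unfolding Q_def using R(3) by (subst AE_distr_iff) (auto simp: G_def)
    show "lift_dist d x0 Q = P"
    proof (rule measure_eqI)
      show "sets (lift_dist d x0 Q) = sets P" by (simp add: Q P(2))
      fix A assume "A \<in> sets (lift_dist d x0 Q)"
      then have A[measurable]: "A \<in> sets (M0 d x0)" by (simp add: Q)
      define A' where "A' = G -` A \<inter> space ?N"
      have A'[measurable]: "A' \<in> sets ?N" unfolding A'_def by (rule measurable_sets[OF G A])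
      have "emeasure (lift_dist d x0 Q) A = (\<integral>\<^sup>+x. indicator A x \<partial>lift_dist d x0 Q)" using Q by simp
      also have "\<dots> = (\<integral>\<^sup>+z. (\<integral>\<^sup>+v. indicator A (raise z (max 0 (v * height z))) * indicator {0<..<1} v \<partial>lborel) \<partial>Q)"
        by (rule nn_integral_lift_dist[OF Q]) measurable
      also have "\<dots> = (\<integral>\<^sup>+p. (\<integral>\<^sup>+v. indicator A (raise (G p) (max 0 (v * height (G p)))) * indicator {0<..<1} v \<partial>lborel) \<partial>R)"
        unfolding Q_def by (rule nn_integral_distr) measurable
      also have "\<dots> = (\<integral>\<^sup>+p. (\<integral>\<^sup>+v. indicator A' (fst p, v * snd p) * indicator {0<..<1} v \<partial>lborel) \<partial>R)"
      proof (rule nn_integral_cong_AE, use R(3) AE_space in eventually_elim)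
        case (elim p)
        then have "fst p \<in> space (M0 d x0)" using sets_eq_imp_space_eq[OF R(2)] by (auto simp: space_pair_measure)
        then show ?case using elim
          by (intro nn_integral_cong) (auto simp: indicator_def A'_def G_def space_pair_measure)
      qed
      also have "\<dots> = emeasure mu A'" by (rule key[symmetric]) measurable
      also have "\<dots> = emeasure P A"
        unfolding mu[OF A'] using sets.sets_into_space[OF A]
        by (intro arg_cong[where f="emeasure P"])
           (auto simp: A'_def G_def split_def space_pair_measure space_M0 D0_coord_1(2) max_absorb2)
      finally show "emeasure (lift_dist d x0 Q) A = emeasure P A" .
    qed
  qed
qed

section \<open>Lebesgue measure on the domain, sliced along the first coordinate\<close>

lemma sets_Leb0 [simp]: "sets (Leb0 d x0) = sets (M0 d x0)"
  by (simp add: Leb0_def)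

lemma measurable_emb: "emb d \<in> measurable (PiM {1..d} (\<lambda>_. lborel)) (amb d)"
  unfolding emb_def amb_def by (rule measurable_restrict) measurable

lemma emb_update: "emb d (w(1 := s)) = raise (emb d w) (s - r0)"
  using d by (auto simp: emb_def raise_def)

text \<open>Tonelli along the first coordinate. Since \<open>F\<close> vanishes off the domain, the
  slices may run over all reals.\<close>

lemma nn_integral_Leb0:
  assumes F: "F \<in> borel_measurable (amb d)" and F0: "\<And>x. x \<notin> D0 d x0 \<Longrightarrow> F x = 0"
  shows "(\<integral>\<^sup>+x. F x \<partial>Leb0 d x0)
    = (\<integral>\<^sup>+w. (\<integral>\<^sup>+s. F (emb d (w(1 := s))) \<partial>lborel) \<partial>PiM {2..d} (\<lambda>_. lborel))"
proof -
  note F[measurable] measurable_emb[measurable]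
  let ?P = "PiM {1..d} (\<lambda>_. lborel :: real measure)"
  let ?S = "{y \<in> space ?P. emb d y \<in> D0 d x0}"
  have S: "?S \<in> sets ?P"
    using measurable_sets[OF measurable_emb sets_D0] by (simp add: vimage_def Int_def conj_commute)
  have "emb d \<in> measurable (restrict_space ?P ?S) (M0 d x0)"
    by (rule measurable_M0I, rule measurable_restrict_space1, rule measurable_emb) (simp add: space_restrict_space)
  then have "(\<integral>\<^sup>+x. F x \<partial>Leb0 d x0) = (\<integral>\<^sup>+y. F (emb d y) \<partial>restrict_space ?P ?S)"
    unfolding Leb0_def by (rule nn_integral_distr) (simp add: measurable_compose[OF measurable_M0_amb F])
  also have "\<dots> = (\<integral>\<^sup>+y. F (emb d y) * indicator ?S y \<partial>?P)"
    using S by (intro nn_integral_restrict_space) (simp add: sets.Int)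
  also have "\<dots> = (\<integral>\<^sup>+y. F (emb d y) \<partial>?P)"
    by (intro nn_integral_cong) (auto simp: indicator_def F0)
  also have "\<dots> = (\<integral>\<^sup>+w. (\<integral>\<^sup>+s. F (emb d (w(1 := s))) \<partial>lborel) \<partial>PiM {2..d} (\<lambda>_. lborel))"
  proof -
    interpret product_sigma_finite "\<lambda>_. lborel :: real measure" ..
    have "(\<lambda>y. F (emb d y)) \<in> borel_measurable (PiM (insert 1 {2..d}) (\<lambda>_. lborel))"
      unfolding coords_eq[symmetric] by measurable
    then show ?thesis unfolding coords_eq by (subst product_nn_integral_insert) auto
  qed
  finally show ?thesis .
qed

lemma measurable_emb_slice:
  assumes "B \<in> sets (M0 d x0)"
  shows "(\<lambda>p. indicator B (emb d ((fst p)(1 := snd p))) :: ennreal)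
      \<in> borel_measurable (PiM {2..d} (\<lambda>_. lborel :: real measure) \<Otimes>\<^sub>M borel)"
proof -
  have "(\<lambda>p. (fst p)(1 := snd p)) \<in> measurable (PiM {2..d} (\<lambda>_. lborel :: real measure) \<Otimes>\<^sub>M borel)
      (PiM {1..d} (\<lambda>_. lborel :: real measure))"
    by (rule measurable_fun_upd[where J="{2..d}"]) (auto simp: coords_eq)
  from measurable_compose[OF this measurable_emb]
  have [measurable]: "(\<lambda>p. emb d ((fst p)(1 := snd p)))
      \<in> measurable (PiM {2..d} (\<lambda>_. lborel :: real measure) \<Otimes>\<^sub>M borel) (amb d)" .
  have [measurable]: "B \<in> sets (amb d)" using assms by (simp add: sets_M0_iff)
  show ?thesis by measurable
qed

lemma emeasure_Leb0:
  assumes "B \<in> sets (M0 d x0)"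
  shows "emeasure (Leb0 d x0) B
    = (\<integral>\<^sup>+w. (\<integral>\<^sup>+s. indicator B (emb d (w(1 := s))) \<partial>lborel) \<partial>PiM {2..d} (\<lambda>_. lborel))"
  using assms by (subst nn_integral_Leb0[symmetric]) (auto simp: sets_M0_iff indicator_def)

text \<open>On every slice the contraction sends the set on the left into
  \<open>K \<inter> A\<close>, by the defining property of \<open>K\<close>. It scales lengths by k,
  which accounts for the factor on the left.\<close>

lemma shrink_POU:
  assumes K: "POU_set d x0 K" and k: "0 < k" "k < 1" and A: "A \<in> sets (M0 d x0)"
  shows "ennreal k * emeasure (Leb0 d x0) (K \<inter> {x \<in> D0 d x0. raise x (k * height x) \<in> A})
    \<le> emeasure (Leb0 d x0) (K \<inter> A)"
proof -
  have K_sets: "K \<in> sets (M0 d x0)" using K by (simp add: POU_set_def)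
  have "(\<lambda>x. raise x (max 0 (k * height x))) \<in> measurable (M0 d x0) (M0 d x0)" by measurable
  from measurable_sets[OF this A]
  have A': "{x \<in> D0 d x0. raise x (k * height x) \<in> A} \<in> sets (M0 d x0)"
    by (rule back_subst[where P="\<lambda>S. S \<in> sets (M0 d x0)"])
       (use k in \<open>auto simp: space_M0 max_absorb2 D0_coord_1(2)\<close>)
  have ms: "(\<lambda>s. indicator B (emb d (w(1 := s))) :: ennreal) \<in> borel_measurable borel"
    if "B \<in> sets (M0 d x0)" "w \<in> space (PiM {2..d} (\<lambda>_. lborel :: real measure))" for B w
    using measurable_compose[OF measurable_Pair1'[OF that(2)] measurable_emb_slice[OF that(1)]] by simp
  have ms_int: "(\<lambda>w. \<integral>\<^sup>+s. indicator B (emb d (w(1 := s))) \<partial>lborel)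
      \<in> borel_measurable (PiM {2..d} (\<lambda>_. lborel :: real measure))" if "B \<in> sets (M0 d x0)" for B
    using measurable_emb_slice[OF that] by (intro lborel.borel_measurable_nn_integral) (simp add: case_prod_beta')
  have slice: "ennreal k * (\<integral>\<^sup>+s. indicator (K \<inter> {x \<in> D0 d x0. raise x (k * height x) \<in> A}) (emb d (w(1 := s))) \<partial>lborel)
      \<le> (\<integral>\<^sup>+s. indicator (K \<inter> A) (emb d (w(1 := s))) \<partial>lborel)"
    if w: "w \<in> space (PiM {2..d} (\<lambda>_. lborel :: real measure))" for w
  proof -
    \<comment> \<open>The argument \<open>(r0 - k * r0) + k * s\<close> is r0 + k (s - r0), the
      contraction written in the affine form of \<open>nn_integral_real_affine\<close>.\<close>
    have "(\<integral>\<^sup>+s. indicator (K \<inter> {x \<in> D0 d x0. raise x (k * height x) \<in> A}) (emb d (w(1 := s))) \<partial>lborel)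
        \<le> (\<integral>\<^sup>+s. indicator (K \<inter> A) (emb d (w(1 := (r0 - k * r0) + k * s))) \<partial>lborel)"
    proof (rule nn_integral_mono)
      fix s :: real
      show "indicator (K \<inter> {x \<in> D0 d x0. raise x (k * height x) \<in> A}) (emb d (w(1 := s)))
        \<le> (indicator (K \<inter> A) (emb d (w(1 := (r0 - k * r0) + k * s))) :: ennreal)"
      proof (cases "emb d (w(1 := s)) \<in> K \<inter> {x \<in> D0 d x0. raise x (k * height x) \<in> A}")
        case True
        define x where "x = emb d (w(1 := s))"
        have x: "x \<in> K" "x \<in> D0 d x0" "raise x (k * height x) \<in> A" using True by (auto simp: x_def)
        have xs: "x = raise (emb d w) (s - r0)" by (simp add: x_def emb_update)
        then have h: "height x = s - r0" by simp
        have "emb d (w(1 := (r0 - k * r0) + k * s)) = raise x (k * height x)"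
          unfolding emb_update xs by (simp add: algebra_simps)
        moreover have "raise x (k * height x) \<in> K"
        proof -
          have h0: "0 \<le> height x" by (rule D0_coord_1(2)) fact
          have "ereal r0 \<le> ereal (r0 + k * height x)" using h0 k by (simp del: ereal_r0)
          then have "x0 1 \<le> ereal (r0 + k * height x)" by simp
          moreover have "ereal (r0 + k * height x) \<le> x 1"
            using D0_coord_1(1)[OF x(2)] h0 k by (simp add: mult_left_le_one_le)
          ultimately show ?thesis using K x(1) unfolding POU_set_def raise_def by blast
        qed
        ultimately show ?thesis using x(3) by (simp add: indicator_def)
      qed simp
    qed
    then have "ennreal k * (\<integral>\<^sup>+s. indicator (K \<inter> {x \<in> D0 d x0. raise x (k * height x) \<in> A}) (emb d (w(1 := s))) \<partial>lborel)
        \<le> ennreal \<bar>k\<bar> * (\<integral>\<^sup>+s. indicator (K \<inter> A) (emb d (w(1 := (r0 - k * r0) + k * s))) \<partial>lborel)"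
      using k by (simp add: mult_left_mono)
    also have "\<dots> = (\<integral>\<^sup>+s. indicator (K \<inter> A) (emb d (w(1 := s))) \<partial>lborel)"
      by (rule nn_integral_real_affine[symmetric]) (use k ms[OF sets.Int[OF K_sets A] w] in auto)
    finally show ?thesis .
  qed
  have "ennreal k * emeasure (Leb0 d x0) (K \<inter> {x \<in> D0 d x0. raise x (k * height x) \<in> A})
      \<le> (\<integral>\<^sup>+w. ennreal k * (\<integral>\<^sup>+s. indicator (K \<inter> {x \<in> D0 d x0. raise x (k * height x) \<in> A}) (emb d (w(1 := s))) \<partial>lborel) \<partial>PiM {2..d} (\<lambda>_. lborel))"
    unfolding emeasure_Leb0[OF sets.Int[OF K_sets A']] 
    by (simp only: nn_integral_cmult[OF ms_int[OF sets.Int[OF K_sets A']]])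
  also have "\<dots> \<le> emeasure (Leb0 d x0) (K \<inter> A)"
    unfolding emeasure_Leb0[OF sets.Int[OF K_sets A]] by (rule nn_integral_mono) (rule slice)
  finally show ?thesis .
qed

end

section \<open>Finite mixtures as measures\<close>

lemma sets_mixture [simp]: "sets (mixture M ps) = sets M"
  by (simp add: mixture_def)

lemma space_mixture [simp]: "space (mixture M ps) = space M"
  by (simp add: mixture_def)

text \<open>\<open>measure_of\<close> takes the intended values only for a countably additive set
  function, so additivity is proved by induction along the list.\<close>

lemma emeasure_mixture:
  assumes ps: "\<And>w Q. (w, Q) \<in> set ps \<Longrightarrow> sets Q = sets M" and A: "A \<in> sets M"
  shows "emeasure (mixture M ps) A = (\<Sum>(w, Q)\<leftarrow>ps. ennreal w * emeasure Q A)"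
  unfolding mixture_def
proof (rule emeasure_measure_of_sigma)
  show "sigma_algebra (space M) (sets M)" ..
  show "positive (sets M) (\<lambda>A. \<Sum>(w, Q)\<leftarrow>ps. ennreal w * emeasure Q A)"
    unfolding positive_def by (induction ps) auto
  show "countably_additive (sets M) (\<lambda>A. \<Sum>(w, Q)\<leftarrow>ps. ennreal w * emeasure Q A)"
    using ps
  proof (induction ps)
    case Nil
    show ?case by (simp add: countably_additive_def)
  next
    case (Cons p ps)
    obtain w Q where p: "p = (w, Q)" by force
    have IH: "countably_additive (sets M) (\<lambda>A. \<Sum>(w, Q)\<leftarrow>ps. ennreal w * emeasure Q A)"
      by (rule Cons.IH) (use Cons.prems in auto)
    have Q: "sets Q = sets M" using Cons.prems by (auto simp: p)
    show ?case
    proof (rule countably_additiveI)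
      fix B :: "nat \<Rightarrow> 'a set" assume B: "range B \<subseteq> sets M" "disjoint_family B" "\<Union>(range B) \<in> sets M"
      have "(\<Sum>i. \<Sum>(w, Q)\<leftarrow>p # ps. ennreal w * emeasure Q (B i))
          = (\<Sum>i. ennreal w * emeasure Q (B i)) + (\<Sum>i. \<Sum>(w, Q)\<leftarrow>ps. ennreal w * emeasure Q (B i))"
        by (simp add: p suminf_add[symmetric])
      also have "(\<Sum>i. ennreal w * emeasure Q (B i)) = ennreal w * emeasure Q (\<Union>(range B))"
        using B Q by (simp add: suminf_emeasure)
      also have "(\<Sum>i. \<Sum>(w, Q)\<leftarrow>ps. ennreal w * emeasure Q (B i))
          = (\<Sum>(w, Q)\<leftarrow>ps. ennreal w * emeasure Q (\<Union>(range B)))"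
        using IH B unfolding countably_additive_def by blast
      finally show "(\<Sum>i. \<Sum>(w, Q)\<leftarrow>p # ps. ennreal w * emeasure Q (B i))
          = (\<Sum>(w, Q)\<leftarrow>p # ps. ennreal w * emeasure Q (\<Union>(range B)))" by (simp add: p)
    qed
  qed
qed (rule A)

lemma prob_space_mixture:
  assumes ps: "\<And>w Q. (w, Q) \<in> set ps \<Longrightarrow> sets Q = sets M \<and> prob_space Q \<and> 0 \<le> w"
    and sum: "(\<Sum>(w, Q)\<leftarrow>ps. w) = 1"
  shows "prob_space (mixture M ps)"
proof
  have "emeasure (mixture M ps) (space M) = (\<Sum>(w, Q)\<leftarrow>ps. ennreal w * emeasure Q (space M))"
    using ps by (intro emeasure_mixture) auto
  moreover have "(\<Sum>(w, Q)\<leftarrow>ps. ennreal w * emeasure Q (space M)) = ennreal (\<Sum>(w, Q)\<leftarrow>ps. w)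
      \<and> 0 \<le> (\<Sum>(w, Q)\<leftarrow>ps. w)"
    using ps
  proof (induction ps)
    case (Cons p ps)
    obtain w Q where p: "p = (w, Q)" by force
    have Q: "sets Q = sets M" "prob_space Q" "0 \<le> w" using Cons.prems[of w Q] by (auto simp: p)
    have "emeasure Q (space M) = 1"
      using prob_space.emeasure_space_1[OF Q(2)] sets_eq_imp_space_eq[OF Q(1)] by simp
    moreover have "(\<Sum>(w, Q)\<leftarrow>ps. ennreal w * emeasure Q (space M)) = ennreal (\<Sum>(w, Q)\<leftarrow>ps. w)
      \<and> 0 \<le> (\<Sum>(w, Q)\<leftarrow>ps. w)" by (rule Cons.IH) (use Cons.prems in auto)
    ultimately show ?case using Q by (simp add: p)
  qed simp
  ultimately show "emeasure (mixture M ps) (space (mixture M ps)) = 1" by (simp add: sum)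
qed

section \<open>From integrals of continuous functions to Borel sets\<close>

lemma emeasure_le_if_closed:
  fixes M N :: "'a::{second_countable_topology, complete_space} measure"
  assumes "finite_measure M" and sets: "sets M = sets borel" "sets N = sets borel"
    and closed: "\<And>C. closed C \<Longrightarrow> k * emeasure M C \<le> emeasure N C"
    and B: "B \<in> sets borel"
  shows "k * emeasure M B \<le> emeasure N B"
proof -
  interpret finite_measure M by fact
  \<comment> \<open>Inner regularity by compact sets is applied to the smaller side; on the other
    side a compact subset of \<open>B\<close> is controlled by monotonicity.\<close>
  have "k * emeasure M B = (SUP K \<in> {K. K \<subseteq> B \<and> compact K}. k * emeasure M K)"
    by (subst inner_regular[OF sets(1) _ B]) (auto simp: SUP_mult_left_ennreal)
  also have "\<dots> \<le> emeasure N B"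
  proof (rule SUP_least, clarify)
    fix K assume K: "K \<subseteq> B" "compact K"
    have "k * emeasure M K \<le> emeasure N K" by (rule closed) (rule compact_imp_closed[OF K(2)])
    also have "\<dots> \<le> emeasure N B" using K B sets by (intro emeasure_mono) auto
    finally show "k * emeasure M K \<le> emeasure N B" .
  qed
  finally show ?thesis .
qed

text \<open>The continuous functions \<open>h n\<close> fall to the indicator of a closed set, which
  carries the inequality over to closed sets; \<open>emeasure_le_if_closed\<close> extends it to
  Borel sets.\<close>

lemma emeasure_le_if_integral_le:
  fixes M N :: "'a::{second_countable_topology, complete_space} measure"
  assumes M: "prob_space M" "sets M = sets borel" and N: "prob_space N" "sets N = sets borel" and k: "0 \<le> k"
    and le: "\<And>f. continuous_on UNIV f \<Longrightarrow> (\<And>x. 0 \<le> f x \<and> f x \<le> 1) \<Longrightarrow> k * (\<integral>x. f x \<partial>M) \<le> (\<integral>x. f x \<partial>N)"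
    and B: "B \<in> sets borel"
  shows "ennreal k * emeasure M B \<le> emeasure N B"
proof (rule emeasure_le_if_closed[OF prob_space.finite_measure[OF M(1)] M(2) N(2) _ B])
  interpret M: prob_space M by fact
  interpret N: prob_space N by fact
  fix C :: "'a set" assume C: "closed C"
  show "ennreal k * emeasure M C \<le> emeasure N C"
  \<comment> \<open>\<open>infdist\<close> to the empty set is 0 by convention, so
    \<open>h n\<close> would be constantly 1 there instead of tending to the indicator.\<close>
  proof (cases "C = {}")
    case False
    define h where "h n x = max 0 (1 - real n * infdist x C)" for n x
    have cont: "continuous_on UNIV (h n)" for n unfolding h_def by (intro continuous_intros)
    have h01: "0 \<le> h n x" "h n x \<le> 1" for n x by (auto simp: h_def infdist_nonneg)
    have h_meas[measurable]: "h n \<in> borel_measurable borel" for n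
      by (rule borel_measurable_continuous_onI[OF cont])
    have lim: "(\<lambda>n. h n x) \<longlonglongrightarrow> indicator C x" for x
    proof (cases "x \<in> C")
      case True
      then show ?thesis by (simp add: h_def)
    next
      case x: False
      then have pos: "0 < infdist x C" using in_closed_iff_infdist_zero[OF C False] infdist_nonneg[of x C] by (metis less_eq_real_def)
      obtain m :: nat where m: "1 / infdist x C < real m" using reals_Archimedean2 by blast
      have "\<forall>\<^sub>F n in sequentially. h n x = indicator C x"
        using eventually_ge_at_top[of m]
      proof eventually_elim
        case (elim n)
        have "1 < real m * infdist x C" using m pos by (simp add: field_simps)
        also have "\<dots> \<le> real n * infdist x C" using elim pos by (intro mult_right_mono) auto
        finally show ?case using x by (simp add: h_def)
      qed
      then show ?thesis by (rule tendsto_eventually)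
    qed
    have limM: "(\<lambda>n. \<integral>x. h n x \<partial>M) \<longlonglongrightarrow> (\<integral>x. indicator C x \<partial>M)"
      by (rule integral_dominated_convergence[where w="\<lambda>_. 1"]) (use lim h01 borel_closed[OF C] M(2) in auto)
    have limN: "(\<lambda>n. \<integral>x. h n x \<partial>N) \<longlonglongrightarrow> (\<integral>x. indicator C x \<partial>N)"
      by (rule integral_dominated_convergence[where w="\<lambda>_. 1"]) (use lim h01 borel_closed[OF C] N(2) in auto)
    have "k * (\<integral>x. indicator C x \<partial>M) \<le> (\<integral>x. indicator C x \<partial>N)"
      by (rule LIMSEQ_le[OF tendsto_mult_left[OF limM] limN]) (use le[OF cont] h01 in auto)
    then have "k * measure M C \<le> measure N C" using C M(2) N(2) by (simp add: borel_closed)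
    then show ?thesis
      using k by (simp add: M.emeasure_eq_measure N.emeasure_eq_measure ennreal_mult[symmetric])
  qed simp
qed

text \<open>The exponential embeds each half-open ray of extended reals into the real line; this makes
  regularity of Borel measures on the Polish space of real sequences available.\<close>

definition squash :: "ereal \<Rightarrow> real" where
  "squash x = (if x = -\<infinity> then 0 else exp (real_of_ereal x))"

definition unsquash :: "real \<Rightarrow> ereal" where
  "unsquash s = (if s \<le> 0 then -\<infinity> else ereal (ln s))"

lemma unsquash_squash: "x < \<infinity> \<Longrightarrow> unsquash (squash x) = x"
  by (cases x) (auto simp: squash_def unsquash_def)

lemma measurable_squash [measurable]: "squash \<in> borel_measurable borel"
  unfolding squash_def by measurable

lemma measurable_unsquash [measurable]: "unsquash \<in> borel_measurable borel"
  unfolding unsquash_def by measurable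

lemma continuous_on_squash: "continuous_on {..<\<infinity>} squash"
proof (rule continuous_at_imp_continuous_on, rule ballI)
  fix x :: ereal assume "x \<in> {..<\<infinity>}"
  then consider r where "x = ereal r" | "x = -\<infinity>" by (cases x) auto
  then show "isCont squash x"
  proof cases
    case 1
    have "((\<lambda>t. exp t) \<longlongrightarrow> exp r) (at r)" by (intro tendsto_intros)
    then have "(squash \<longlongrightarrow> squash (ereal r)) (at (ereal r))"
      unfolding at_ereal filterlim_filtermap by (simp add: squash_def)
    then show ?thesis by (simp add: 1 isCont_def)
  next
    case 2
    show ?thesis unfolding isCont_def
    proof (rule tendstoI)
      fix e :: real assume e: "0 < e"
      \<comment> \<open>exp t < e means t < ln e, so the ray below ln e is a neighbourhood of
        -\<infinity> that \<open>squash\<close> maps below e.\<close>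
      have "dist (squash y) (squash x) < e" if "y < ereal (ln e)" for y
      proof (cases y)
        case (real t)
        with that have "exp t < exp (ln e)" by simp
        then show ?thesis using e by (simp add: real 2 squash_def)
      qed (use that e in \<open>auto simp: 2 squash_def\<close>)
      then show "\<forall>\<^sub>F y in at x. dist (squash y) (squash x) < e"
        unfolding eventually_at_topological by (intro exI[of _ "{..<ereal (ln e)}"]) (auto simp: 2)
    qed
  qed
qed

section \<open>The contraction inequality for mixtures and for their weak limits\<close>

context pou
begin

lemma shrink_measurable [measurable]:
  "0 < k \<Longrightarrow> (\<lambda>x. raise x (k * height x)) \<in> measurable (M0 d x0) (M0 d x0)"
  by (rule measurable_raise) (auto simp: space_M0 D0_coord_1(2))

lemma shrink_sets:
  assumes "A \<in> sets (M0 d x0)" "0 < k" shows "{x \<in> D0 d x0. raise x (k * height x) \<in> A} \<in> sets (M0 d x0)"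
  by (rule back_subst[where P="\<lambda>S. S \<in> sets (M0 d x0)", OF measurable_sets[OF shrink_measurable assms(1)]])
     (use assms(2) in \<open>auto simp: space_M0\<close>)

lemma unif_POU_D:
  assumes "Q \<in> unif_POU d x0"
  shows "sets Q = sets (M0 d x0)" and "prob_space Q"
    and "0 < k \<Longrightarrow> k < 1 \<Longrightarrow> A \<in> sets (M0 d x0) \<Longrightarrow>
      ennreal k * emeasure Q {x \<in> D0 d x0. raise x (k * height x) \<in> A} \<le> emeasure Q A"
proof -
  obtain K where Q: "Q = uniform_measure (Leb0 d x0) K" and K: "POU_set d x0 K"
    "0 < emeasure (Leb0 d x0) K" "emeasure (Leb0 d x0) K < \<infinity>"
    using assms by (auto simp: unif_POU_def)
  show "sets Q = sets (M0 d x0)" by (simp add: Q)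
  show "prob_space Q" unfolding Q using K by (intro prob_space_uniform_measure) auto
  assume k: "0 < k" "k < 1" and A: "A \<in> sets (M0 d x0)"
  have "K \<in> sets (M0 d x0)" using K(1) by (simp add: POU_set_def)
  then show "ennreal k * emeasure Q {x \<in> D0 d x0. raise x (k * height x) \<in> A} \<le> emeasure Q A"
    unfolding Q using shrink_POU[OF K(1) k A] A shrink_sets[OF A k(1)]
    by (simp add: divide_right_mono_ennreal ennreal_times_divide)
qed

lemma conv_hull_D:
  assumes "Q \<in> conv_hull_meas (M0 d x0) (unif_POU d x0)"
  shows "sets Q = sets (M0 d x0)" and "prob_space Q"
    and "0 < k \<Longrightarrow> k < 1 \<Longrightarrow> A \<in> sets (M0 d x0) \<Longrightarrow>
      ennreal k * emeasure Q {x \<in> D0 d x0. raise x (k * height x) \<in> A} \<le> emeasure Q A"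
proof -
  obtain ps where Q: "Q = mixture (M0 d x0) ps" and ps: "\<forall>(w, Q)\<in>set ps. 0 \<le> w \<and> Q \<in> unif_POU d x0"
    and sum: "(\<Sum>(w, Q)\<leftarrow>ps. w) = 1"
    using assms by (auto simp: conv_hull_meas_def)
  show "sets Q = sets (M0 d x0)" by (simp add: Q)
  show "prob_space Q" unfolding Q
    by (rule prob_space_mixture) (use ps sum unif_POU_D(1,2) in auto)
  assume k: "0 < k" "k < 1" and A: "A \<in> sets (M0 d x0)"
  have "emeasure Q {x \<in> D0 d x0. raise x (k * height x) \<in> A} = (\<Sum>(w, Q)\<leftarrow>ps. ennreal w * emeasure Q {x \<in> D0 d x0. raise x (k * height x) \<in> A})"
    unfolding Q by (intro emeasure_mixture shrink_sets A k) (use ps unif_POU_D(1) in auto)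
  moreover have "emeasure Q A = (\<Sum>(w, Q)\<leftarrow>ps. ennreal w * emeasure Q A)"
    unfolding Q by (intro emeasure_mixture A) (use ps unif_POU_D(1) in auto)
  moreover have "ennreal k * (\<Sum>(w, Q)\<leftarrow>ps. ennreal w * emeasure Q {x \<in> D0 d x0. raise x (k * height x) \<in> A})
      \<le> (\<Sum>(w, Q)\<leftarrow>ps. ennreal w * emeasure Q A)"
    using ps
  proof (induction ps)
    case (Cons p ps)
    obtain w R where p: "p = (w, R)" by force
    have R: "R \<in> unif_POU d x0" using Cons.prems by (auto simp: p)
    have "ennreal w * (ennreal k * emeasure R {x \<in> D0 d x0. raise x (k * height x) \<in> A}) \<le> ennreal w * emeasure R A"
      by (intro mult_left_mono unif_POU_D(3)[OF R k A]) simp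
    moreover have "ennreal k * (\<Sum>(w, Q)\<leftarrow>ps. ennreal w * emeasure Q {x \<in> D0 d x0. raise x (k * height x) \<in> A})
      \<le> (\<Sum>(w, Q)\<leftarrow>ps. ennreal w * emeasure Q A)" by (rule Cons.IH) (use Cons.prems in auto)
    ultimately show ?case by (simp add: p distrib_left add_mono ac_simps)
  qed simp
  ultimately show "ennreal k * emeasure Q {x \<in> D0 d x0. raise x (k * height x) \<in> A} \<le> emeasure Q A" by simp
qed

text \<open>The inequality on sets says that \<open>k\<close> times the image of \<open>Q\<close>
  under the contraction is a measure below \<open>Q\<close>, and integrals of nonnegative functions
  are monotone in the measure.\<close>

lemma conv_hull_integral_shrink:
  assumes Q: "Q \<in> conv_hull_meas (M0 d x0) (unif_POU d x0)" and k: "0 < k" "k < 1"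
    and f[measurable]: "f \<in> borel_measurable (M0 d x0)" and f01: "\<And>x. 0 \<le> f x \<and> f x \<le> (1::real)"
  shows "k * (\<integral>x. f (raise x (k * height x)) \<partial>Q) \<le> (\<integral>x. f x \<partial>Q)"
proof -
  note Q' = conv_hull_D[OF Q]
  interpret prob_space Q by (rule Q'(2))
  note Q'(1)[measurable_cong]
  have [measurable]: "(\<lambda>x. raise x (k * height x)) \<in> measurable (M0 d x0) (M0 d x0)"
    using k by simp
  let ?S = "scale_measure (ennreal k) (distr Q (M0 d x0) (\<lambda>x. raise x (k * height x)))"
  have "?S \<le> Q"
  proof (subst le_measure, simp add: Q'(1), intro ballI)
    fix A assume "A \<in> sets ?S"
    then have A[measurable]: "A \<in> sets (M0 d x0)" by simp
    have "emeasure ?S A = ennreal k * emeasure Q {x \<in> D0 d x0. raise x (k * height x) \<in> A}"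
      using sets_eq_imp_space_eq[OF Q'(1)]
      by (simp add: emeasure_distr) (auto simp: space_M0 intro!: arg_cong[where f="\<lambda>B. ennreal k * emeasure Q B"])
    then show "emeasure ?S A \<le> emeasure Q A" using Q'(3)[OF k A] by simp
  qed
  then have "(\<integral>\<^sup>+x. ennreal (f x) \<partial>?S) \<le> (\<integral>\<^sup>+x. ennreal (f x) \<partial>Q)"
    by (intro nn_integral_mono_measure) (simp_all add: Q'(1))
  then have "ennreal k * (\<integral>\<^sup>+x. ennreal (f (raise x (k * height x))) \<partial>Q) \<le> (\<integral>\<^sup>+x. ennreal (f x) \<partial>Q)"
    by (simp add: nn_integral_scale_measure nn_integral_distr)
  moreover have "(\<integral>\<^sup>+x. ennreal (f (raise x (k * height x))) \<partial>Q) = ennreal (\<integral>x. f (raise x (k * height x)) \<partial>Q)"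
    by (intro nn_integral_eq_integral integrable_const_bound[where B=1]) (use f01 in auto)
  moreover have "(\<integral>\<^sup>+x. ennreal (f x) \<partial>Q) = ennreal (\<integral>x. f x \<partial>Q)"
    by (intro nn_integral_eq_integral integrable_const_bound[where B=1]) (use f01 in auto)
  moreover have "0 \<le> (\<integral>x. f (raise x (k * height x)) \<partial>Q)" "0 \<le> (\<integral>x. f x \<partial>Q)" using f01 by (auto intro: integral_nonneg)
  ultimately show ?thesis using k by (simp add: ennreal_mult[symmetric])
qed

text \<open>The padding by 0 makes the target the space of all real sequences, which is Polish in
  the product topology.\<close>

definition squash_all :: "(nat \<Rightarrow> ereal) \<Rightarrow> (nat \<Rightarrow> real)" where
  "squash_all x = (\<lambda>j. if j \<in> {1..d} then squash (x j) else 0)"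

lemma continuous_on_coord: "continuous_on (D0 d x0) (\<lambda>x. x j)"
  by (rule continuous_on_subset[OF continuous_on_product_coordinates]) simp

lemma continuous_on_squash_coord: "j \<in> {1..d} \<Longrightarrow> continuous_on (D0 d x0) (\<lambda>x. squash (x j))"
  by (rule continuous_on_compose2[OF continuous_on_squash continuous_on_coord]) (use D0_D in auto)

lemma continuous_on_squash_all: "continuous_on (D0 d x0) squash_all"
proof (rule continuous_on_coordinatewise_then_product)
  show "continuous_on (D0 d x0) (\<lambda>x. squash_all x j)" for j
    unfolding squash_all_def using continuous_on_squash_coord[of j] by (cases "j \<in> {1..d}") auto
qed

lemma continuous_on_height: "continuous_on (D0 d x0) height"
proof -
  have "continuous_on {y::ereal. \<bar>y\<bar> \<noteq> \<infinity>} real_of_ereal"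
    by (rule continuous_at_imp_continuous_on) (auto intro: continuous_at_of_ereal)
  then have "continuous_on (D0 d x0) (\<lambda>x. real_of_ereal (x 1))"
    by (rule continuous_on_compose2[OF _ continuous_on_coord]) (use D0_coord_1(1) in force)
  then show ?thesis unfolding height_def by (intro continuous_intros)
qed

lemma continuous_on_squash_all_shrink: "continuous_on (D0 d x0) (\<lambda>x. squash_all (raise x (k * height x)))"
proof (rule continuous_on_coordinatewise_then_product)
  fix j
  consider "j = 1" | "j \<in> {2..d}" | "j \<notin> {1..d}" using coords_eq by auto
  then show "continuous_on (D0 d x0) (\<lambda>x. squash_all (raise x (k * height x)) j)"
  proof cases
    case 1
    have "continuous_on (D0 d x0) (\<lambda>x. exp (r0 + k * height x))"
      by (intro continuous_intros continuous_on_height)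
    then show ?thesis using 1 d by (simp add: squash_all_def squash_def)
  next
    case 2
    then show ?thesis using continuous_on_squash_coord[of j] by (simp add: squash_all_def)
  next
    case 3
    then show ?thesis unfolding squash_all_def by (simp only: if_False continuous_on_const)
  qed
qed

lemma measurable_squash_all [measurable]: "squash_all \<in> borel_measurable (M0 d x0)"
proof (rule measurable_coordinatewise_then_product)
  show "(\<lambda>x. squash_all x j) \<in> borel_measurable (M0 d x0)" for j
    unfolding squash_all_def using measurable_compose[OF measurable_coord[of j] measurable_squash]
    by (cases "j \<in> {1..d}") auto
qed

text \<open>Coordinatewise \<open>unsquash\<close> is a measurable left inverse of
  \<open>squash_all\<close> on the domain; the preimage of \<open>A\<close> under it serves as
  \<open>B\<close>.\<close>

lemma squash_all_preimage:
  assumes "A \<in> sets (M0 d x0)"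
  obtains B where "B \<in> sets borel" "\<And>x. x \<in> D0 d x0 \<Longrightarrow> squash_all x \<in> B \<longleftrightarrow> x \<in> A"
proof -
  define un where "un y = (\<lambda>j\<in>{1..d}. unsquash (y j))" for y :: "nat \<Rightarrow> real"
  have un: "un \<in> measurable borel (amb d)"
    unfolding un_def amb_def
    by (rule measurable_restrict) (rule measurable_compose[OF _ measurable_unsquash], simp add: measurable_product_coordinates)
  have inv: "un (squash_all x) = x" if x: "x \<in> D0 d x0" for x
  proof
    fix j
    have "x \<in> extensional {1..d}" using x by (auto simp: D0_def space_amb PiE_iff)
    then show "un (squash_all x) j = x j"
      using D0_D[OF x, of j] by (auto simp: un_def squash_all_def unsquash_squash extensional_def)
  qed
  show thesis
  proof (rule that)
    show "un -` A \<in> sets borel" using measurable_sets[OF un, of A] assms by (simp add: sets_M0_iff)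
  qed (simp add: inv)
qed

text \<open>Weak approximation controls only continuous observables, so the inequality is first
  passed to the limit for f composed with \<open>squash_all\<close>, before and after the
  contraction. Both compositions are bounded and continuous on the domain. In the sequence space the
  inequality then extends to Borel sets, and \<open>squash_all_preimage\<close> brings it
  back.\<close>

lemma is_1POU_shrink:
  assumes P: "is_1POU d x0 P" and k: "0 < k" "k < 1" and A: "A \<in> sets (M0 d x0)"
  shows "ennreal k * emeasure P {x \<in> D0 d x0. raise x (k * height x) \<in> A} \<le> emeasure P A"
proof -
  have P': "prob_space P" "sets P = sets (M0 d x0)" using P by (auto simp: is_1POU_def)
  interpret prob_space P by (rule P'(1))
  note P'(2)[measurable_cong]
  have space_P: "space P = D0 d x0" using sets_eq_imp_space_eq[OF P'(2)] by (simp add: space_M0)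
  have [measurable]: "(\<lambda>x. raise x (k * height x)) \<in> measurable (M0 d x0) (M0 d x0)"
    using k by simp
  define M1 where "M1 = distr P borel (\<lambda>x. squash_all (raise x (k * height x)))"
  define M2 where "M2 = distr P borel squash_all"
  obtain B where B: "B \<in> sets borel" "\<And>x. x \<in> D0 d x0 \<Longrightarrow> squash_all x \<in> B \<longleftrightarrow> x \<in> A"
    using squash_all_preimage[OF A] by blast
  have B1: "emeasure M1 B = emeasure P {x \<in> D0 d x0. raise x (k * height x) \<in> A}"
    unfolding M1_def using B k
    by (subst emeasure_distr) (auto simp: space_P D0_coord_1(2) intro!: arg_cong[where f="emeasure P"])
  have B2: "emeasure M2 B = emeasure P A"
    unfolding M2_def using B sets.sets_into_space[OF A]
    by (subst emeasure_distr) (auto simp: space_P space_M0 intro!: arg_cong[where f="emeasure P"])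
  have "ennreal k * emeasure M1 B \<le> emeasure M2 B"
  proof (rule emeasure_le_if_integral_le)
    show "prob_space M1" "prob_space M2" unfolding M1_def M2_def by (auto intro!: prob_space_distr)
    fix f :: "(nat \<Rightarrow> real) \<Rightarrow> real" assume f: "continuous_on UNIV f" "\<And>x. 0 \<le> f x \<and> f x \<le> 1"
    have f_meas[measurable]: "f \<in> borel_measurable borel" by (rule borel_measurable_continuous_onI) fact
    let ?f1 = "\<lambda>x. f (squash_all (raise x (k * height x)))" and ?f2 = "\<lambda>x. f (squash_all x)"
    have cont: "continuous_on (D0 d x0) ?f1" "continuous_on (D0 d x0) ?f2"
      by (auto intro!: continuous_on_compose2[OF f(1)] continuous_on_squash_all continuous_on_squash_all_shrink)
    have bdd: "bounded (?f1 ` D0 d x0)" "bounded (?f2 ` D0 d x0)"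
      using f(2) by (auto simp: bounded_iff intro!: exI[of _ 1])
    have "k * (\<integral>x. ?f1 x \<partial>P) \<le> (\<integral>x. ?f2 x \<partial>P)"
    proof (rule field_le_epsilon)
      fix e :: real assume e: "0 < e"
      have "P \<in> weak_closure (M0 d x0) (D0 d x0) (conv_hull_meas (M0 d x0) (unif_POU d x0))"
        using P by (simp add: is_1POU_def)
      then have "\<forall>F (\<epsilon>::real). finite F \<and> \<epsilon> > 0 \<and>
        (\<forall>f\<in>F. continuous_on (D0 d x0) f \<and> bounded (f ` D0 d x0) \<and> f \<in> borel_measurable (M0 d x0)) \<longrightarrow>
        (\<exists>Q\<in>conv_hull_meas (M0 d x0) (unif_POU d x0). \<forall>f\<in>F. \<bar>(\<integral>x. f x \<partial>P) - (\<integral>x. f x \<partial>Q)\<bar> < \<epsilon>)"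
        unfolding weak_closure_def by blast
      \<comment> \<open>The same \<open>Q\<close> has to approximate both integrals, so they are
        tested together. As k < 1, the two errors add up to at most e.\<close>
      from this[rule_format, of "{?f1, ?f2}" "e / 2"] obtain Q
        where Q: "Q \<in> conv_hull_meas (M0 d x0) (unif_POU d x0)"
          "\<bar>(\<integral>x. ?f1 x \<partial>P) - (\<integral>x. ?f1 x \<partial>Q)\<bar> < e / 2"
          "\<bar>(\<integral>x. ?f2 x \<partial>P) - (\<integral>x. ?f2 x \<partial>Q)\<bar> < e / 2"
        using cont bdd e by auto
      have "k * (\<integral>x. ?f1 x \<partial>Q) \<le> (\<integral>x. ?f2 x \<partial>Q)"
        by (rule conv_hull_integral_shrink[OF Q(1) k]) (use f(2) in auto)
      moreover have "k * (\<integral>x. ?f1 x \<partial>P) \<le> k * (\<integral>x. ?f1 x \<partial>Q) + e / 2"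
      proof -
        have "k * ((\<integral>x. ?f1 x \<partial>P) - (\<integral>x. ?f1 x \<partial>Q)) \<le> k * (e / 2)"
          by (rule mult_left_mono) (use k Q(2) in linarith)+
        also have "\<dots> \<le> 1 * (e / 2)" by (rule mult_right_mono) (use k e in auto)
        finally show ?thesis by (simp add: algebra_simps)
      qed
      ultimately show "k * (\<integral>x. ?f1 x \<partial>P) \<le> (\<integral>x. ?f2 x \<partial>P) + e" using Q(3) by linarith
    qed
    then show "k * (\<integral>x. f x \<partial>M1) \<le> (\<integral>x. f x \<partial>M2)"
      unfolding M1_def M2_def by (simp add: integral_distr)
  qed (use k B in \<open>auto simp: M1_def M2_def\<close>)
  then show ?thesis by (simp add: B1 B2)
qed

end

section \<open>Lifts are 1-POU\<close>

text \<open>The sum of measures is known only through its values on sets, so the integral is built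
  up by induction on the function. With \<open>R\<close> the mixture of the remaining list this is
  the induction step for mixtures.\<close>

lemma nn_integral_add_measure:
  assumes sets: "sets N = sets M" "sets Q = sets M" "sets R = sets M"
    and em: "\<And>A. A \<in> sets M \<Longrightarrow> emeasure N A = w * emeasure Q A + emeasure R A"
    and f: "f \<in> borel_measurable M"
  shows "(\<integral>\<^sup>+x. f x \<partial>N) = w * (\<integral>\<^sup>+x. f x \<partial>Q) + (\<integral>\<^sup>+x. f x \<partial>R)"
  using f
proof (induction rule: borel_measurable_induct)
  case (cong f g)
  have "space N = space M" "space Q = space M" "space R = space M" using sets by (auto dest: sets_eq_imp_space_eq)
  then have "integral\<^sup>N L f = integral\<^sup>N L g" if "L \<in> {N, Q, R}" for L
    by (intro nn_integral_cong cong(3)) (use that in auto)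
  then show ?case using cong(4) by simp
next
  case (set A)
  then show ?case using em sets by simp
next
  case (mult u c)
  then show ?case using sets by (simp add: nn_integral_cmult distrib_left ac_simps cong: measurable_cong_sets)
next
  case (add u v)
  then show ?case using sets by (simp add: nn_integral_add distrib_left ac_simps cong: measurable_cong_sets)
next
  case (seq U)
  have m: "U i \<in> borel_measurable N" "U i \<in> borel_measurable Q" "U i \<in> borel_measurable R" for i
    using seq sets by (auto cong: measurable_cong_sets)
  have mono: "incseq (\<lambda>i. \<integral>\<^sup>+x. U i x \<partial>L)" for L
    using seq(3) by (auto simp: incseq_def le_fun_def intro!: nn_integral_mono)
  have "(\<integral>\<^sup>+x. (SUP i. U i) x \<partial>L) = (SUP i. \<integral>\<^sup>+x. U i x \<partial>L)" if "\<And>i. U i \<in> borel_measurable L" for L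
    using seq(3) that by (simp add: nn_integral_monotone_convergence_SUP image_comp)
  then have lim: "(\<integral>\<^sup>+x. (SUP i. U i) x \<partial>N) = (SUP i. \<integral>\<^sup>+x. U i x \<partial>N)"
    "(\<integral>\<^sup>+x. (SUP i. U i) x \<partial>Q) = (SUP i. \<integral>\<^sup>+x. U i x \<partial>Q)"
    "(\<integral>\<^sup>+x. (SUP i. U i) x \<partial>R) = (SUP i. \<integral>\<^sup>+x. U i x \<partial>R)" using m by auto
  have IH: "(\<integral>\<^sup>+x. U i x \<partial>N) = w * (\<integral>\<^sup>+x. U i x \<partial>Q) + (\<integral>\<^sup>+x. U i x \<partial>R)" for i
    by (rule seq)
  have mono_w: "incseq (\<lambda>i. w * (\<integral>\<^sup>+x. U i x \<partial>Q))"
    using mono[of Q] by (auto simp: incseq_def intro!: mult_left_mono)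
  show ?case
    unfolding lim IH by (simp only: SUP_mult_left_ennreal ennreal_SUP_add[OF mono_w mono])
qed

lemma nn_integral_mixture:
  assumes ps: "\<And>w Q. (w, Q) \<in> set ps \<Longrightarrow> sets Q = sets M" and f: "f \<in> borel_measurable M"
  shows "(\<integral>\<^sup>+x. f x \<partial>mixture M ps) = (\<Sum>(w, Q)\<leftarrow>ps. ennreal w * (\<integral>\<^sup>+x. f x \<partial>Q))"
  using ps
proof (induction ps)
  case Nil
  have "emeasure (mixture M []) (space (mixture M [])) = 0" by (subst emeasure_mixture) auto
  then have "AE x in mixture M []. f x = 0" by (intro AE_I[of _ _ "space (mixture M [])"]) auto
  then have "(\<integral>\<^sup>+x. f x \<partial>mixture M []) = (\<integral>\<^sup>+x. 0 \<partial>mixture M [])" by (rule nn_integral_cong_AE)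
  then show ?case by simp
next
  case (Cons p ps)
  obtain w Q where p: "p = (w, Q)" by force
  have "(\<integral>\<^sup>+x. f x \<partial>mixture M (p # ps)) = ennreal w * (\<integral>\<^sup>+x. f x \<partial>Q) + (\<integral>\<^sup>+x. f x \<partial>mixture M ps)"
  proof (rule nn_integral_add_measure[OF _ _ _ _ f])
    fix A assume A: "A \<in> sets M"
    have "emeasure (mixture M ps) A = (\<Sum>(w, Q)\<leftarrow>ps. ennreal w * emeasure Q A)"
      by (rule emeasure_mixture) (use Cons.prems A in auto)
    moreover have "emeasure (mixture M (p # ps)) A = (\<Sum>(w, Q)\<leftarrow>p # ps. ennreal w * emeasure Q A)"
      by (rule emeasure_mixture) (use Cons.prems A in auto)
    ultimately show "emeasure (mixture M (p # ps)) A = ennreal w * emeasure Q A + emeasure (mixture M ps) A"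
      by (simp add: p)
  qed (use Cons.prems p in auto)
  also have "(\<integral>\<^sup>+x. f x \<partial>mixture M ps) = (\<Sum>(w, Q)\<leftarrow>ps. ennreal w * (\<integral>\<^sup>+x. f x \<partial>Q))"
    by (rule Cons.IH) (use Cons.prems in auto)
  finally show ?case by (simp add: p)
qed

text \<open>Adding the bound \<open>B\<close> makes the function nonnegative, so the formula for
  \<open>nn_integral\<close> applies; as the weights sum to 1, the shift cancels.\<close>

lemma integral_mixture:
  fixes f :: "'a \<Rightarrow> real"
  assumes ps: "\<And>w Q. (w, Q) \<in> set ps \<Longrightarrow> sets Q = sets M \<and> prob_space Q \<and> 0 \<le> w"
    and sum: "(\<Sum>(w, Q)\<leftarrow>ps. w) = 1"
    and f: "f \<in> borel_measurable M" and B: "\<And>x. x \<in> space M \<Longrightarrow> \<bar>f x\<bar> \<le> B"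
  shows "(\<integral>x. f x \<partial>mixture M ps) = (\<Sum>(w, Q)\<leftarrow>ps. w * (\<integral>x. f x \<partial>Q))"
proof -
  have shift: "(\<integral>\<^sup>+x. ennreal (f x + B) \<partial>P) = ennreal ((\<integral>x. f x \<partial>P) + B)" "0 \<le> (\<integral>x. f x \<partial>P) + B"
    if P: "prob_space P" "sets P = sets M" for P
  proof -
    interpret prob_space P by (rule P(1))
    have sp: "space P = space M" using P(2) by (rule sets_eq_imp_space_eq)
    have int: "integrable P f"
      by (rule integrable_const_bound[where B=B]) (use f B P(2) sp in \<open>auto cong: measurable_cong_sets\<close>)
    have pos: "AE x in P. 0 \<le> f x + B" using B sp by (intro AE_I2) force
    have "(\<integral>\<^sup>+x. ennreal (f x + B) \<partial>P) = ennreal (\<integral>x. f x + B \<partial>P)"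
      using int pos by (intro nn_integral_eq_integral) auto
    also have "(\<integral>x. f x + B \<partial>P) = (\<integral>x. f x \<partial>P) + B" using int by (simp add: prob_space)
    finally show "(\<integral>\<^sup>+x. ennreal (f x + B) \<partial>P) = ennreal ((\<integral>x. f x \<partial>P) + B)" .
    have "0 \<le> (\<integral>x. f x + B \<partial>P)" using pos by (rule integral_nonneg_AE)
    then show "0 \<le> (\<integral>x. f x \<partial>P) + B" using int by (simp add: prob_space)
  qed
  have mix: "prob_space (mixture M ps)" by (rule prob_space_mixture[OF ps sum])
  have "ennreal ((\<integral>x. f x \<partial>mixture M ps) + B) = (\<Sum>(w, Q)\<leftarrow>ps. ennreal w * (\<integral>\<^sup>+x. ennreal (f x + B) \<partial>Q))"
    unfolding shift(1)[OF mix sets_mixture, symmetric]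
    by (rule nn_integral_mixture) (use ps f in auto)
  moreover have "(\<Sum>(w, Q)\<leftarrow>ps. ennreal w * (\<integral>\<^sup>+x. ennreal (f x + B) \<partial>Q))
      = ennreal ((\<Sum>(w, Q)\<leftarrow>ps. w * (\<integral>x. f x \<partial>Q)) + B * (\<Sum>(w, Q)\<leftarrow>ps. w))
      \<and> 0 \<le> (\<Sum>(w, Q)\<leftarrow>ps. w * (\<integral>x. f x \<partial>Q)) + B * (\<Sum>(w, Q)\<leftarrow>ps. w)"
    using ps
  proof (induction ps)
    case (Cons p ps)
    obtain w Q where p: "p = (w, Q)" by force
    have Q: "sets Q = sets M" "prob_space Q" "0 \<le> w" using Cons.prems[of w Q] by (auto simp: p)
    have IH: "(\<Sum>(w, Q)\<leftarrow>ps. ennreal w * (\<integral>\<^sup>+x. ennreal (f x + B) \<partial>Q))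
      = ennreal ((\<Sum>(w, Q)\<leftarrow>ps. w * (\<integral>x. f x \<partial>Q)) + B * (\<Sum>(w, Q)\<leftarrow>ps. w))"
      "0 \<le> (\<Sum>(w, Q)\<leftarrow>ps. w * (\<integral>x. f x \<partial>Q)) + B * (\<Sum>(w, Q)\<leftarrow>ps. w)"
      using Cons.IH Cons.prems by auto
    have w0: "0 \<le> w * ((\<integral>x. f x \<partial>Q) + B)" using shift(2)[OF Q(2,1)] Q(3) by simp
    have "ennreal w * (\<integral>\<^sup>+x. ennreal (f x + B) \<partial>Q) = ennreal (w * ((\<integral>x. f x \<partial>Q) + B))"
      unfolding shift(1)[OF Q(2,1)] using Q(3) shift(2)[OF Q(2,1)] by (simp add: ennreal_mult del: ennreal_plus)
    then show ?case
      using IH w0 by (simp add: p ennreal_plus[symmetric] algebra_simps del: ennreal_plus)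
  qed simp
  ultimately have "ennreal ((\<integral>x. f x \<partial>mixture M ps) + B) = ennreal ((\<Sum>(w, Q)\<leftarrow>ps. w * (\<integral>x. f x \<partial>Q)) + B)"
    "0 \<le> (\<Sum>(w, Q)\<leftarrow>ps. w * (\<integral>x. f x \<partial>Q)) + B" by (simp_all add: sum)
  then show ?thesis using shift(2)[OF mix sets_mixture] by simp
qed

text \<open>Finitely many bounded observables can be integrated, up to a given error, against a finitely
  supported law: group the points by the rounded values of the observables and keep one
  representative per group.\<close>

lemma finite_support_approximation:
  fixes F :: "('a \<Rightarrow> real) set"
  assumes "prob_space Q" and F: "finite F" "\<And>f. f \<in> F \<Longrightarrow> f \<in> borel_measurable Q"
    and B: "\<And>f x. f \<in> F \<Longrightarrow> x \<in> space Q \<Longrightarrow> \<bar>f x\<bar> \<le> B"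
    and S: "S \<in> sets Q" "AE x in Q. x \<in> S" and e: "0 < e"
  obtains Y p where "finite Y" "Y \<subseteq> S" "\<And>y. y \<in> Y \<Longrightarrow> 0 \<le> p y" "(\<Sum>y\<in>Y. p y) = (1::real)"
    "\<And>f. f \<in> F \<Longrightarrow> \<bar>(\<integral>x. f x \<partial>Q) - (\<Sum>y\<in>Y. p y * f y)\<bar> \<le> e"
proof -
  interpret prob_space Q by fact
  \<comment> \<open>Rounding to multiples of \<open>e\<close>: points with equal keys have values
    within \<open>e\<close> of each other for every observable. The default 0 outside
    \<open>F\<close> keeps the set of keys finite.\<close>
  define key where "key x = (\<lambda>f. if f \<in> F then \<lfloor>f x / e\<rfloor> else 0)" for x
  have S_space: "S \<subseteq> space Q" using S(1) by (rule sets.sets_into_space)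
  have "key x f \<in> {\<lfloor>- B / e\<rfloor>..\<lfloor>B / e\<rfloor>}" if "x \<in> S" "f \<in> F" for x f
  proof -
    have "\<bar>f x\<bar> \<le> B" using B that S_space by blast
    then have "- B / e \<le> f x / e" "f x / e \<le> B / e" using e by (simp_all add: field_simps)
    then show ?thesis using that by (simp add: key_def floor_mono)
  qed
  moreover have "key x f = 0" if "f \<notin> F" for x f using that by (simp add: key_def)
  ultimately have "key ` S \<subseteq> {g. \<forall>f. (f \<in> F \<longrightarrow> g f \<in> {\<lfloor>- B / e\<rfloor>..\<lfloor>B / e\<rfloor>}) \<and> (f \<notin> F \<longrightarrow> g f = 0)}"
    by blast
  then have fin_key: "finite (key ` S)"
    by (rule finite_subset) (rule finite_set_of_finite_funs[OF F(1)], simp)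
  define rep where "rep g = (SOME x. x \<in> S \<and> key x = g)" for g
  have rep: "rep (key x) \<in> S \<and> key (rep (key x)) = key x" if "x \<in> S" for x
    unfolding rep_def by (rule someI[of _ x]) (use that in simp)
  define Y where "Y = rep ` key ` S"
  define cell where "cell y = {x \<in> S. key x = key y}" for y
  have Y: "finite Y" "Y \<subseteq> S" using fin_key rep by (auto simp: Y_def)
  have cell_sets: "cell y \<in> sets Q" for y
  proof -
    have "cell y = S \<inter> {x \<in> space Q. \<forall>f\<in>F. \<lfloor>f x / e\<rfloor> = \<lfloor>f y / e\<rfloor>}"
      using S_space by (auto simp: cell_def key_def fun_eq_iff split: if_splits)
    moreover have "{x \<in> space Q. \<forall>f\<in>F. \<lfloor>f x / e\<rfloor> = \<lfloor>f y / e\<rfloor>} \<in> sets Q"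
    proof (rule sets.sets_Collect_finite_All[OF _ F(1)])
      fix f assume "f \<in> F"
      then have [measurable]: "f \<in> borel_measurable Q" by (rule F(2))
      show "{x \<in> space Q. \<lfloor>f x / e\<rfloor> = \<lfloor>f y / e\<rfloor>} \<in> sets Q" by measurable
    qed
    ultimately show ?thesis using S(1) by simp
  qed
  have close: "\<bar>f x - f (rep (key x))\<bar> \<le> e" if "x \<in> S" "f \<in> F" for x f
  proof -
    have "\<lfloor>f x / e\<rfloor> = \<lfloor>f (rep (key x)) / e\<rfloor>" using rep[OF that(1)] that(2) by (auto simp: key_def fun_eq_iff split: if_splits)
    then have "\<bar>f x / e - f (rep (key x)) / e\<bar> \<le> 1" by linarith
    then show ?thesis using e by (simp add: diff_divide_distrib[symmetric] abs_divide)
  qed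
  \<comment> \<open>The cells of the representatives partition \<open>S\<close>, so exactly one
    summand survives: that of the representative of x.\<close>
  have step: "f (rep (key x)) = (\<Sum>y\<in>Y. f y * indicator (cell y) x)" if x: "x \<in> S" for x and f :: "'a \<Rightarrow> real"
  proof -
    have "(\<Sum>y\<in>Y. f y * indicator (cell y) x) = (\<Sum>y\<in>Y. if y = rep (key x) then f y else 0)"
    proof (rule sum.cong[OF refl])
      fix y assume "y \<in> Y"
      then obtain x' where x': "x' \<in> S" "y = rep (key x')" by (auto simp: Y_def)
      then have key_y: "key y = key x'" using rep by simp
      then have "x \<in> cell y \<longleftrightarrow> key x = key x'" using x by (simp add: cell_def)
      also have "\<dots> \<longleftrightarrow> y = rep (key x)"
      proof
        assume "y = rep (key x)"
        then have "key y = key x" using rep[OF x] by simp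
        then show "key x = key x'" using key_y by simp
      qed (simp add: x'(2))
      finally have "x \<in> cell y \<longleftrightarrow> y = rep (key x)" .
      then show "f y * indicator (cell y) x = (if y = rep (key x) then f y else 0)" by (simp add: indicator_def)
    qed
    also have "\<dots> = f (rep (key x))" using Y(1) x by (simp add: Y_def)
    finally show ?thesis by simp
  qed
  have int_step: "(\<integral>x. (\<Sum>y\<in>Y. f y * indicator (cell y) x) \<partial>Q) = (\<Sum>y\<in>Y. measure Q (cell y) * f y)" for f :: "'a \<Rightarrow> real"
    using cell_sets by (subst Bochner_Integration.integral_sum) (auto simp: mult.commute emeasure_eq_measure)
  show thesis
  proof (rule that[of Y "\<lambda>y. measure Q (cell y)"])
    have "(\<Sum>y\<in>Y. measure Q (cell y)) = (\<integral>x. (\<Sum>y\<in>Y. 1 * indicator (cell y) x) \<partial>Q)"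
      unfolding int_step by simp
    also have "\<dots> = (\<integral>x. 1 \<partial>Q)"
      using cell_sets by (intro integral_cong_AE) (use S(2) step[of _ "\<lambda>_. 1"] in \<open>auto elim!: eventually_mono\<close>)
    finally show "(\<Sum>y\<in>Y. measure Q (cell y)) = 1" by (simp add: prob_space)
    fix f assume f: "f \<in> F"
    have f_int: "integrable Q f"
      by (rule integrable_const_bound[where B=B]) (use F(2)[OF f] B[OF f] in auto)
    have s_int: "integrable Q (\<lambda>x. \<Sum>y\<in>Y. f y * indicator (cell y) x)"
      using cell_sets by (auto simp: emeasure_eq_measure)
    have "\<bar>(\<integral>x. f x \<partial>Q) - (\<Sum>y\<in>Y. measure Q (cell y) * f y)\<bar>
        = \<bar>\<integral>x. f x - (\<Sum>y\<in>Y. f y * indicator (cell y) x) \<partial>Q\<bar>"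
      using f_int s_int by (simp add: int_step[symmetric])
    also have "\<dots> \<le> (\<integral>x. \<bar>f x - (\<Sum>y\<in>Y. f y * indicator (cell y) x)\<bar> \<partial>Q)"
      by (rule integral_abs_bound)
    also have "\<dots> \<le> (\<integral>x. e \<partial>Q)"
    proof (rule integral_mono_AE)
      show "AE x in Q. \<bar>f x - (\<Sum>y\<in>Y. f y * indicator (cell y) x)\<bar> \<le> e"
        using S(2)
      proof eventually_elim
        case (elim x)
        show ?case using close[OF elim f] step[OF elim, of f] by simp
      qed
    qed (use f_int s_int in auto)
    finally show "\<bar>(\<integral>x. f x \<partial>Q) - (\<Sum>y\<in>Y. measure Q (cell y) * f y)\<bar> \<le> e" by (simp add: prob_space)
  qed (use Y in auto)
qed

section \<open>Uniform laws on boxes standing on the bottom face\<close>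

locale pou_box = pou +
  fixes h :: real and l r :: "nat \<Rightarrow> real"
  assumes h: "0 < h" and lr: "\<And>j. j \<in> {2..d} \<Longrightarrow> l j < r j" and x0_l: "\<And>j. j \<in> {2..d} \<Longrightarrow> x0 j \<le> ereal (l j)"
begin

abbreviation "W \<equiv> PiM {2..d} (\<lambda>_. lborel :: real measure)"

definition "C = PiE {2..d} (\<lambda>j. {l j..r j})"

definition "K = {x \<in> D0 d x0. x 1 \<le> ereal (r0 + h) \<and> (\<forall>j\<in>{2..d}. ereal (l j) \<le> x j \<and> x j \<le> ereal (r j))}"

definition "V = uniform_measure W C"

text \<open>Outside the base, a null set for \<open>V\<close>, the corner \<open>l\<close> is
  substituted. This way \<open>foot\<close> and \<open>point\<close> take values in the domain
  everywhere and are measurable into \<open>M0 d x0\<close>.\<close>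

definition clamp :: "(nat \<Rightarrow> real) \<Rightarrow> (nat \<Rightarrow> real)" where
  "clamp w = (if w \<in> C then w else (\<lambda>j\<in>{2..d}. l j))"

definition foot :: "(nat \<Rightarrow> real) \<Rightarrow> (nat \<Rightarrow> ereal)" where
  "foot w = emb d ((clamp w)(1 := r0))"

definition point :: "(nat \<Rightarrow> real) \<Rightarrow> real \<Rightarrow> (nat \<Rightarrow> ereal)" where
  "point w v = raise (foot w) (max 0 (v * h))"

lemma C_sets: "C \<in> sets W"
  unfolding C_def by (rule sets_PiM_I_finite) auto

lemma emeasure_C: "emeasure W C = ennreal (\<Prod>j\<in>{2..d}. r j - l j)" and C_pos: "0 < (\<Prod>j\<in>{2..d}. r j - l j)"
proof -
  interpret product_sigma_finite "\<lambda>_. lborel :: real measure" ..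
  have "emeasure W C = (\<Prod>j\<in>{2..d}. emeasure lborel {l j..r j})"
    unfolding C_def by (rule emeasure_PiM) auto
  also have "\<dots> = (\<Prod>j\<in>{2..d}. ennreal (r j - l j))"
    using lr by (intro prod.cong) (auto simp: less_imp_le)
  also have "\<dots> = ennreal (\<Prod>j\<in>{2..d}. r j - l j)"
    using lr by (intro prod_ennreal) (auto simp: less_imp_le)
  finally show "emeasure W C = ennreal (\<Prod>j\<in>{2..d}. r j - l j)" .
  show "0 < (\<Prod>j\<in>{2..d}. r j - l j)" using lr by (intro prod_pos) auto
qed

lemma prob_V: "prob_space V"
  unfolding V_def
proof (rule prob_space_uniform_measure)
  show "emeasure W C \<noteq> 0" using C_pos unfolding emeasure_C by (metis ennreal_eq_0_iff not_le)
qed (simp add: emeasure_C)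

lemma AE_V: "AE w in V. w \<in> C"
  unfolding V_def by (rule AE_uniform_measureI) (use C_sets in auto)

lemma sets_V [measurable_cong]: "sets V = sets W"
  by (simp add: V_def)

lemma clamp_in_C: "clamp w \<in> C"
  using lr by (auto simp: clamp_def C_def less_imp_le)

lemma foot_in_D0: "foot w \<in> D0 d x0"
proof -
  have "x0 j \<le> ereal (clamp w j)" if "j \<in> {2..d}" for j
  proof -
    have "l j \<le> clamp w j" using clamp_in_C[of w] that by (auto simp: C_def PiE_iff)
    then show ?thesis using x0_l[OF that] by (meson ereal_less_eq(3) order_trans)
  qed
  then show ?thesis using d x0_1
    by (auto simp: D0_def space_amb foot_def emb_def coords_eq)
qed

lemma measurable_foot: "foot \<in> measurable W (M0 d x0)"
proof (rule measurable_M0I)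
  have [measurable]: "C \<in> sets W" by (rule C_sets)
  have "(\<lambda>j\<in>{2..d}. l j) \<in> space W" by (auto simp: space_PiM)
  then have clamp: "clamp \<in> measurable W W" unfolding clamp_def by measurable
  have "(\<lambda>w. (clamp w)(1 := r0)) \<in> measurable W (PiM {1..d} (\<lambda>_. lborel :: real measure))"
    by (rule measurable_fun_upd[where J="{2..d}"]) (use clamp coords_eq in auto)
  from measurable_compose[OF this measurable_emb] show "foot \<in> measurable W (amb d)"
    by (simp add: foot_def[abs_def])
qed (rule foot_in_D0)

lemma measurable_point [measurable]: "(\<lambda>p. point (fst p) (snd p)) \<in> measurable (W \<Otimes>\<^sub>M borel) (M0 d x0)"
  unfolding point_def using measurable_foot by measurable

lemma emb_foot: "w \<in> C \<Longrightarrow> emb d (w(1 := s)) = raise (foot w) (s - r0)"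
  by (simp add: foot_def clamp_def emb_update)

lemma K_sets: "K \<in> sets (M0 d x0)"
proof -
  have [measurable]: "\<And>j. j \<in> {2..d} \<Longrightarrow> (\<lambda>x. x j) \<in> borel_measurable (M0 d x0)"
    by (rule measurable_coord) auto
  show ?thesis unfolding K_def by (intro sets_Collect_D0) measurable
qed

lemma POU_K: "POU_set d x0 K"
  unfolding POU_set_def
proof (intro conjI K_sets ballI allI impI, elim conjE)
  fix x t assume x: "x \<in> K" and t: "x0 1 \<le> t" "t \<le> x 1"
  have xD: "x \<in> D0 d x0" using x by (simp add: K_def)
  have "t < \<infinity>" using t(2) D0_D[OF xD, of 1] d by (auto intro: le_less_trans)
  moreover have "ereal r0 \<le> t" using t(1) by simp
  ultimately obtain s where s: "t = ereal s" "r0 \<le> s"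
    by (cases t) (auto simp del: ereal_r0)
  have "x(1 := t) = raise x (s - r0)" by (simp add: raise_def s)
  then have "x(1 := t) \<in> D0 d x0" using xD s(2) by simp
  then show "x(1 := t) \<in> K" using x t(2) by (auto simp: K_def intro: order_trans)
qed

text \<open>Substitute s = r0 + h v: over the base, negative v leave the domain, v > 1 leave the
  box, and the two endpoints are null.\<close>

lemma slice_K:
  assumes A: "A \<in> sets (M0 d x0)" and w: "w \<in> space W"
  shows "(\<integral>\<^sup>+s. indicator (K \<inter> A) (emb d (w(1 := s))) \<partial>lborel)
    = ennreal h * ((\<integral>\<^sup>+v. indicator A (point w v) \<partial>UU) * indicator C w)"
proof (cases "w \<in> C")
  case False
  have "emb d (w(1 := s)) \<notin> K" for s
  proof
    assume "emb d (w(1 := s)) \<in> K"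
    then have "\<forall>j\<in>{2..d}. l j \<le> w j \<and> w j \<le> r j" by (auto simp: K_def emb_def)
    moreover have "w \<in> extensional {2..d}" using w by (auto simp: space_PiM PiE_iff)
    ultimately show False using False by (auto simp: C_def PiE_iff)
  qed
  then show ?thesis using False by simp
next
  case True
  have m: "(\<lambda>v. point w v) \<in> measurable borel (M0 d x0)"
    using measurable_compose[OF measurable_Pair1'[OF w] measurable_point] by simp
  have K_iff: "raise (foot w) s \<in> K \<longleftrightarrow> s \<le> h" if "0 \<le> s" for s
  proof -
    have "\<forall>j\<in>{2..d}. l j \<le> w j \<and> w j \<le> r j" using True by (auto simp: C_def PiE_iff)
    then have "\<forall>j\<in>{2..d}. ereal (l j) \<le> foot w j \<and> foot w j \<le> ereal (r j)"
      using True by (auto simp: foot_def emb_def clamp_def)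
    then show ?thesis using that foot_in_D0[of w] by (auto simp: K_def)
  qed
  have "(\<integral>\<^sup>+s. indicator (K \<inter> A) (emb d (w(1 := s))) \<partial>lborel)
      = ennreal \<bar>h\<bar> * (\<integral>\<^sup>+v. indicator (K \<inter> A) (emb d (w(1 := r0 + h * v))) \<partial>lborel)"
  proof (rule nn_integral_real_affine)
    show "(\<lambda>s. indicator (K \<inter> A) (emb d (w(1 := s))) :: ennreal) \<in> borel_measurable borel"
      using measurable_compose[OF measurable_Pair1'[OF w] measurable_emb_slice[OF sets.Int[OF K_sets A]]] by simp
  qed (use h in simp)
  also have "(\<integral>\<^sup>+v. indicator (K \<inter> A) (emb d (w(1 := r0 + h * v))) \<partial>lborel)
      = (\<integral>\<^sup>+v. indicator A (point w v) * indicator {0<..<1} v \<partial>lborel)"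
  proof (rule nn_integral_cong_AE)
    have "AE v in lborel. v \<noteq> (0::real)" "AE v in lborel. v \<noteq> (1::real)" by (auto intro: AE_lborel_singleton)
    then show "AE v in lborel. indicator (K \<inter> A) (emb d (w(1 := r0 + h * v)))
        = (indicator A (point w v) * indicator {0<..<1} v :: ennreal)"
    proof eventually_elim
      case (elim v)
      have e: "emb d (w(1 := r0 + h * v)) = raise (foot w) (v * h)" by (simp add: emb_foot[OF True] mult.commute)
      show ?case
      proof (cases "0 < v")
        case pos: True
        then have "0 \<le> v * h" using h by simp
        moreover have "v * h \<le> h \<longleftrightarrow> v < 1" using h elim by auto
        ultimately show ?thesis using pos by (auto simp: e point_def K_iff indicator_def)
      next
        case False
        then have "v * h < 0" using elim h by (simp add: mult_neg_pos)
        then have "raise (foot w) (v * h) \<notin> D0 d x0" using D0_coord_1(2)[of "raise (foot w) (v * h)"] by auto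
        then show ?thesis using False by (simp add: e K_def)
      qed
    qed
  qed
  also have "\<dots> = (\<integral>\<^sup>+v. indicator A (point w v) \<partial>UU)"
    by (rule nn_integral_UU[symmetric]) (use m A in measurable)
  finally show ?thesis using True h by (simp del: fun_upd_apply)
qed

lemma measurable_slice:
  assumes A[measurable]: "A \<in> sets (M0 d x0)"
  shows "(\<lambda>w. \<integral>\<^sup>+v. indicator A (point w v) \<partial>UU) \<in> borel_measurable W"
proof -
  interpret U: prob_space UU by (rule prob_UU)
  have sets_UU[measurable_cong]: "sets UU = sets borel" by simp
  have "(\<lambda>p. indicator A (point (fst p) (snd p)) :: ennreal) \<in> borel_measurable (W \<Otimes>\<^sub>M borel)" by measurable
  then have "(\<lambda>(w, v). indicator A (point w v) :: ennreal) \<in> borel_measurable (W \<Otimes>\<^sub>M UU)"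
    by (simp add: case_prod_beta' cong: measurable_cong_sets)
  then show ?thesis by (rule U.borel_measurable_nn_integral)
qed

lemma emeasure_K_Int:
  assumes A: "A \<in> sets (M0 d x0)"
  shows "emeasure (Leb0 d x0) (K \<inter> A)
    = ennreal h * (\<integral>\<^sup>+w. (\<integral>\<^sup>+v. indicator A (point w v) \<partial>UU) * indicator C w \<partial>W)"
proof -
  have "emeasure (Leb0 d x0) (K \<inter> A)
      = (\<integral>\<^sup>+w. ennreal h * ((\<integral>\<^sup>+v. indicator A (point w v) \<partial>UU) * indicator C w) \<partial>W)"
    unfolding emeasure_Leb0[OF sets.Int[OF K_sets A]]
    by (rule nn_integral_cong) (rule slice_K[OF A])
  also have "\<dots> = ennreal h * (\<integral>\<^sup>+w. (\<integral>\<^sup>+v. indicator A (point w v) \<partial>UU) * indicator C w \<partial>W)"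
    by (rule nn_integral_cmult) (use measurable_slice[OF A] C_sets in measurable)
  finally show ?thesis .
qed

lemma point_in_D0: "point w v \<in> D0 d x0"
  unfolding point_def by (rule raise_in_D0) (auto simp: foot_in_D0)

lemma emeasure_K: "emeasure (Leb0 d x0) K = ennreal h * emeasure W C"
proof -
  interpret U: prob_space UU by (rule prob_UU)
  have "K = K \<inter> D0 d x0" by (auto simp: K_def)
  then have "emeasure (Leb0 d x0) K = ennreal h * (\<integral>\<^sup>+w. (\<integral>\<^sup>+v. indicator (D0 d x0) (point w v) \<partial>UU) * indicator C w \<partial>W)"
    using emeasure_K_Int[of "D0 d x0"] sets.top[of "M0 d x0"] by (simp add: space_M0)
  also have "(\<lambda>w. (\<integral>\<^sup>+v. indicator (D0 d x0) (point w v) \<partial>UU) * indicator C w) = (indicator C :: _ \<Rightarrow> ennreal)"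
    using U.emeasure_space_1 by (simp add: point_in_D0)
  finally show ?thesis using C_sets by simp
qed

lemma emeasure_K_pos: "0 < emeasure (Leb0 d x0) K" "emeasure (Leb0 d x0) K < \<infinity>"
  unfolding emeasure_K emeasure_C using h C_pos by (auto simp: ennreal_mult[symmetric] less_imp_le)

lemma unif_K: "uniform_measure (Leb0 d x0) K \<in> unif_POU d x0"
  unfolding unif_POU_def using POU_K emeasure_K_pos by blast

text \<open>The box is the product of its base and a segment, so by Tonelli its uniform law is the
  image of two independent uniform variables; the factor \<open>h\<close> cancels against the
  normalisation.\<close>

lemma uniform_K_eq_distr:
  "uniform_measure (Leb0 d x0) K = distr (V \<Otimes>\<^sub>M UU) (M0 d x0) (\<lambda>p. point (fst p) (snd p))"
proof (rule measure_eqI)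
  interpret U: prob_space UU by (rule prob_UU)
  have sets_UU[measurable_cong]: "sets UU = sets borel" by simp
  fix A assume "A \<in> sets (uniform_measure (Leb0 d x0) K)"
  then have A[measurable]: "A \<in> sets (M0 d x0)" by simp
  let ?I = "\<integral>\<^sup>+w. (\<integral>\<^sup>+v. indicator A (point w v) \<partial>UU) * indicator C w \<partial>W"
  have pm: "(\<lambda>p. point (fst p) (snd p)) \<in> measurable (V \<Otimes>\<^sub>M UU) (M0 d x0)"
    using measurable_point by (simp add: sets_V cong: measurable_cong_sets sets_pair_measure_cong)
  have "emeasure (distr (V \<Otimes>\<^sub>M UU) (M0 d x0) (\<lambda>p. point (fst p) (snd p))) A
      = (\<integral>\<^sup>+x. indicator A x \<partial>distr (V \<Otimes>\<^sub>M UU) (M0 d x0) (\<lambda>p. point (fst p) (snd p)))" by simp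
  also have "\<dots> = (\<integral>\<^sup>+p. indicator A (point (fst p) (snd p)) \<partial>(V \<Otimes>\<^sub>M UU))"
    by (rule nn_integral_distr[OF pm]) simp
  also have "\<dots> = (\<integral>\<^sup>+w. (\<integral>\<^sup>+v. indicator A (point w v) \<partial>UU) \<partial>V)"
    using pm by (subst U.nn_integral_fst[symmetric]) auto
  also have "\<dots> = ?I / emeasure W C"
    unfolding V_def by (rule nn_integral_uniform_measure[OF measurable_slice[OF A] C_sets])
  finally have distr: "emeasure (distr (V \<Otimes>\<^sub>M UU) (M0 d x0) (\<lambda>p. point (fst p) (snd p))) A = ?I / emeasure W C" .
  have "emeasure (uniform_measure (Leb0 d x0) K) A = (ennreal h * ?I) / (ennreal h * emeasure W C)"
    using K_sets A by (simp add: emeasure_K_Int[OF A] emeasure_K)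
  also have "\<dots> = ?I / emeasure W C"
  \<comment> \<open>Cancelling \<open>h\<close> in \<open>ennreal\<close> goes through real
    inverses, as both the height and the base volume are positive and finite.\<close>
  proof -
    let ?c = "\<Prod>j\<in>{2..d}. r j - l j"
    have "inverse (ennreal h * ennreal ?c) = ennreal (1 / h) * ennreal (1 / ?c)"
      using h C_pos by (simp add: ennreal_mult[symmetric] inverse_ennreal inverse_eq_divide less_imp_le del: prod_pos)
    moreover have "ennreal h * ennreal (1 / h) = 1" using h by (simp add: ennreal_mult[symmetric])
    moreover have "inverse (ennreal ?c) = ennreal (1 / ?c)"
      using C_pos by (simp add: inverse_ennreal inverse_eq_divide)
    moreover have "(ennreal h * ?I) * (ennreal (1 / h) * ennreal (1 / ?c))
        = (ennreal h * ennreal (1 / h)) * (?I * ennreal (1 / ?c))" by (simp only: ac_simps)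
    ultimately show ?thesis unfolding emeasure_C divide_ennreal_def by (simp only: mult_1)
  qed
  finally show "emeasure (uniform_measure (Leb0 d x0) K) A
      = emeasure (distr (V \<Otimes>\<^sub>M UU) (M0 d x0) (\<lambda>p. point (fst p) (snd p))) A" by (simp only: distr)
qed simp

text \<open>The base variable is integrated inside: for fixed v this inner integral converges as the
  base shrinks, and the outer one is then a matter of dominated convergence.\<close>

lemma integral_uniform_K:
  fixes f :: "(nat \<Rightarrow> ereal) \<Rightarrow> real"
  assumes f[measurable]: "f \<in> borel_measurable (M0 d x0)" and B: "\<And>x. x \<in> D0 d x0 \<Longrightarrow> \<bar>f x\<bar> \<le> B"
  shows "(\<integral>x. f x \<partial>uniform_measure (Leb0 d x0) K) = (\<integral>v. (\<integral>w. f (point w v) \<partial>V) \<partial>UU)"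
    and "(\<lambda>v. \<integral>w. f (point w v) \<partial>V) \<in> borel_measurable borel"
    and "(\<lambda>w. f (point w v)) \<in> borel_measurable V"
proof -
  interpret U: prob_space UU by (rule prob_UU)
  interpret V: prob_space V by (rule prob_V)
  interpret VU: pair_prob_space V UU ..
  have sets_UU[measurable_cong]: "sets UU = sets borel" by simp
  have pm[measurable]: "(\<lambda>p. point (fst p) (snd p)) \<in> measurable (V \<Otimes>\<^sub>M UU) (M0 d x0)"
    using measurable_point by (simp add: sets_V cong: measurable_cong_sets sets_pair_measure_cong)
  have fm: "(\<lambda>p. f (point (fst p) (snd p))) \<in> borel_measurable (V \<Otimes>\<^sub>M UU)" by measurable
  have int: "integrable (V \<Otimes>\<^sub>M UU) (\<lambda>p. f (point (fst p) (snd p)))"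
    by (rule VU.P.integrable_const_bound[where B=B]) (use fm B point_in_D0 in auto)
  have "(\<integral>x. f x \<partial>uniform_measure (Leb0 d x0) K) = (\<integral>p. f (point (fst p) (snd p)) \<partial>(V \<Otimes>\<^sub>M UU))"
    unfolding uniform_K_eq_distr by (rule integral_distr[OF pm f])
  also have "\<dots> = (\<integral>v. (\<integral>w. f (point w v) \<partial>V) \<partial>UU)"
    using int by (subst VU.integral_snd) (simp_all add: case_prod_beta')
  finally show "(\<integral>x. f x \<partial>uniform_measure (Leb0 d x0) K) = (\<integral>v. (\<integral>w. f (point w v) \<partial>V) \<partial>UU)" .
  have "(\<lambda>p. f (point (snd p) (fst p))) \<in> borel_measurable (borel \<Otimes>\<^sub>M V)"
    using measurable_compose[OF measurable_pair_swap'[of borel V] _, of "\<lambda>p. f (point (fst p) (snd p))" borel] fm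
    by (simp add: case_prod_beta' sets_UU cong: measurable_cong_sets sets_pair_measure_cong)
  then show "(\<lambda>v. \<integral>w. f (point w v) \<partial>V) \<in> borel_measurable borel"
    by (intro V.borel_measurable_lebesgue_integral) (simp add: case_prod_beta')
  show "(\<lambda>w. f (point w v)) \<in> borel_measurable V"
    using measurable_compose[OF measurable_Pair2'[of v UU V] fm] by simp
qed

end

lemma tendsto_coordinatewise:
  fixes X :: "'b \<Rightarrow> 'a \<Rightarrow> 'c::topological_space"
  assumes "\<And>i. ((\<lambda>n. X n i) \<longlongrightarrow> l i) F"
  shows "(X \<longlongrightarrow> l) F"
proof -
  have "limitin (product_topology (\<lambda>_. euclidean) UNIV) X l F"
    unfolding limitin_componentwise using assms by simp
  then show ?thesis by (simp add: euclidean_product_topology)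
qed

lemma (in prob_space) abs_expectation_diff_le:
  fixes f :: "'a \<Rightarrow> real"
  assumes f: "integrable M f" and le: "AE x in M. \<bar>f x - c\<bar> \<le> e"
  shows "\<bar>expectation f - c\<bar> \<le> e"
proof -
  have "expectation f - c = expectation (\<lambda>x. f x - c)" using f by (simp add: prob_space)
  also have "\<bar>\<dots>\<bar> \<le> expectation (\<lambda>x. \<bar>f x - c\<bar>)" by (rule integral_abs_bound)
  also have "\<dots> \<le> expectation (\<lambda>x. e)"
  proof (rule integral_mono_AE[OF _ _ le])
    show "integrable M (\<lambda>x. \<bar>f x - c\<bar>)" using f by simp
  qed simp
  finally show ?thesis by (simp add: prob_space)
qed

section \<open>Boxes shrinking to a segment, and weak approximation of lifts\<close>

context pou
begin

text \<open>The limit is integration against the lift of the point mass at z. A finite coordinate is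
  enclosed in [z j, z j + 1 / (k + 1)], to the right of z j so as to stay in the domain. As
  \<open>Leb0\<close> does not charge points with a coordinate -\<infinity>, such a coordinate is
  approached by the unit intervals [-k - 1, -k] moving off to -\<infinity>; there x0 j is
  -\<infinity> too.\<close>

lemma unif_POU_tendsto_point:
  assumes z: "z \<in> D0 d x0" and hz: "0 < height z"
  obtains U where "\<And>k. U k \<in> unif_POU d x0"
    "\<And>f. continuous_on (D0 d x0) f \<Longrightarrow> bounded (f ` D0 d x0) \<Longrightarrow> f \<in> borel_measurable (M0 d x0) \<Longrightarrow>
      (\<lambda>k::nat. \<integral>x. f x \<partial>U k) \<longlonglongrightarrow> (\<integral>v. f (lift_map (z, v)) \<partial>UU :: real)"
proof -
  define l where "l k j = (if z j = -\<infinity> then - real k - 1 else real_of_ereal (z j))" for k :: nat and j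
  define r where "r k j = l k j + (if z j = -\<infinity> then 1 else inverse (real (Suc k)))" for k :: nat and j
  have z_fin: "z j = ereal (real_of_ereal (z j))" if "j \<in> {2..d}" "z j \<noteq> -\<infinity>" for j
    using D0_D[OF z, of j] that by (cases "z j") auto
  have box: "pou_box d x0 (height z) (l k) (r k)" for k
  proof unfold_locales
    show "0 < height z" by (rule hz)
    show "l k j < r k j" if "j \<in> {2..d}" for j by (simp add: r_def)
    show "x0 j \<le> ereal (l k j)" if j: "j \<in> {2..d}" for j
    proof (cases "z j = -\<infinity>")
      case True
      then have "x0 j = -\<infinity>" using D0_D[OF z, of j] j by auto
      then show ?thesis by simp
    next
      case False
      then show ?thesis using D0_D[OF z, of j] j z_fin[OF j False] by (simp add: l_def)
    qed
  qed
  have r_lim: "(\<lambda>k. ereal (r k j)) \<longlonglongrightarrow> z j" if j: "j \<in> {2..d}" for j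
  proof (cases "z j = -\<infinity>")
    case True
    have "filterlim (\<lambda>k. - real k) at_bot sequentially"
      by (simp add: filterlim_uminus_at_bot filterlim_real_sequentially)
    then have "((\<lambda>k. ereal (- real k)) \<longlongrightarrow> -\<infinity>) sequentially"
      by (simp add: tendsto_MInfty filterlim_at_bot_dense)
    then show ?thesis using True by (simp add: r_def l_def)
  next
    case False
    have "(\<lambda>k. ereal (real_of_ereal (z j) + inverse (real (Suc k)))) \<longlonglongrightarrow> ereal (real_of_ereal (z j))"
      by (intro tendsto_intros LIMSEQ_inverse_real_of_nat_add)
    then show ?thesis using False z_fin[OF j False] by (simp add: r_def l_def)
  qed
  have r_mono: "r k j \<le> r m j" if "m \<le> k" for k m j
    using that by (auto simp: r_def l_def field_simps)
  let ?C = "\<lambda>k. pou_box.C d (l k) (r k)" and ?pt = "\<lambda>k. pou_box.point d x0 (height z) (l k) (r k)"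
  let ?U = "\<lambda>k. uniform_measure (Leb0 d x0) (pou_box.K d x0 (height z) (l k) (r k))"
  have C_D: "l k j \<le> w j \<and> w j \<le> r k j" if "w \<in> ?C k" "j \<in> {2..d}" for k w j
    using that unfolding pou_box.C_def[OF box] by (auto simp: PiE_iff)
  have pt_eq: "?pt k w v = raise (emb d w) (max 0 (v * height z))" if "w \<in> ?C k" for k w v
    unfolding pou_box.point_def[OF box] pou_box.foot_def[OF box] pou_box.clamp_def[OF box]
    using that by (simp add: emb_update)
  \<comment> \<open>Indices with n \<le> \<kappa> n and points in the bases are arbitrary here,
    because the uniform convergence below is proved by contradiction from a sequence of bad
    choices.\<close>
  have pt_lim: "(\<lambda>n. ?pt (\<kappa> n) (w n) v) \<longlonglongrightarrow> lift_map (z, v)"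
    if \<kappa>: "\<And>n. n \<le> \<kappa> n" and w: "\<And>n. w n \<in> ?C (\<kappa> n)" for \<kappa> w v
  proof (rule tendsto_coordinatewise)
    fix j
    consider "j = 1" | "j \<in> {2..d}" | "j \<notin> {1..d}" using coords_eq by auto
    then show "(\<lambda>n. ?pt (\<kappa> n) (w n) v j) \<longlonglongrightarrow> lift_map (z, v) j"
    proof cases
      case 1
      then show ?thesis by (simp add: pt_eq[OF w] lift_map_def)
    next
      case 2
      have eq: "?pt (\<kappa> n) (w n) v j = ereal (w n j)" for n
        using 2 by (simp add: pt_eq[OF w] emb_def)
      have "(\<lambda>n. ereal (w n j)) \<longlonglongrightarrow> z j"
      proof (rule tendsto_sandwich[OF _ _ tendsto_const r_lim[OF 2]])
        show "\<forall>\<^sub>F n in sequentially. z j \<le> ereal (w n j)"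
        proof (intro always_eventually allI)
          fix n
          show "z j \<le> ereal (w n j)"
          proof (cases "z j = -\<infinity>")
            case False
            then have "z j = ereal (l (\<kappa> n) j)" using z_fin[OF 2] by (simp add: l_def)
            then show ?thesis using C_D[OF w 2, of n] by simp
          qed simp
        qed
        show "\<forall>\<^sub>F n in sequentially. ereal (w n j) \<le> ereal (r n j)"
        proof (intro always_eventually allI)
          fix n
          show "ereal (w n j) \<le> ereal (r n j)" using C_D[OF w 2, of n] r_mono[OF \<kappa>[of n], of j] by simp
        qed
      qed
      then show ?thesis using 2 by (simp add: eq lift_map_def)
    next
      \<comment> \<open>Convergence is in the product over all natural numbers; outside
        \<open>{1..d}\<close> both sides are \<open>undefined\<close>.\<close>
      case 3
      have "z \<in> extensional {1..d}" using z by (auto simp: D0_def space_amb PiE_iff)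
      then have "z j = undefined" using 3 by (auto simp: extensional_def)
      moreover have "j \<noteq> 1" using 3 d by auto
      moreover have "emb d w' j = undefined" for w' using 3 by (auto simp: emb_def)
      ultimately show ?thesis by (simp add: pt_eq[OF w] lift_map_def raise_def)
    qed
  qed
  have lift_D0: "lift_map (z, v) \<in> D0 d x0" for v using z by (simp add: lift_map_def)
  have pt_D0: "?pt k w v \<in> D0 d x0" for k w v by (rule pou_box.point_in_D0[OF box])
  show thesis
  proof (rule that[of ?U])
    show "?U k \<in> unif_POU d x0" for k by (rule pou_box.unif_K[OF box])
    fix f :: "(nat \<Rightarrow> ereal) \<Rightarrow> real"
    assume cont: "continuous_on (D0 d x0) f" and bdd: "bounded (f ` D0 d x0)" and f: "f \<in> borel_measurable (M0 d x0)"
    obtain B where B: "\<And>x. x \<in> D0 d x0 \<Longrightarrow> \<bar>f x\<bar> \<le> B" using bdd by (auto simp: bounded_iff)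
    interpret U: prob_space UU by (rule prob_UU)
    \<comment> \<open>Continuity alone gives no uniform modulus on the domain. If the bound over the
      bases failed, violating points could be chosen in boxes of ever larger index; by
      \<open>pt_lim\<close> they converge, against continuity at the limit.\<close>
    have unif: "\<exists>N. \<forall>k\<ge>N. \<forall>w\<in>?C k. \<bar>f (?pt k w v) - f (lift_map (z, v))\<bar> \<le> e" if e: "0 < e" for e v
    proof (rule ccontr)
      assume "\<not> ?thesis"
      then have "\<exists>k. N \<le> k \<and> (\<exists>w. w \<in> ?C k \<and> e < \<bar>f (?pt k w v) - f (lift_map (z, v))\<bar>)" for N
        by (simp only: not_ex not_all not_imp Ball_def not_le)
      then obtain \<kappa> where \<kappa>1: "\<And>n. n \<le> \<kappa> n"
        and "\<And>n. \<exists>w. w \<in> ?C (\<kappa> n) \<and> e < \<bar>f (?pt (\<kappa> n) w v) - f (lift_map (z, v))\<bar>" by metis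
      then obtain w where w: "\<And>n. w n \<in> ?C (\<kappa> n)"
        and far: "\<And>n. e < \<bar>f (?pt (\<kappa> n) (w n) v) - f (lift_map (z, v))\<bar>" by metis
      note \<kappa> = \<kappa>1 w
      have "(\<lambda>n. f (?pt (\<kappa> n) (w n) v)) \<longlonglongrightarrow> f (lift_map (z, v))"
        by (rule continuous_on_tendsto_compose[OF cont pt_lim[OF \<kappa>] lift_D0]) (simp add: pt_D0)
      then have "\<forall>\<^sub>F n in sequentially. dist (f (?pt (\<kappa> n) (w n) v)) (f (lift_map (z, v))) < e"
        using e by (rule tendstoD)
      then obtain n where "dist (f (?pt (\<kappa> n) (w n) v)) (f (lift_map (z, v))) < e"
        unfolding eventually_sequentially by blast
      with far[of n] show False by (simp add: dist_real_def)
    qed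
    have inner: "(\<lambda>k. \<integral>w. f (?pt k w v) \<partial>pou_box.V d (l k) (r k)) \<longlonglongrightarrow> f (lift_map (z, v))" for v
    proof (rule LIMSEQ_I)
      fix e :: real assume e: "0 < e"
      then obtain N where N: "\<And>k w. N \<le> k \<Longrightarrow> w \<in> ?C k \<Longrightarrow> \<bar>f (?pt k w v) - f (lift_map (z, v))\<bar> \<le> e / 2"
        using unif[of "e / 2" v] by auto
      have "norm ((\<integral>w. f (?pt k w v) \<partial>pou_box.V d (l k) (r k)) - f (lift_map (z, v))) < e" if k: "N \<le> k" for k
      proof -
        interpret V: prob_space "pou_box.V d (l k) (r k)" by (rule pou_box.prob_V[OF box])
        have int: "integrable (pou_box.V d (l k) (r k)) (\<lambda>w. f (?pt k w v))"
          by (rule V.integrable_const_bound[where B=B])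
             (use B pt_D0 pou_box.integral_uniform_K(3)[OF box f B] in auto)
        have "AE w in pou_box.V d (l k) (r k). \<bar>f (?pt k w v) - f (lift_map (z, v))\<bar> \<le> e / 2"
          using pou_box.AE_V[OF box] by eventually_elim (rule N[OF k])
        from V.abs_expectation_diff_le[OF int this] show ?thesis using e by simp
      qed
      then show "\<exists>N. \<forall>k\<ge>N. norm ((\<integral>w. f (?pt k w v) \<partial>pou_box.V d (l k) (r k)) - f (lift_map (z, v))) < e" by blast
    qed
    have "(\<lambda>k. \<integral>v. (\<integral>w. f (?pt k w v) \<partial>pou_box.V d (l k) (r k)) \<partial>UU) \<longlonglongrightarrow> (\<integral>v. f (lift_map (z, v)) \<partial>UU)"
    proof (rule integral_dominated_convergence[where w="\<lambda>_. B"])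
      have "(\<lambda>v. lift_map (z, v)) \<in> measurable borel (M0 d x0)"
        by (rule measurable_compose[OF measurable_Pair1' measurable_lift_map]) (simp add: space_M0 z)
      from measurable_compose[OF this f] show "(\<lambda>v. f (lift_map (z, v))) \<in> borel_measurable UU" by simp
      show "(\<lambda>v. \<integral>w. f (?pt k w v) \<partial>pou_box.V d (l k) (r k)) \<in> borel_measurable UU" for k
        using pou_box.integral_uniform_K(2)[OF box f B] by simp
      show "AE v in UU. norm (\<integral>w. f (?pt k w v) \<partial>pou_box.V d (l k) (r k)) \<le> B" for k
      proof (rule AE_I2)
        fix v
        interpret V: prob_space "pou_box.V d (l k) (r k)" by (rule pou_box.prob_V[OF box])
        have int: "integrable (pou_box.V d (l k) (r k)) (\<lambda>w. f (?pt k w v))"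
          by (rule V.integrable_const_bound[where B=B])
             (use B pt_D0 pou_box.integral_uniform_K(3)[OF box f B] in auto)
        show "norm (\<integral>w. f (?pt k w v) \<partial>pou_box.V d (l k) (r k)) \<le> B"
          using V.abs_expectation_diff_le[OF int, of 0 B] B[OF pt_D0] by simp
      qed
    qed (use inner in auto)
    then show "(\<lambda>k. \<integral>x. f x \<partial>?U k) \<longlonglongrightarrow> (\<integral>v. f (lift_map (z, v)) \<partial>UU)"
      using pou_box.integral_uniform_K(1)[OF box f B] by simp
  qed
qed

lemma integral_lift_dist:
  fixes f :: "(nat \<Rightarrow> ereal) \<Rightarrow> real"
  assumes Q: "prob_space Q" "sets Q = sets (M0 d x0)"
    and f[measurable]: "f \<in> borel_measurable (M0 d x0)" and B: "\<And>x. x \<in> D0 d x0 \<Longrightarrow> \<bar>f x\<bar> \<le> B"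
  shows "(\<integral>x. f x \<partial>lift_dist d x0 Q) = (\<integral>z. (\<integral>v. f (lift_map (z, v)) \<partial>UU) \<partial>Q)"
proof -
  interpret Q: prob_space Q by fact
  interpret U: prob_space UU by (rule prob_UU)
  interpret QU: pair_prob_space Q UU ..
  note Q(2)[measurable_cong]
  have sets_UU[measurable_cong]: "sets UU = sets borel" by simp
  have lm[measurable]: "lift_map \<in> measurable (Q \<Otimes>\<^sub>M UU) (M0 d x0)" by measurable
  have int: "integrable (Q \<Otimes>\<^sub>M UU) (\<lambda>p. f (lift_map p))"
  proof (rule QU.P.integrable_const_bound[where B=B])
    show "AE p in Q \<Otimes>\<^sub>M UU. norm (f (lift_map p)) \<le> B"
      by (rule AE_I2) (use B measurable_space[OF lm] in \<open>auto simp: space_M0\<close>)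
  qed measurable
  show ?thesis
    unfolding lift_dist_eq[OF Q] by (simp add: integral_distr[OF lm f] QU.integral_fst'[OF int])
qed

text \<open>Integrating f against the lift is integrating \<phi> f against \<open>Q\<close>. As
  \<phi> f is bounded and measurable, \<open>Q\<close> may be replaced by a finitely supported law,
  and at each of its points \<phi> f is approximated by a uniform law on a thin box. The mixture of
  these laws lies in the convex hull.\<close>

lemma is_1POU_lift_dist:
  assumes Q: "prob_space Q" "sets Q = sets (M0 d x0)" and pos: "AE z in Q. 0 < height z"
  shows "is_1POU d x0 (lift_dist d x0 Q)"
proof -
  interpret Q: prob_space Q by fact
  interpret U: prob_space UU by (rule prob_UU)
  note Q(2)[measurable_cong]
  have sets_UU[measurable_cong]: "sets UU = sets borel" by simp
  have space_Q: "space Q = D0 d x0" using sets_eq_imp_space_eq[OF Q(2)] by (simp add: space_M0)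
  have approx: "\<exists>R\<in>conv_hull_meas (M0 d x0) (unif_POU d x0).
      \<forall>f\<in>F. \<bar>(\<integral>x. f x \<partial>lift_dist d x0 Q) - (\<integral>x. f x \<partial>R)\<bar> < \<epsilon>"
    if F: "finite F" "\<And>f. f \<in> F \<Longrightarrow> continuous_on (D0 d x0) f \<and> bounded (f ` D0 d x0) \<and> f \<in> borel_measurable (M0 d x0)"
      and \<epsilon>: "0 < \<epsilon>" for F :: "((nat \<Rightarrow> ereal) \<Rightarrow> real) set" and \<epsilon>
  proof -
    have "\<forall>f\<in>F. \<exists>b. \<forall>x\<in>D0 d x0. \<bar>f x\<bar> \<le> b" using F(2) by (auto simp: bounded_iff)
    then obtain b where b: "\<And>f x. f \<in> F \<Longrightarrow> x \<in> D0 d x0 \<Longrightarrow> \<bar>f x\<bar> \<le> b f" by metis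
    define B where "B = Max (insert 0 (b ` F))"
    have B: "\<bar>f x\<bar> \<le> B" if "f \<in> F" "x \<in> D0 d x0" for f x
      using b[OF that] F(1) that(1) by (auto simp: B_def intro!: order_trans[OF _ Max_ge])
    define \<phi> where "\<phi> f z = (\<integral>v. f (lift_map (z, v)) \<partial>UU)" for f :: "(nat \<Rightarrow> ereal) \<Rightarrow> real" and z
    have lift_int: "integrable UU (\<lambda>v. f (lift_map (z, v)))" and lift_D0: "lift_map (z, v) \<in> D0 d x0"
      if "f \<in> F" "z \<in> D0 d x0" for f z v
    proof -
      show D0: "lift_map (z, v) \<in> D0 d x0" for v using that by (simp add: lift_map_def)
      have "(\<lambda>v. lift_map (z, v)) \<in> measurable borel (M0 d x0)"
        by (rule measurable_compose[OF measurable_Pair1' measurable_lift_map]) (simp add: space_M0 that)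
      from measurable_compose[OF this, of f borel]
      have "(\<lambda>v. f (lift_map (z, v))) \<in> borel_measurable UU" using F(2)[OF that(1)] by simp
      then show "integrable UU (\<lambda>v. f (lift_map (z, v)))"
        by (intro U.integrable_const_bound[where B=B]) (use B[OF that(1) D0] in auto)
    qed
    have \<phi>_meas: "\<phi> f \<in> borel_measurable Q" if "f \<in> F" for f
    proof -
      have [measurable]: "f \<in> borel_measurable (M0 d x0)" using F(2)[OF that] by simp
      show ?thesis unfolding \<phi>_def by measurable
    qed
    have \<phi>_B: "\<bar>\<phi> f z\<bar> \<le> B" if "f \<in> F" "z \<in> D0 d x0" for f z
    proof -
      show ?thesis
        unfolding \<phi>_def using U.abs_expectation_diff_le[OF lift_int[OF that], of 0 B] B[OF that(1) lift_D0[OF that]] by simp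
    qed
    have lift_\<phi>: "(\<integral>x. f x \<partial>lift_dist d x0 Q) = (\<integral>z. \<phi> f z \<partial>Q)" if "f \<in> F" for f
      unfolding \<phi>_def using F(2)[OF that] B[OF that] by (intro integral_lift_dist[OF Q]) auto
    \<comment> \<open>The support points are taken from here because boxes require a positive
      height.\<close>
    define S where "S = {z \<in> D0 d x0. 0 < height z}"
    have S: "S \<in> sets Q" "AE z in Q. z \<in> S"
    proof -
      show "S \<in> sets Q" unfolding S_def Q(2) by (rule sets_Collect_D0) measurable
      show "AE z in Q. z \<in> S" using pos AE_space by eventually_elim (simp add: S_def space_Q)
    qed
    obtain Y p where Y: "finite Y" "Y \<subseteq> S" "\<And>y. y \<in> Y \<Longrightarrow> 0 \<le> p y" "(\<Sum>y\<in>Y. p y) = (1::real)"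
      and close: "\<And>g. g \<in> \<phi> ` F \<Longrightarrow> \<bar>(\<integral>x. g x \<partial>Q) - (\<Sum>y\<in>Y. p y * g y)\<bar> \<le> \<epsilon> / 3"
    proof (rule finite_support_approximation[OF Q(1), of "\<phi> ` F" B S "\<epsilon> / 3"])
      show "finite (\<phi> ` F)" using F(1) by simp
    qed (use \<phi>_meas \<phi>_B S \<epsilon> space_Q in auto)
    have "\<exists>U\<in>unif_POU d x0. \<forall>f\<in>F. \<bar>(\<integral>x. f x \<partial>U) - \<phi> f y\<bar> < \<epsilon> / 3" if "y \<in> Y" for y
    proof -
      have y: "y \<in> D0 d x0" "0 < height y" using that Y(2) by (auto simp: S_def)
      obtain U where U: "\<And>k. U k \<in> unif_POU d x0"
        "\<And>f. continuous_on (D0 d x0) f \<Longrightarrow> bounded (f ` D0 d x0) \<Longrightarrow> f \<in> borel_measurable (M0 d x0) \<Longrightarrow>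
          (\<lambda>k::nat. \<integral>x. f x \<partial>U k) \<longlonglongrightarrow> (\<integral>v. f (lift_map (y, v)) \<partial>UU :: real)"
        using unif_POU_tendsto_point[OF y] by blast
      have "\<forall>\<^sub>F k in sequentially. \<forall>f\<in>F. dist (\<integral>x. f x \<partial>U k) (\<phi> f y) < \<epsilon> / 3"
      proof (intro eventually_ball_finite F(1) ballI tendstoD)
        fix f assume "f \<in> F"
        then show "(\<lambda>k. \<integral>x. f x \<partial>U k) \<longlonglongrightarrow> \<phi> f y" unfolding \<phi>_def using F(2) U(2) by blast
      qed (use \<epsilon> in simp)
      then obtain k where "\<forall>f\<in>F. dist (\<integral>x. f x \<partial>U k) (\<phi> f y) < \<epsilon> / 3"
        unfolding eventually_sequentially by blast
      then show ?thesis using U(1)[of k] by (auto simp: dist_real_def)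
    qed
    then obtain U where U: "\<And>y. y \<in> Y \<Longrightarrow> U y \<in> unif_POU d x0"
      and U_close: "\<And>y f. y \<in> Y \<Longrightarrow> f \<in> F \<Longrightarrow> \<bar>(\<integral>x. f x \<partial>U y) - \<phi> f y\<bar> < \<epsilon> / 3" by metis
    \<comment> \<open>Mixtures are indexed by lists; distinct entries keep a weight from being
      counted twice.\<close>
    obtain ys where ys: "set ys = Y" "distinct ys" using finite_distinct_list[OF Y(1)] by blast
    define ps where "ps = map (\<lambda>y. (p y, U y)) ys"
    have ps_sum: "(\<Sum>(w, R)\<leftarrow>ps. w * g R) = (\<Sum>y\<in>Y. p y * g (U y))" for g :: "_ \<Rightarrow> real"
      unfolding ps_def ys(1)[symmetric] using ys(2) by (simp add: comp_def sum_list_distinct_conv_sum_set)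
    have ps: "\<And>w R. (w, R) \<in> set ps \<Longrightarrow> 0 \<le> w \<and> R \<in> unif_POU d x0"
      using Y(3) U ys(1) by (auto simp: ps_def)
    have ps1: "(\<Sum>(w, R)\<leftarrow>ps. w) = 1" using ps_sum[of "\<lambda>_. 1"] Y(4) by simp
    have "ps \<noteq> []" using ps1 by auto
    then have hull: "mixture (M0 d x0) ps \<in> conv_hull_meas (M0 d x0) (unif_POU d x0)"
      unfolding conv_hull_meas_def using ps ps1 by blast
    show ?thesis
    proof (rule bexI[OF _ hull], rule ballI)
      fix f assume f: "f \<in> F"
      have "(\<integral>x. f x \<partial>mixture (M0 d x0) ps) = (\<Sum>(w, R)\<leftarrow>ps. w * (\<integral>x. f x \<partial>R))"
        by (rule integral_mixture[OF _ ps1, where B=B])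
           (use ps unif_POU_D(1,2) F(2)[OF f] B[OF f] in \<open>auto simp: space_M0\<close>)
      then have mix: "(\<integral>x. f x \<partial>mixture (M0 d x0) ps) = (\<Sum>y\<in>Y. p y * (\<integral>x. f x \<partial>U y))"
        by (simp only: ps_sum)
      have "\<bar>(\<Sum>y\<in>Y. p y * \<phi> f y) - (\<Sum>y\<in>Y. p y * (\<integral>x. f x \<partial>U y))\<bar>
          = \<bar>\<Sum>y\<in>Y. p y * (\<phi> f y - (\<integral>x. f x \<partial>U y))\<bar>"
        by (simp add: right_diff_distrib sum_subtractf)
      also have "\<dots> \<le> (\<Sum>y\<in>Y. \<bar>p y * (\<phi> f y - (\<integral>x. f x \<partial>U y))\<bar>)" by (rule sum_abs)
      \<comment> \<open>The average is only bounded by \<le>, as is the error of the finite support.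
        Two errors of \<epsilon> / 3 leave the room for the strict bound \<epsilon>.\<close>
      also have "\<dots> \<le> (\<Sum>y\<in>Y. p y * (\<epsilon> / 3))"
      proof (rule sum_mono)
        fix y assume y: "y \<in> Y"
        have "\<bar>\<phi> f y - (\<integral>x. f x \<partial>U y)\<bar> \<le> \<epsilon> / 3" using U_close[OF y f] by linarith
        then show "\<bar>p y * (\<phi> f y - (\<integral>x. f x \<partial>U y))\<bar> \<le> p y * (\<epsilon> / 3)"
          using Y(3)[OF y] by (simp only: abs_mult abs_of_nonneg mult_left_mono)
      qed
      also have "\<dots> = \<epsilon> / 3" by (simp only: sum_distrib_right[symmetric] Y(4) mult_1)
      finally have "\<bar>(\<integral>z. \<phi> f z \<partial>Q) - (\<Sum>y\<in>Y. p y * (\<integral>x. f x \<partial>U y))\<bar> < \<epsilon>"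
        using close[OF imageI[OF f]] \<epsilon> by linarith
      then show "\<bar>(\<integral>x. f x \<partial>lift_dist d x0 Q) - (\<integral>x. f x \<partial>mixture (M0 d x0) ps)\<bar> < \<epsilon>"
        by (simp only: lift_\<phi>[OF f] mix)
    qed
  qed
  show ?thesis
    unfolding is_1POU_def weak_closure_def mem_Collect_eq
    by (intro conjI allI impI prob_space_lift_dist[OF Q] sets_lift_dist[OF Q] approx) auto
qed

end

section \<open>Equivalence of the two problems\<close>

context pou
begin

lemma MOM_feasible_AE_height_pos:
  assumes "Q \<in> MOM_feasible d n x0 c u a b lo hi"
  shows "AE z in Q. 0 < height z"
proof -
  have "sets Q = sets (M0 d x0)" "(\<integral>\<^sup>+z. inv_gap x0 z \<partial>Q) \<le> ennreal (u / c)"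
    using assms by (auto simp: MOM_feasible_def)
  then show ?thesis by (intro AE_height_pos) (auto intro: le_less_trans)
qed

lemma scale_lift_dist_DRO_feasible:
  assumes c: "0 < c" and u: "0 \<le> u"
    and boxes: "\<forall>i\<in>{1..n}. \<forall>j\<in>{1..d}. x0 j \<le> lo i j \<and> lo i j \<le> hi i j"
    and Q: "Q \<in> MOM_feasible d n x0 c u a b lo hi"
  shows "scale_measure (ennreal c) (lift_dist d x0 Q) \<in> DRO_feasible d n x0 c u a b lo hi"
proof -
  have Q': "prob_space Q" "sets Q = sets (M0 d x0)" and gap: "(\<integral>\<^sup>+z. inv_gap x0 z \<partial>Q) \<le> ennreal (u / c)"
    and abQ: "\<And>i. i \<in> {1..n} \<Longrightarrow> a i \<le> (\<integral>z. box_ratio d x0 lo hi i z \<partial>Q) \<and> (\<integral>z. box_ratio d x0 lo hi i z \<partial>Q) \<le> b i"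
    using Q by (auto simp: MOM_feasible_def)
  note pos = MOM_feasible_AE_height_pos[OF Q]
  interpret L: prob_space "lift_dist d x0 Q" by (rule prob_space_lift_dist[OF Q'])
  have total: "emeasure (lift_dist d x0 Q) (D0 d x0) = 1"
    using L.emeasure_space_1 sets_eq_imp_space_eq[OF sets_lift_dist[OF Q']] by (simp add: space_M0)
  have box: "measure (lift_dist d x0 Q) (box d x0 lo hi i) = (\<integral>z. box_ratio d x0 lo hi i z \<partial>Q)"
    if "i \<in> {1..n}" for i
    by (rule measure_lift_dist_box[OF Q' pos]) (use boxes that d in auto)
  have finite: "finite_measure (scale_measure (ennreal c) (lift_dist d x0 Q))"
    by (rule finite_measureI)
       (use L.emeasure_space_1 in \<open>simp add: space_scale_measure\<close>)
  show ?thesis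
    unfolding DRO_feasible_def mem_Collect_eq
  proof (intro conjI ballI)
    have "ennreal (1 / c) * ennreal c = 1" using c by (simp add: ennreal_mult[symmetric])
    then show "is_1POU d x0 (scale_measure (ennreal (1 / c)) (scale_measure (ennreal c) (lift_dist d x0 Q)))"
      using is_1POU_lift_dist[OF Q' pos] by simp
    show "X1_density_bound d x0 (scale_measure (ennreal c) (lift_dist d x0 Q)) u"
      by (rule X1_density_bound_lift_dist[OF Q' c u gap])
    fix i assume i: "i \<in> {1..n}"
    show "a i * c \<le> measure (scale_measure (ennreal c) (lift_dist d x0 Q)) (box d x0 lo hi i)"
      "measure (scale_measure (ennreal c) (lift_dist d x0 Q)) (box d x0 lo hi i) \<le> b i * c"
      using abQ[OF i] c by (simp_all add: box[OF i] mult.commute)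
  qed (use finite total emeasure_lift_dist_bottom[OF Q' pos] Q' in auto)
qed

lemma measure_scale_lift_dist_Sset:
  assumes c: "0 < c" and Q: "Q \<in> MOM_feasible d n x0 c u a b lo hi"
    and g: "g1 \<in> borel_measurable (PiM {2..d} (\<lambda>_. (borel :: ereal measure)))"
      "g2 \<in> borel_measurable (PiM {2..d} (\<lambda>_. (borel :: ereal measure)))"
    and g_range: "\<forall>y\<in>PiE {2..d} (\<lambda>_. UNIV). (\<forall>j\<in>{2..d}. x0 j \<le> y j \<and> y j < \<infinity>) \<longrightarrow>
                    x0 1 \<le> g1 y \<and> g1 y \<le> g2 y"
  shows "measure (scale_measure (ennreal c) (lift_dist d x0 Q)) (Sset d x0 g1 g2) = MOM_obj d x0 c g1 g2 Q"
proof -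
  have "prob_space Q" "sets Q = sets (M0 d x0)" using Q by (auto simp: MOM_feasible_def)
  from measure_lift_dist_Sset[OF this MOM_feasible_AE_height_pos[OF Q] g g_range]
  show ?thesis using c by (simp add: MOM_obj_def)
qed

text \<open>Converse to \<open>scale_lift_dist_DRO_feasible\<close>: 1-POU supplies the contraction
  inequality, which with the absence of mass at the bottom gives a representing \<open>Q\<close>.
  The constraints on \<open>P\<close> translate back through the integral formulas for
  lifts.\<close>

lemma DRO_feasible_eq_scale_lift_dist:
  assumes c: "0 < c" and u: "0 \<le> u"
    and boxes: "\<forall>i\<in>{1..n}. \<forall>j\<in>{1..d}. x0 j \<le> lo i j \<and> lo i j \<le> hi i j"
    and P: "P \<in> DRO_feasible d n x0 c u a b lo hi"
  obtains Q where "Q \<in> MOM_feasible d n x0 c u a b lo hi" "P = scale_measure (ennreal c) (lift_dist d x0 Q)"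
proof -
  let ?P = "scale_measure (ennreal (1 / c)) P"
  have P1: "is_1POU d x0 ?P" and bottom: "emeasure P {x \<in> D0 d x0. x 1 = x0 1} = 0"
    and dens: "X1_density_bound d x0 P u"
    and abP: "\<And>i. i \<in> {1..n} \<Longrightarrow> a i * c \<le> measure P (box d x0 lo hi i) \<and> measure P (box d x0 lo hi i) \<le> b i * c"
    using P by (auto simp: DRO_feasible_def)
  have P': "prob_space ?P" "sets ?P = sets (M0 d x0)" using P1 by (auto simp: is_1POU_def)
  obtain Q where Q: "prob_space Q" "sets Q = sets (M0 d x0)" "AE z in Q. 0 < height z" "lift_dist d x0 Q = ?P"
    by (rule lift_dist_eq_if_shrink[OF P']) (use bottom is_1POU_shrink[OF P1] in auto)
  have "ennreal c * ennreal (1 / c) = 1" using c by (simp add: ennreal_mult[symmetric])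
  then have P_eq: "P = scale_measure (ennreal c) (lift_dist d x0 Q)" by (simp add: Q(4))
  have box: "measure P (box d x0 lo hi i) = c * (\<integral>z. box_ratio d x0 lo hi i z \<partial>Q)" if "i \<in> {1..n}" for i
  proof -
    have "measure (lift_dist d x0 Q) (box d x0 lo hi i) = (\<integral>z. box_ratio d x0 lo hi i z \<partial>Q)"
      by (rule measure_lift_dist_box[OF Q(1-3)]) (use boxes that d in auto)
    then show ?thesis using c by (simp add: P_eq)
  qed
  have "Q \<in> MOM_feasible d n x0 c u a b lo hi"
    unfolding MOM_feasible_def mem_Collect_eq
  proof (intro conjI ballI Q)
    show "(\<integral>\<^sup>+z. inv_gap x0 z \<partial>Q) \<le> ennreal (u / c)"
      by (rule inv_gap_le_if_X1_density_bound[OF Q(1,2) c u Q(3)]) (use dens P_eq in simp)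
    fix i assume i: "i \<in> {1..n}"
    show "a i \<le> (\<integral>z. box_ratio d x0 lo hi i z \<partial>Q)" "(\<integral>z. box_ratio d x0 lo hi i z \<partial>Q) \<le> b i"
      using abP[OF i] c by (simp_all add: box[OF i] mult.commute)
  qed
  then show thesis using P_eq by (rule that)
qed

end

theorem mainTheorem18:
  fixes d n :: nat and x0 :: "nat \<Rightarrow> ereal" and c u :: real
    and a b :: "nat \<Rightarrow> real" and lo hi :: "nat \<Rightarrow> nat \<Rightarrow> ereal"
    and g1 g2 :: "(nat \<Rightarrow> ereal) \<Rightarrow> ereal"
  assumes d: "1 \<le> d"
    and x0_1: "\<bar>x0 1\<bar> \<noteq> \<infinity>"
    and x0_fin: "\<forall>j\<in>{1..d}. x0 j < \<infinity>"
    and c: "0 < c" and u: "0 \<le> u"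
    and ab: "\<forall>i\<in>{1..n}. 0 \<le> a i \<and> a i \<le> b i \<and> b i \<le> 1"
    and boxes: "\<forall>i\<in>{1..n}. \<forall>j\<in>{1..d}. x0 j \<le> lo i j \<and> lo i j \<le> hi i j"
    and g1_meas: "g1 \<in> borel_measurable (PiM {2..d} (\<lambda>_. (borel :: ereal measure)))"
    and g2_meas: "g2 \<in> borel_measurable (PiM {2..d} (\<lambda>_. (borel :: ereal measure)))"
    and g_range: "\<forall>y\<in>PiE {2..d} (\<lambda>_. UNIV). (\<forall>j\<in>{2..d}. x0 j \<le> y j \<and> y j < \<infinity>) \<longrightarrow>
                    x0 1 \<le> g1 y \<and> g1 y \<le> g2 y"
  shows "(SUP P\<in>DRO_feasible d n x0 c u a b lo hi. ereal (measure P (Sset d x0 g1 g2)))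
           = (SUP Q\<in>MOM_feasible d n x0 c u a b lo hi. ereal (MOM_obj d x0 c g1 g2 Q))
         \<and> (\<forall>Qs\<in>MOM_feasible d n x0 c u a b lo hi.
              ereal (MOM_obj d x0 c g1 g2 Qs)
                = (SUP Q\<in>MOM_feasible d n x0 c u a b lo hi. ereal (MOM_obj d x0 c g1 g2 Q)) \<longrightarrow>
              scale_measure (ennreal c) (lift_dist d x0 Qs) \<in> DRO_feasible d n x0 c u a b lo hi \<and>
              ereal (measure (scale_measure (ennreal c) (lift_dist d x0 Qs)) (Sset d x0 g1 g2))
                = (SUP P\<in>DRO_feasible d n x0 c u a b lo hi. ereal (measure P (Sset d x0 g1 g2))))"
proof -
  interpret pou d x0 by unfold_locales (use d x0_1 in auto)
  let ?D = "DRO_feasible d n x0 c u a b lo hi" and ?M = "MOM_feasible d n x0 c u a b lo hi"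
  let ?L = "\<lambda>Q. scale_measure (ennreal c) (lift_dist d x0 Q)"
  \<comment> \<open>With one feasible set the image of the other and equal objectives along the map,
    both suprema range over the same values; if there is no feasible point, both are
    -\<infinity>.\<close>
  have D_eq: "?D = ?L ` ?M"
    using scale_lift_dist_DRO_feasible[OF c u boxes] DRO_feasible_eq_scale_lift_dist[OF c u boxes]
    by (blast elim: DRO_feasible_eq_scale_lift_dist[OF c u boxes])
  have obj: "measure (?L Q) (Sset d x0 g1 g2) = MOM_obj d x0 c g1 g2 Q" if "Q \<in> ?M" for Q
    by (rule measure_scale_lift_dist_Sset[OF c that g1_meas g2_meas g_range])
  have sup: "(SUP P\<in>?D. ereal (measure P (Sset d x0 g1 g2))) = (SUP Q\<in>?M. ereal (MOM_obj d x0 c g1 g2 Q))"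
    unfolding D_eq image_image by (rule SUP_cong) (simp_all only: obj)
  show ?thesis
  proof (intro conjI ballI impI sup)
    fix Q assume Q: "Q \<in> ?M" and opt: "ereal (MOM_obj d x0 c g1 g2 Q) = (SUP Q\<in>?M. ereal (MOM_obj d x0 c g1 g2 Q))"
    show "?L Q \<in> ?D" using Q D_eq by blast
    show "ereal (measure (?L Q) (Sset d x0 g1 g2)) = (SUP P\<in>?D. ereal (measure P (Sset d x0 g1 g2)))"
      by (simp only: obj[OF Q] opt sup)
  qed
qed

end
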